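(* The functor $\mathcal{F}^m:\mathbf{Pcoh}_!\to\mathbf{Cstab_m}$ ($X\mapsto\mathcal{F}^mX$, $f\mapsto\hat f$) is a cartesian closed, full and faithful functor: it is full and faithful, for every finite family $(X_i)_{i\in I}$ of PCSs the canonical map $x\mapsto((x_{(i,a)})_a)_i$ is an isomorphism in $\mathbf{Cstab_m}$ from $\mathcal{F}^m(\prod_iX_i)$ to $\prod_i^{\mathbf{Cstab_m}}\mathcal{F}^mX_i$, and for all PCSs $X,Y$ the map $f\mapsto\hat f$ is an isomorphism in $\mathbf{Cstab_m}$ from $\mathcal{F}^m(X\Rightarrow Y)$ to $\mathcal{F}^mX\Rightarrow\mathcal{F}^mY$.
   Context: PCS $X=(|X|,\mathcal{P}(X))$: $|X|$ countable, $\mathcal{P}(X)\subseteq\mathbb{R}_{\ge0}^{|X|}$, $\mathcal{P}(X)^{\perp\perp}=\mathcal{P}(X)$ with $S^\perp=\{u:\sum_au_av_a\le1\ \forall v\in S\}$, each $a$ having $\lambda>0$ with $\lambda e_a\in\mathcal{P}(X)$ and a bound on $u_a$ over $\mathcal{P}(X)$. $\mathbf{Pcoh}_!$: objects PCSs; $\mathbf{Pcoh}_!(X,Y)$: $f\in\mathbb{R}_{\ge0}^{\mathcal{M}_{fin}(|X|)\times|Y|}$ with $\hat f(x):=f\cdot x^!\in\mathcal{P}(Y)$ for $x\in\mathcal{P}(X)$, $(f\cdot x^!)_b=\sum_\mu f_{\mu,b}\prod_ax_a^{\mu(a)}$; composition corresponds to composing the $\hat f$. $\prod_iX_i$: web $\bigcup_i\{i\}\times|X_i|$,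 cliques $x$ with $(x_{(i,a)})_a\in\mathcal{P}(X_i)$ for all $i$. $X\Rightarrow Y$: web $\mathcal{M}_{fin}(|X|)\times|Y|$, cliques $\mathbf{Pcoh}_!(X,Y)$. Cone $\mathcal{F}X=\{\alpha x:\alpha\ge0,x\in\mathcal{P}(X)\}$, pointwise operations, norm $\inf\{1/r:r>0,rx\in\mathcal{P}(X)\}$, unit ball $\mathcal{P}(X)$. Measurable cone: sequentially complete cone $C$ with families $\mathcal{M}_n(C)$ of functions from $\mathbb{R}^n$ to linear Scott-continuous maps $C\to\mathbb{R}_{\ge0}$, containing $0$, closed under precomposition with Borel measurable maps, with $\vec u\mapsto l(\vec u)(x)$ measurable. Measurable path of arity $n$: $\gamma:\mathbb{R}^n\to C$ with bounded image and $(\vec r,\vec s)\mapsto l(\vec r)(\gamma(\vec s))$ Borel measurable for all $l\in\mathcal{M}_k(C)$; unitary if image in unit ball. $\mathbf{Cstab_m}$: objects measurable cones; morphisms $C\to D$ are stable functions (pre-stable: $\sum_{I\subseteq\{1..n\},\,n-|I|\text{ odd}}f(x+\sum_{i\in I}u_i)\le\sum_{I,\,n-|I|\text{ even}}f(x+\sum_{i\in I}u_i)$ whenever $x+\sum u_i$ in the unit ball; preserving lubs of nondecreasing sequences; bounded) from unit ball to unit ball, sending unitary measurable paths to measurable paths. Finite products: tuples, componentwise operations, max norm, tests $\bigoplus_il_i$ with $(\bigoplus_il_i)(\vec r)((x_i))=\sum_il_i(\vec r)(x_i)$, $l_i\in\mathcal{M}_n(C_i)$. Exponential $C\Rightarrow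 D$: stable functions sending unitary measurable paths to measurable paths, pointwise operations, norm $\sup_{x\in\mathcal{B}C}\|f(x)\|$, tests $\gamma\triangleright m$ ($\gamma$ measurable path of arity $n$ of $C$, $m\in\mathcal{M}_n(D)$) with $(\gamma\triangleright m)(\vec r)(f)=m(\vec r)(f(\gamma(\vec r)))$. $\mathcal{F}^mX$ is $\mathcal{F}X$ with tests $\mathcal{M}_n=\{0\}\cup\{\epsilon_a:a\in|X|\}$, $\epsilon_a(\vec r)(x)=x_a$. *)

theory Defs
  imports "HOL-Analysis.Analysis" "HOL-Algebra.FiniteProduct" "HOL-Library.Multiset"
begin

section \<open>Probabilistic coherence spaces\<close>

text \<open>Vectors of nonnegative reals indexed by a web \<open>A\<close> are represented by functions on the whole
  type that vanish outside \<open>A\<close>.\<close>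

definition nnvecs :: "'a set \<Rightarrow> ('a \<Rightarrow> real) set" where
  "nnvecs A = {u. (\<forall>a\<in>A. 0 \<le> u a) \<and> (\<forall>a. a \<notin> A \<longrightarrow> u a = 0)}"

definition pdual :: "'a set \<Rightarrow> ('a \<Rightarrow> real) set \<Rightarrow> ('a \<Rightarrow> real) set" where
  "pdual A S = {u \<in> nnvecs A. \<forall>v\<in>S. (\<lambda>a. u a * v a) summable_on A \<and> (\<Sum>\<^sub>\<infinity>a\<in>A. u a * v a) \<le> 1}"

record 'a pcs =
  web :: "'a set"
  cliques :: "('a \<Rightarrow> real) set"

definition is_pcs :: "'a pcs \<Rightarrow> bool" where
  "is_pcs X \<longleftrightarrow>
     countable (web X) \<and>
     cliques X \<subseteq> nnvecs (web X) \<and>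
     pdual (web X) (pdual (web X) (cliques X)) = cliques X \<and>
     (\<forall>a\<in>web X. (\<exists>c>0. (\<lambda>b. if b = a then c else 0) \<in> cliques X) \<and>
                (\<exists>B. \<forall>u\<in>cliques X. u a \<le> B))"

definition mfin :: "'a set \<Rightarrow> 'a multiset set" where
  "mfin A = {\<mu>. set_mset \<mu> \<subseteq> A}"

definition mpow :: "('a \<Rightarrow> real) \<Rightarrow> 'a multiset \<Rightarrow> real" where
  "mpow x \<mu> = (\<Prod>a\<in>set_mset \<mu>. x a ^ count \<mu> a)"

definition hat :: "'a pcs \<Rightarrow> ('a multiset \<times> 'b \<Rightarrow> real) \<Rightarrow> ('a \<Rightarrow> real) \<Rightarrow> ('b \<Rightarrow> real)" where
  "hat X f x = (\<lambda>b. \<Sum>\<^sub>\<infinity>\<mu>\<in>mfin (web X). f (\<mu>, b) * mpow x \<mu>)"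

text \<open>Since a divergent \<open>infsum\<close> is \<open>0\<close>, finiteness of the series is a separate requirement.\<close>

definition pcoh_hom :: "'a pcs \<Rightarrow> 'b pcs \<Rightarrow> ('a multiset \<times> 'b \<Rightarrow> real) set" where
  "pcoh_hom X Y = {f \<in> nnvecs (mfin (web X) \<times> web Y). \<forall>x\<in>cliques X.
      (\<forall>b\<in>web Y. (\<lambda>\<mu>. f (\<mu>, b) * mpow x \<mu>) summable_on mfin (web X)) \<and>
      hat X f x \<in> cliques Y}"

definition pcoh_id :: "'a pcs \<Rightarrow> ('a multiset \<times> 'a \<Rightarrow> real)" where
  "pcoh_id X = (\<lambda>(\<mu>, a). if a \<in> web X \<and> \<mu> = {#a#} then 1 else 0)"

text \<open>\<open>promotion f \<mu> \<nu>\<close> is the coefficient of \<open>x\<^sup>\<mu>\<close> in the formal product, over the occurrences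
  \<open>b\<close> in \<open>\<nu>\<close>, of the power series \<open>\<Sum>m. f (m, b) x\<^sup>m\<close>. It does not depend on the enumeration
  chosen for \<open>\<nu>\<close>, and it is a finite sum.\<close>

definition promotion :: "('a multiset \<times> 'b \<Rightarrow> real) \<Rightarrow> 'a multiset \<Rightarrow> 'b multiset \<Rightarrow> real" where
  "promotion f \<mu> \<nu> =
     (let bs = (SOME bs. mset bs = \<nu>)
      in \<Sum>ms | length ms = length bs \<and> sum_list ms = \<mu>. \<Prod>i<length bs. f (ms ! i, bs ! i))"

definition pcoh_comp ::
  "'b pcs \<Rightarrow> ('b multiset \<times> 'c \<Rightarrow> real) \<Rightarrow> ('a multiset \<times> 'b \<Rightarrow> real) \<Rightarrow> ('a multiset \<times> 'c \<Rightarrow> real)" where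
  "pcoh_comp Y g f = (\<lambda>(\<mu>, c). \<Sum>\<^sub>\<infinity>\<nu>\<in>mfin (web Y). g (\<nu>, c) * promotion f \<mu> \<nu>)"

definition pcs_prod :: "'i set \<Rightarrow> ('i \<Rightarrow> 'a pcs) \<Rightarrow> ('i \<times> 'a) pcs" where
  "pcs_prod I X = \<lparr>web = (SIGMA i:I. web (X i)),
     cliques = {x \<in> nnvecs (SIGMA i:I. web (X i)). \<forall>i\<in>I. (\<lambda>a. x (i, a)) \<in> cliques (X i)}\<rparr>"

definition pcs_exp :: "'a pcs \<Rightarrow> 'b pcs \<Rightarrow> ('a multiset \<times> 'b) pcs" where
  "pcs_exp X Y = \<lparr>web = mfin (web X) \<times> web Y, cliques = pcoh_hom X Y\<rparr>"

section \<open>Measurable cones\<close>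

abbreviation Rn :: "nat \<Rightarrow> (nat \<Rightarrow> real) measure" where
  "Rn n \<equiv> Pi\<^sub>M {..<n} (\<lambda>_. borel)"

record 'c mcone =
  elems :: "'c set"
  czero :: 'c
  cadd :: "'c \<Rightarrow> 'c \<Rightarrow> 'c"
  cscale :: "real \<Rightarrow> 'c \<Rightarrow> 'c"
  cnorm :: "'c \<Rightarrow> real"
  tests :: "nat \<Rightarrow> ((nat \<Rightarrow> real) \<Rightarrow> 'c \<Rightarrow> real) set"

definition cone_monoid :: "'c mcone \<Rightarrow> 'c monoid" where
  "cone_monoid C = \<lparr>carrier = elems C, monoid.mult = cadd C, one = czero C\<rparr>"

definition csum :: "'c mcone \<Rightarrow> ('i \<Rightarrow> 'c) \<Rightarrow> 'i set \<Rightarrow> 'c" where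
  "csum C f A = finprod (cone_monoid C) f A"

definition is_cone :: "'c mcone \<Rightarrow> bool" where
  "is_cone C \<longleftrightarrow>
     comm_monoid (cone_monoid C) \<and>
     (\<forall>\<alpha>\<ge>0. \<forall>x\<in>elems C. cscale C \<alpha> x \<in> elems C) \<and>
     (\<forall>\<alpha>\<ge>0. \<forall>x\<in>elems C. \<forall>y\<in>elems C.
        cscale C \<alpha> (cadd C x y) = cadd C (cscale C \<alpha> x) (cscale C \<alpha> y)) \<and>
     (\<forall>\<alpha>\<ge>0. \<forall>\<beta>\<ge>0. \<forall>x\<in>elems C. cscale C (\<alpha> + \<beta>) x = cadd C (cscale C \<alpha> x) (cscale C \<beta> x)) \<and>
     (\<forall>\<alpha>\<ge>0. \<forall>\<beta>\<ge>0. \<forall>x\<in>elems C. cscale C (\<alpha> * \<beta>) x = cscale C \<alpha> (cscale C \<beta> x)) \<and>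
     (\<forall>x\<in>elems C. cscale C 1 x = x) \<and>
     (\<forall>x\<in>elems C. cscale C 0 x = czero C) \<and>
     (\<forall>\<alpha>\<ge>0. cscale C \<alpha> (czero C) = czero C) \<and>
     (\<forall>x\<in>elems C. \<forall>y\<in>elems C. \<forall>z\<in>elems C. cadd C x y = cadd C x z \<longrightarrow> y = z) \<and>
     (\<forall>x\<in>elems C. 0 \<le> cnorm C x) \<and>
     (\<forall>\<alpha>\<ge>0. \<forall>x\<in>elems C. cnorm C (cscale C \<alpha> x) = \<alpha> * cnorm C x) \<and>
     (\<forall>x\<in>elems C. cnorm C x = 0 \<longrightarrow> x = czero C) \<and>
     (\<forall>x\<in>elems C. \<forall>y\<in>elems C. cnorm C (cadd C x y) \<le> cnorm C x + cnorm C y) \<and>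
     (\<forall>x\<in>elems C. \<forall>y\<in>elems C. cnorm C x \<le> cnorm C (cadd C x y))"

definition unit_ball :: "'c mcone \<Rightarrow> 'c set" where
  "unit_ball C = {x \<in> elems C. cnorm C x \<le> 1}"

definition cle :: "'c mcone \<Rightarrow> 'c \<Rightarrow> 'c \<Rightarrow> bool" where
  "cle C x y \<longleftrightarrow> (\<exists>z\<in>elems C. y = cadd C x z)"

definition nondecreasing :: "'c mcone \<Rightarrow> (nat \<Rightarrow> 'c) \<Rightarrow> bool" where
  "nondecreasing C x \<longleftrightarrow> (\<forall>n. x n \<in> elems C) \<and> (\<forall>n. cle C (x n) (x (Suc n)))"

definition is_seq_lub :: "'c mcone \<Rightarrow> (nat \<Rightarrow> 'c) \<Rightarrow> 'c \<Rightarrow> bool" where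
  "is_seq_lub C x s \<longleftrightarrow> s \<in> elems C \<and> (\<forall>n. cle C (x n) s) \<and>
     (\<forall>t\<in>elems C. (\<forall>n. cle C (x n) t) \<longrightarrow> cle C s t)"

definition seq_complete :: "'c mcone \<Rightarrow> bool" where
  "seq_complete C \<longleftrightarrow> (\<forall>x. nondecreasing C x \<and> range x \<subseteq> unit_ball C \<longrightarrow>
     (\<exists>s\<in>unit_ball C. is_seq_lub C x s))"

definition linear_scott :: "'c mcone \<Rightarrow> ('c \<Rightarrow> real) \<Rightarrow> bool" where
  "linear_scott C l \<longleftrightarrow>
     (\<forall>x\<in>elems C. 0 \<le> l x) \<and>
     (\<forall>x\<in>elems C. \<forall>y\<in>elems C. l (cadd C x y) = l x + l y) \<and>
     (\<forall>\<alpha>\<ge>0. \<forall>x\<in>elems C. l (cscale C \<alpha> x) = \<alpha> * l x) \<and>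
     (\<forall>x s. nondecreasing C x \<and> is_seq_lub C x s \<longrightarrow>
        bdd_above (range (\<lambda>n. l (x n))) \<and> l s = (SUP n. l (x n)))"

text \<open>Members of \<open>tests C n\<close> stand for their restrictions to \<open>\<real>\<^sup>n\<close> and \<open>elems C\<close>; their values
  elsewhere carry no meaning, so membership conditions are up to agreement there.\<close>

definition measurable_cone :: "'c mcone \<Rightarrow> bool" where
  "measurable_cone C \<longleftrightarrow>
     is_cone C \<and> seq_complete C \<and>
     (\<forall>n. \<forall>l\<in>tests C n. \<forall>r\<in>space (Rn n). linear_scott C (l r)) \<and>
     (\<forall>n. \<exists>l\<in>tests C n. \<forall>r\<in>space (Rn n). \<forall>x\<in>elems C. l r x = 0) \<and>
     (\<forall>m n. \<forall>l\<in>tests C n. \<forall>h\<in>measurable (Rn m) (Rn n).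
        \<exists>l'\<in>tests C m. \<forall>r\<in>space (Rn m). \<forall>x\<in>elems C. l' r x = l (h r) x) \<and>
     (\<forall>n. \<forall>l\<in>tests C n. \<forall>x\<in>elems C. (\<lambda>r. l r x) \<in> borel_measurable (Rn n))"

definition meas_path :: "'c mcone \<Rightarrow> nat \<Rightarrow> ((nat \<Rightarrow> real) \<Rightarrow> 'c) \<Rightarrow> bool" where
  "meas_path C n \<gamma> \<longleftrightarrow>
     (\<forall>s\<in>space (Rn n). \<gamma> s \<in> elems C) \<and>
     (\<exists>B. \<forall>s\<in>space (Rn n). cnorm C (\<gamma> s) \<le> B) \<and>
     (\<forall>k. \<forall>l\<in>tests C k. (\<lambda>(r, s). l r (\<gamma> s)) \<in> borel_measurable (Rn k \<Otimes>\<^sub>M Rn n))"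

definition unitary_path :: "'c mcone \<Rightarrow> nat \<Rightarrow> ((nat \<Rightarrow> real) \<Rightarrow> 'c) \<Rightarrow> bool" where
  "unitary_path C n \<gamma> \<longleftrightarrow> meas_path C n \<gamma> \<and> (\<forall>s\<in>space (Rn n). \<gamma> s \<in> unit_ball C)"

section \<open>Stable functions and the category of measurable cones\<close>

definition pre_stable :: "'c mcone \<Rightarrow> 'd mcone \<Rightarrow> ('c \<Rightarrow> 'd) \<Rightarrow> bool" where
  "pre_stable C D f \<longleftrightarrow>
     (\<forall>(n::nat) x u. x \<in> elems C \<and> (\<forall>i\<in>{1..n}. u i \<in> elems C) \<and>
        cadd C x (csum C u {1..n}) \<in> unit_ball C \<longrightarrow>
        cle D
          (csum D (\<lambda>J. f (cadd C x (csum C u J))) {J. J \<subseteq> {1..n} \<and> odd (n - card J)})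
          (csum D (\<lambda>J. f (cadd C x (csum C u J))) {J. J \<subseteq> {1..n} \<and> even (n - card J)}))"

definition stable :: "'c mcone \<Rightarrow> 'd mcone \<Rightarrow> ('c \<Rightarrow> 'd) \<Rightarrow> bool" where
  "stable C D f \<longleftrightarrow>
     f \<in> unit_ball C \<rightarrow>\<^sub>E elems D \<and>
     pre_stable C D f \<and>
     (\<forall>x s. nondecreasing C x \<and> range x \<subseteq> unit_ball C \<and> is_seq_lub C x s \<longrightarrow>
        is_seq_lub D (\<lambda>n. f (x n)) (f s)) \<and>
     (\<exists>B. \<forall>x\<in>unit_ball C. cnorm D (f x) \<le> B)"

definition meas_stable :: "'c mcone \<Rightarrow> 'd mcone \<Rightarrow> ('c \<Rightarrow> 'd) set" where
  "meas_stable C D = {f. stable C D f \<and>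
     (\<forall>n \<gamma>. unitary_path C n \<gamma> \<longrightarrow> meas_path D n (\<lambda>r. f (\<gamma> r)))}"

definition cstab_hom :: "'c mcone \<Rightarrow> 'd mcone \<Rightarrow> ('c \<Rightarrow> 'd) set" where
  "cstab_hom C D = {f \<in> meas_stable C D. \<forall>x\<in>unit_ball C. f x \<in> unit_ball D}"

definition cstab_id :: "'c mcone \<Rightarrow> 'c \<Rightarrow> 'c" where
  "cstab_id C = (\<lambda>x\<in>unit_ball C. x)"

definition cstab_comp :: "'c mcone \<Rightarrow> ('d \<Rightarrow> 'e) \<Rightarrow> ('c \<Rightarrow> 'd) \<Rightarrow> 'c \<Rightarrow> 'e" where
  "cstab_comp C g f = compose (unit_ball C) g f"

definition cstab_iso :: "'c mcone \<Rightarrow> 'd mcone \<Rightarrow> ('c \<Rightarrow> 'd) \<Rightarrow> bool" where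
  "cstab_iso C D f \<longleftrightarrow> measurable_cone C \<and> measurable_cone D \<and> f \<in> cstab_hom C D \<and>
     (\<exists>g\<in>cstab_hom D C. cstab_comp C g f = cstab_id C \<and> cstab_comp D f g = cstab_id D)"

text \<open>The \<open>0\<close> inserted under \<open>Max\<close> only matters for the empty product.\<close>

definition cone_prod :: "'i set \<Rightarrow> ('i \<Rightarrow> 'c mcone) \<Rightarrow> ('i \<Rightarrow> 'c) mcone" where
  "cone_prod I C = \<lparr>
     elems = (\<Pi>\<^sub>E i\<in>I. elems (C i)),
     czero = (\<lambda>i\<in>I. czero (C i)),
     cadd = (\<lambda>x y. \<lambda>i\<in>I. cadd (C i) (x i) (y i)),
     cscale = (\<lambda>\<alpha> x. \<lambda>i\<in>I. cscale (C i) \<alpha> (x i)),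
     cnorm = (\<lambda>x. Max (insert 0 ((\<lambda>i. cnorm (C i) (x i)) ` I))),
     tests = (\<lambda>n. {\<lambda>r x. \<Sum>i\<in>I. l i r (x i) | l. \<forall>i\<in>I. l i \<in> tests (C i) n})\<rparr>"

text \<open>The paths used in the tests are unitary because the elements of the exponential are only
  defined on the unit ball.\<close>

definition cone_exp :: "'c mcone \<Rightarrow> 'd mcone \<Rightarrow> ('c \<Rightarrow> 'd) mcone" where
  "cone_exp C D = \<lparr>
     elems = meas_stable C D,
     czero = (\<lambda>x\<in>unit_ball C. czero D),
     cadd = (\<lambda>f g. \<lambda>x\<in>unit_ball C. cadd D (f x) (g x)),
     cscale = (\<lambda>\<alpha> f. \<lambda>x\<in>unit_ball C. cscale D \<alpha> (f x)),
     cnorm = (\<lambda>f. SUP x\<in>unit_ball C. cnorm D (f x)),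
     tests = (\<lambda>n. {\<lambda>r f. m r (f (\<gamma> r)) | \<gamma> m. unitary_path C n \<gamma> \<and> m \<in> tests D n})\<rparr>"

section \<open>The functor\<close>

definition Fm :: "'a pcs \<Rightarrow> ('a \<Rightarrow> real) mcone" where
  "Fm X = \<lparr>
     elems = {\<lambda>a. \<alpha> * x a | \<alpha> x. 0 \<le> \<alpha> \<and> x \<in> cliques X},
     czero = (\<lambda>a. 0),
     cadd = (\<lambda>x y a. x a + y a),
     cscale = (\<lambda>\<alpha> x a. \<alpha> * x a),
     cnorm = (\<lambda>x. Inf {1 / r | r. 0 < r \<and> (\<lambda>a. r * x a) \<in> cliques X}),
     tests = (\<lambda>n. {\<lambda>r x. 0} \<union> {\<lambda>r x. x a | a. a \<in> web X})\<rparr>"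

definition Fm_map :: "'a pcs \<Rightarrow> ('a multiset \<times> 'b \<Rightarrow> real) \<Rightarrow> ('a \<Rightarrow> real) \<Rightarrow> ('b \<Rightarrow> real)" where
  "Fm_map X f = (\<lambda>x\<in>unit_ball (Fm X). hat X f x)"

definition prod_map ::
  "'i set \<Rightarrow> ('i \<Rightarrow> 'a pcs) \<Rightarrow> ('i \<times> 'a \<Rightarrow> real) \<Rightarrow> ('i \<Rightarrow> 'a \<Rightarrow> real)" where
  "prod_map I X = (\<lambda>x\<in>unit_ball (Fm (pcs_prod I X)). \<lambda>i\<in>I. \<lambda>a. x (i, a))"

definition exp_map ::
  "'a pcs \<Rightarrow> 'b pcs \<Rightarrow> ('a multiset \<times> 'b \<Rightarrow> real) \<Rightarrow> ('a \<Rightarrow> real) \<Rightarrow> ('b \<Rightarrow> real)" where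
  "exp_map X Y = (\<lambda>f\<in>unit_ball (Fm (pcs_exp X Y)). Fm_map X f)"

end

theory Submission
  imports Defs "HOL-Library.Function_Algebras" "HOL-Complex_Analysis.Great_Picard"
begin

text \<open>
  A matrix \<open>f\<close> is a morphism \<open>X \<rightarrow> Y\<close> iff its pairing with \<open>x\<^sup>! \<otimes> v\<close> is at most \<open>1\<close> for all cliques
  \<open>x\<close> of \<open>X\<close> and \<open>v\<close> of the dual of \<open>Y\<close>, so the morphisms form a dual set and \<open>X \<Rightarrow> Y\<close> is a PCS.
  Power series with nonnegative coefficients have nonnegative iterated differences, because
  monomials do, and commute with monotone limits; hence \<open>hat X f\<close> is stable.

  Conversely, let \<open>\<phi>\<close> be stable and \<open>x\<close> a clique of finite support. Newton's formula on the grid of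
  mesh \<open>2\<^sup>-\<^sup>k\<close> in the box below \<open>x\<close> writes each coordinate of \<open>\<phi>\<close> as a polynomial in binomial
  coefficients, whose own coefficients are iterated differences, hence nonnegative, and add up to
  the value at \<open>x\<close>. Along a subsequence the coefficients converge, and dominated convergence
  identifies \<open>\<phi>\<close> with the limiting power series at dyadic points, hence everywhere by continuity.
  The coefficients do not depend on the box, since a power series determines its coefficients;
  monotone limits extend the formula to all cliques.

  The two comparison maps are linear isometric bijections from a cone \<open>Fm Z\<close>, along which the cone
  structure and stability are transported; an additive map is pre-stable because its first
  differences are constant. What remains is measurability; for the inverse of \<open>f \<mapsto> hat X f\<close> it
  holds because coefficients are pointwise limits of expressions in the values.
\<close>

section \<open>Sums of nonnegative extended reals\<close>

abbreviation esum :: "'a set \<Rightarrow> ('a \<Rightarrow> ennreal) \<Rightarrow> ennreal" where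
  "esum A f \<equiv> (\<integral>\<^sup>+a. f a \<partial>count_space A)"

lemma summable_on_iff_esum:
  fixes f :: "'a \<Rightarrow> real"
  assumes "\<And>a. a \<in> A \<Longrightarrow> 0 \<le> f a"
  shows "f summable_on A \<longleftrightarrow> esum A (\<lambda>a. ennreal (f a)) < \<infinity>"
proof -
  have "f summable_on A \<longleftrightarrow> integrable (count_space A) f"
    using summable_on_iff_abs_summable_on_real[of f A] abs_summable_equivalent[of f A]
    by (simp add: abs_summable_on_def)
  also have "\<dots> \<longleftrightarrow> esum A (\<lambda>a. ennreal (norm (f a))) < \<infinity>"
    by (simp add: integrable_iff_bounded)
  also have "esum A (\<lambda>a. ennreal (norm (f a))) = esum A (\<lambda>a. ennreal (f a))"
    using assms by (intro nn_integral_cong) simp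
  finally show ?thesis .
qed

lemma esum_eq_infsum:
  assumes "\<And>a. a \<in> A \<Longrightarrow> 0 \<le> f a" and "f summable_on A"
  shows "esum A (\<lambda>a. ennreal (f a)) = ennreal (infsum f A)"
proof -
  have "Infinite_Set_Sum.abs_summable_on f A"
    using assms(2) summable_on_iff_abs_summable_on_real[of f A] abs_summable_equivalent[of f A]
    by simp
  then show ?thesis
    using assms(1) nn_integral_conv_infsetsum[of f A] infsetsum_infsum[of f A] by simp
qed

lemma esum_le_iff:
  assumes "\<And>a. a \<in> A \<Longrightarrow> 0 \<le> f a" and "0 \<le> c"
  shows "esum A (\<lambda>a. ennreal (f a)) \<le> ennreal c \<longleftrightarrow> f summable_on A \<and> infsum f A \<le> c"
proof (cases "f summable_on A")
  case True
  then show ?thesis using assms by (simp add: esum_eq_infsum)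
next
  case False
  then have "esum A (\<lambda>a. ennreal (f a)) = \<infinity>"
    using assms(1) summable_on_iff_esum[of A f] by (auto simp: less_top[symmetric])
  then show ?thesis using False by (simp add: top_unique)
qed

lemma has_sum_iff_esum:
  assumes "\<And>a. a \<in> A \<Longrightarrow> 0 \<le> f a" and "0 \<le> c"
  shows "(f has_sum c) A \<longleftrightarrow> esum A (\<lambda>a. ennreal (f a)) = ennreal c"
proof (cases "f summable_on A")
  case True
  then have "(f has_sum c) A \<longleftrightarrow> infsum f A = c" using has_sum_infsum infsumI by blast
  then show ?thesis using True assms by (simp add: esum_eq_infsum infsum_nonneg)
next
  case False
  then have "esum A (\<lambda>a. ennreal (f a)) = \<infinity>"
    using assms(1) summable_on_iff_esum[of A f] by (auto simp: less_top[symmetric])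
  then show ?thesis using False has_sum_imp_summable by force
qed

lemma esum_product_iterated:
  "esum (A \<times> B) f = esum A (\<lambda>a. esum B (\<lambda>b. f (a, b)))"
proof -
  have "esum A (\<lambda>a. esum B (\<lambda>b. f (a, b))) =
      esum UNIV (\<lambda>a. esum UNIV (\<lambda>b. f (a, b) * indicator B b * indicator A a))"
    by (subst (1 2) nn_integral_count_space_indicator) (auto simp: nn_integral_multc)
  also have "\<dots> = esum UNIV (\<lambda>a. esum UNIV (\<lambda>b. (\<lambda>p. f p * indicator (A \<times> B) p) (a, b)))"
    by (intro nn_integral_cong) (auto split: split_indicator)
  also have "\<dots> = esum UNIV (\<lambda>p. f p * indicator (A \<times> B) p)"
    by (rule nn_integral_fst_count_space)
  also have "\<dots> = esum (A \<times> B) f"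
    by (subst (2) nn_integral_count_space_indicator) auto
  finally show ?thesis by simp
qed

lemma borel_measurable_esum:
  assumes "countable A" and "\<And>a. a \<in> A \<Longrightarrow> (\<lambda>s. f s a) \<in> borel_measurable M"
  shows "(\<lambda>s. esum A (f s)) \<in> borel_measurable M"
proof -
  interpret sigma_finite_measure "count_space A"
    using assms(1) by (rule sigma_finite_measure_count_space_countable)
  have "(\<lambda>(a, s). f s a) \<in> borel_measurable (count_space A \<Otimes>\<^sub>M M)"
    using assms by (intro measurable_pair_measure_countable1) auto
  then have "(\<lambda>(s, a). f s a) \<in> borel_measurable (M \<Otimes>\<^sub>M count_space A)"
    by (subst measurable_pair_swap_iff) (simp add: case_prod_beta)
  then show ?thesis by (rule borel_measurable_nn_integral)
qed

lemma nonneg_fun_apply: "0 \<le> f \<Longrightarrow> 0 \<le> f a"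
  by (simp add: le_fun_def)

lemma tendsto_fun_iff:
  fixes f :: "'b \<Rightarrow> 'a \<Rightarrow> 'c::topological_space"
  shows "(f \<longlongrightarrow> l) F \<longleftrightarrow> (\<forall>a. ((\<lambda>x. f x a) \<longlongrightarrow> l a) F)"
proof -
  have "(f \<longlongrightarrow> l) F \<longleftrightarrow> limitin (product_topology (\<lambda>_. euclidean) UNIV) f l F"
    by (simp add: euclidean_product_topology)
  also have "\<dots> \<longleftrightarrow> (\<forall>a. ((\<lambda>x. f x a) \<longlongrightarrow> l a) F)"
    by (simp add: limitin_componentwise)
  finally show ?thesis .
qed

lemma incseq_fun_iff: "incseq f \<longleftrightarrow> (\<forall>a. incseq (\<lambda>n. f n a))"
  by (auto simp: incseq_def le_fun_def)

lemma incseq_LIMSEQ_fun_SUP: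
  fixes x :: "nat \<Rightarrow> 'a \<Rightarrow> real"
  assumes "incseq x" and "\<And>a. bdd_above (range (\<lambda>n. x n a))"
  shows "x \<longlonglongrightarrow> (\<lambda>a. SUP n. x n a)"
  using assms by (auto simp: tendsto_fun_iff incseq_fun_iff intro!: LIMSEQ_incseq_SUP)

lemma incseq_LIMSEQ_fun_le:
  fixes x :: "nat \<Rightarrow> 'a \<Rightarrow> real"
  assumes "incseq x" and "x \<longlonglongrightarrow> y"
  shows "x n \<le> y"
  using assms by (auto simp: tendsto_fun_iff incseq_fun_iff le_fun_def intro: incseq_le)

section \<open>Monomials\<close>

lemma mpow_eq_prod_mset: "mpow x \<mu> = (\<Prod>a\<in>#\<mu>. x a)"
  by (simp add: mpow_def image_prod_mset_multiplicity)

lemma mpow_empty [simp]: "mpow x {#} = 1"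
  and mpow_add_mset [simp]: "mpow x (add_mset a \<mu>) = x a * mpow x \<mu>"
  and mpow_union [simp]: "mpow x (\<mu> + \<nu>) = mpow x \<mu> * mpow x \<nu>"
  and mpow_replicate_mset [simp]: "mpow x (replicate_mset n a) = x a ^ n"
  by (simp_all add: mpow_eq_prod_mset)

lemma mpow_superset:
  assumes "finite F" and "\<mu> \<in> mfin F"
  shows "mpow x \<mu> = (\<Prod>a\<in>F. x a ^ count \<mu> a)"
  unfolding mpow_def using assms by (intro prod.mono_neutral_left) (auto simp: mfin_def not_in_iff)

lemma mpow_nonneg: "0 \<le> x \<Longrightarrow> 0 \<le> mpow x \<mu>"
  by (simp add: mpow_def le_fun_def prod_nonneg)

lemma mpow_mono: "0 \<le> x \<Longrightarrow> x \<le> y \<Longrightarrow> mpow x \<mu> \<le> mpow y \<mu>"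
  by (auto simp: mpow_def le_fun_def intro!: prod_mono power_mono)

lemma mpow_pos: "(\<And>a. a \<in># \<mu> \<Longrightarrow> 0 < x a) \<Longrightarrow> 0 < mpow x \<mu>"
  by (auto simp: mpow_def intro: prod_pos)

lemma mpow_mult: "mpow (x * y) \<mu> = mpow x \<mu> * mpow y \<mu>"
  by (simp add: mpow_def power_mult_distrib prod.distrib)

lemma mpow_cong: "(\<And>a. a \<in># \<mu> \<Longrightarrow> x a = y a) \<Longrightarrow> mpow x \<mu> = mpow y \<mu>"
  by (simp add: mpow_def)

lemma mpow_eq_0:
  assumes "\<And>a. a \<notin> A \<Longrightarrow> x a = 0" and "\<mu> \<notin> mfin A"
  shows "mpow x \<mu> = 0"
proof -
  obtain a where "a \<in># \<mu>" "x a = 0" using assms by (auto simp: mfin_def)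
  then show ?thesis unfolding mpow_def by (intro prod_zero) (auto intro!: bexI[of _ a])
qed

lemma tendsto_mpow: "(x \<longlongrightarrow> y) F \<Longrightarrow> ((\<lambda>n. mpow (x n) \<mu>) \<longlongrightarrow> mpow y \<mu>) F"
  unfolding mpow_def tendsto_fun_iff by (intro tendsto_prod tendsto_power) auto

lemma mfin_empty [simp]: "mfin {} = {{#}}"
  by (auto simp: mfin_def)

lemma mfin_set_mset [simp]: "\<mu> \<in> mfin (set_mset \<mu>)"
  by (simp add: mfin_def)

lemma mfin_mono: "A \<subseteq> B \<Longrightarrow> mfin A \<subseteq> mfin B"
  by (auto simp: mfin_def)

lemma countable_mfin:
  assumes "countable A"
  shows "countable (mfin A)"
proof -
  have "mfin A \<subseteq> mset ` lists A"
  proof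
    fix \<mu> assume "\<mu> \<in> mfin A"
    moreover obtain xs where "mset xs = \<mu>" using ex_mset by blast
    ultimately show "\<mu> \<in> mset ` lists A" by (intro image_eqI[of _ _ xs]) (auto simp: mfin_def)
  qed
  then show ?thesis using assms by (meson countable_image countable_lists countable_subset)
qed

section \<open>Duality\<close>

lemma nnvecs_iff: "u \<in> nnvecs A \<longleftrightarrow> 0 \<le> u \<and> (\<forall>a. a \<notin> A \<longrightarrow> u a = 0)"
  by (auto simp: nnvecs_def le_fun_def)

lemma nnvecs_nonneg: "u \<in> nnvecs A \<Longrightarrow> 0 \<le> u a"
  by (simp add: nnvecs_iff le_fun_def)

lemma pdual_subset_nnvecs: "pdual A S \<subseteq> nnvecs A"
  by (auto simp: pdual_def)

lemma pdual_iff_esum: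
  assumes "S \<subseteq> nnvecs A"
  shows "u \<in> pdual A S \<longleftrightarrow> u \<in> nnvecs A \<and> (\<forall>v\<in>S. esum A (\<lambda>a. ennreal (u a * v a)) \<le> 1)"
proof -
  have "esum A (\<lambda>a. ennreal (u a * v a)) \<le> 1 \<longleftrightarrow>
      (\<lambda>a. u a * v a) summable_on A \<and> (\<Sum>\<^sub>\<infinity>a\<in>A. u a * v a) \<le> 1"
    if "u \<in> nnvecs A" "v \<in> S" for v
  proof -
    have "0 \<le> u a * v a" for a using that assms by (blast intro: mult_nonneg_nonneg nnvecs_nonneg)
    then show ?thesis using esum_le_iff[of A "\<lambda>a. u a * v a" 1] by simp
  qed
  then show ?thesis by (auto simp: pdual_def)
qed

lemma subset_pdual_pdual:
  assumes "S \<subseteq> nnvecs A"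
  shows "S \<subseteq> pdual A (pdual A S)"
proof
  fix x assume x_in: "x \<in> S"
  have "esum A (\<lambda>a. ennreal (x a * v a)) \<le> 1" if "v \<in> pdual A S" for v
    using that x_in unfolding pdual_iff_esum[OF assms] by (subst mult.commute) blast
  then show "x \<in> pdual A (pdual A S)"
    using x_in assms by (auto simp: pdual_iff_esum[OF pdual_subset_nnvecs])
qed

lemma pdual_antimono: "S \<subseteq> T \<Longrightarrow> pdual A T \<subseteq> pdual A S"
  by (auto simp: pdual_def)

lemma pdual_pdual_pdual:
  assumes "S \<subseteq> nnvecs A"
  shows "pdual A (pdual A (pdual A S)) = pdual A S"
  using pdual_antimono[OF subset_pdual_pdual[OF assms]] subset_pdual_pdual[OF pdual_subset_nnvecs]
  by blast

lemma pdual_coordinate_le: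
  assumes "S \<subseteq> nnvecs A" and u_dual: "u \<in> pdual A S" and v_in: "v \<in> S" and a_in: "a \<in> A"
  shows "u a * v a \<le> 1"
proof -
  have "ennreal (u a * v a) \<le> esum A (\<lambda>a. ennreal (u a * v a))"
    using a_in by (rule nn_integral_ge_point)
  also have "\<dots> \<le> 1" using u_dual v_in assms(1) by (simp add: pdual_iff_esum)
  finally show ?thesis by (simp add: ennreal_le_1)
qed

lemma point_mass_in_pdual:
  assumes "S \<subseteq> nnvecs A" and a_in: "a \<in> A" and "0 \<le> c" and scaled_le: "\<And>v. v \<in> S \<Longrightarrow> c * v a \<le> 1"
  shows "(\<lambda>b. if b = a then c else 0) \<in> pdual A S"
proof -
  have "esum A (\<lambda>b. ennreal ((if b = a then c else 0) * v b)) \<le> 1" if v_in: "v \<in> S" for v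
  proof -
    have "esum A (\<lambda>b. ennreal ((if b = a then c else 0) * v b)) =
        (\<Sum>b\<in>{a}. ennreal ((if b = a then c else 0) * v b))"
      using a_in by (intro nn_integral_count_space') auto
    also have "\<dots> \<le> 1" using scaled_le[OF v_in] by (simp add: ennreal_le_1)
    finally show ?thesis .
  qed
  then show ?thesis using assms(1,3) a_in by (auto simp: pdual_iff_esum nnvecs_def)
qed

lemma is_pcs_pdual:
  assumes "countable A" and S_nnvecs: "S \<subseteq> nnvecs A"
    and pos: "\<And>a. a \<in> A \<Longrightarrow> \<exists>v\<in>S. 0 < v a"
    and bound: "\<And>a. a \<in> A \<Longrightarrow> \<exists>B. \<forall>v\<in>S. v a \<le> B"
  shows "is_pcs \<lparr>web = A, cliques = pdual A S\<rparr>"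
proof -
  have "\<exists>c>0. (\<lambda>b. if b = a then c else 0) \<in> pdual A S" if a_in: "a \<in> A" for a
  proof -
    obtain B where v_bound: "\<And>v. v \<in> S \<Longrightarrow> v a \<le> B" using bound[OF a_in] by blast
    have "1 / max B 1 * v a \<le> 1" if "v \<in> S" for v using v_bound[OF that] by simp
    then have "(\<lambda>b. if b = a then 1 / max B 1 else 0) \<in> pdual A S"
      by (intro point_mass_in_pdual S_nnvecs a_in) simp
    then show ?thesis by (intro exI[of _ "1 / max B 1"]) simp
  qed
  moreover have "\<exists>B. \<forall>u\<in>pdual A S. u a \<le> B" if a_in: "a \<in> A" for a
  proof -
    obtain v where "v \<in> S" "0 < v a" using pos[OF a_in] by blast
    then show ?thesis
      using pdual_coordinate_le[OF S_nnvecs _ _ a_in]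
      by (intro exI[of _ "1 / v a"]) (simp add: pos_le_divide_eq)
  qed
  ultimately show ?thesis
    using assms(1) pdual_subset_nnvecs[of A S] pdual_pdual_pdual[OF S_nnvecs]
    by (auto simp: is_pcs_def)
qed

section \<open>Probabilistic coherence spaces\<close>

locale coherence_space =
  fixes X :: "'a pcs"
  assumes is_pcs: "is_pcs X"
begin

abbreviation dual_cliques :: "('a \<Rightarrow> real) set" where
  "dual_cliques \<equiv> pdual (web X) (cliques X)"

lemma countable_web: "countable (web X)"
  using is_pcs by (simp add: is_pcs_def)

lemma clique_nnvecs: "x \<in> cliques X \<Longrightarrow> x \<in> nnvecs (web X)"
  using is_pcs by (auto simp: is_pcs_def)

lemma clique_nonneg: "x \<in> cliques X \<Longrightarrow> 0 \<le> x"
  using clique_nnvecs by (auto simp: nnvecs_iff)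

lemma clique_outside: "x \<in> cliques X \<Longrightarrow> a \<notin> web X \<Longrightarrow> x a = 0"
  using clique_nnvecs by (auto simp: nnvecs_iff)

lemma clique_bound: "\<exists>B. \<forall>x\<in>cliques X. x a \<le> B"
proof (cases "a \<in> web X")
  case True
  then show ?thesis using is_pcs by (simp add: is_pcs_def)
next
  case False
  then have "\<forall>x\<in>cliques X. x a \<le> 0" by (auto simp: clique_outside)
  then show ?thesis ..
qed

lemma dual_clique_nonneg: "v \<in> dual_cliques \<Longrightarrow> 0 \<le> v a"
  by (rule nnvecs_nonneg[OF subsetD[OF pdual_subset_nnvecs]])

lemma clique_iff_esum:
  "x \<in> cliques X \<longleftrightarrow> x \<in> nnvecs (web X) \<and>
     (\<forall>v\<in>dual_cliques. esum (web X) (\<lambda>a. ennreal (x a * v a)) \<le> 1)"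
  using is_pcs pdual_iff_esum[OF pdual_subset_nnvecs] by (metis is_pcs_def)

lemma clique_zero: "0 \<in> cliques X"
  unfolding clique_iff_esum by (simp add: nnvecs_iff)

lemma clique_antimono:
  assumes "x \<in> cliques X" and "0 \<le> y" and "y \<le> x"
  shows "y \<in> cliques X"
  unfolding clique_iff_esum
proof (intro conjI ballI)
  show "y \<in> nnvecs (web X)"
    using assms clique_outside[OF assms(1)] by (auto simp: nnvecs_iff le_fun_def) (metis antisym)
  fix v assume v_dual: "v \<in> dual_cliques"
  have "esum (web X) (\<lambda>a. ennreal (y a * v a)) \<le> esum (web X) (\<lambda>a. ennreal (x a * v a))"
    using assms(3) dual_clique_nonneg[OF v_dual]
    by (intro nn_integral_mono ennreal_leI mult_right_mono) (auto simp: le_fun_def)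
  also have "\<dots> \<le> 1" using assms(1) v_dual clique_iff_esum by blast
  finally show "esum (web X) (\<lambda>a. ennreal (y a * v a)) \<le> 1" .
qed

lemma clique_subconvex:
  assumes "x \<in> cliques X" "y \<in> cliques X" and "0 \<le> s" "0 \<le> t" "s + t \<le> 1"
  shows "(\<lambda>a. s * x a + t * y a) \<in> cliques X"
  unfolding clique_iff_esum
proof (intro conjI ballI)
  show "(\<lambda>a. s * x a + t * y a) \<in> nnvecs (web X)"
    using assms(3,4) clique_nnvecs[OF assms(1)] clique_nnvecs[OF assms(2)]
    by (auto simp: nnvecs_iff le_fun_def)
  fix v assume v_dual: "v \<in> dual_cliques"
  have "ennreal ((s * x a + t * y a) * v a) =
      ennreal s * ennreal (x a * v a) + ennreal t * ennreal (y a * v a)" for a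
    using assms(3,4) nnvecs_nonneg[OF clique_nnvecs[OF assms(1)], of a]
      nnvecs_nonneg[OF clique_nnvecs[OF assms(2)], of a] dual_clique_nonneg[OF v_dual, of a]
    by (simp add: distrib_right mult.assoc flip: ennreal_mult)
  then have "esum (web X) (\<lambda>a. ennreal ((s * x a + t * y a) * v a)) =
      ennreal s * esum (web X) (\<lambda>a. ennreal (x a * v a)) +
          ennreal t * esum (web X) (\<lambda>a. ennreal (y a * v a))"
    by (simp add: nn_integral_add nn_integral_cmult)
  also have "\<dots> \<le> ennreal s * 1 + ennreal t * 1"
    using assms(1,2) v_dual unfolding clique_iff_esum by (intro add_mono mult_left_mono) auto
  also have "\<dots> \<le> 1" using assms(3-5) by (simp flip: ennreal_plus)
  finally show "esum (web X) (\<lambda>a. ennreal ((s * x a + t * y a) * v a)) \<le> 1" .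
qed

lemma clique_scale: "x \<in> cliques X \<Longrightarrow> 0 \<le> s \<Longrightarrow> s \<le> 1 \<Longrightarrow> (\<lambda>a. s * x a) \<in> cliques X"
  using clique_subconvex[OF _ clique_zero, of x s 0] by simp

lemma clique_LIMSEQ:
  assumes x_clique: "\<And>n. x n \<in> cliques X" and "incseq x" and "x \<longlonglongrightarrow> y"
  shows "y \<in> cliques X"
  unfolding clique_iff_esum
proof (intro conjI ballI)
  have x_le: "x n a \<le> y a" for n a
    using incseq_LIMSEQ_fun_le[OF assms(2,3), of n] by (simp add: le_fun_def)
  have "y a = 0" if "a \<notin> web X" for a
    using that assms(3) clique_outside[OF x_clique]
    by (auto simp: tendsto_fun_iff LIMSEQ_const_iff dest!: spec[of _ a])
  moreover have "0 \<le> y a" for a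
    using nnvecs_nonneg[OF clique_nnvecs[OF x_clique[of 0]], of a] x_le[of 0 a] by simp
  ultimately show "y \<in> nnvecs (web X)" by (simp add: nnvecs_iff le_fun_def)
  fix v assume v_dual: "v \<in> dual_cliques"
  have "(\<lambda>n. esum (web X) (\<lambda>a. ennreal (x n a * v a))) \<longlonglongrightarrow> esum (web X) (\<lambda>a. ennreal (y a * v a))"
  proof (rule nn_integral_LIMSEQ)
    show "incseq (\<lambda>n a. ennreal (x n a * v a))"
      using assms(2) dual_clique_nonneg[OF v_dual]
      by (auto simp: incseq_def le_fun_def intro!: ennreal_leI mult_right_mono)
    show "(\<lambda>n. ennreal (x n a * v a)) \<longlonglongrightarrow> ennreal (y a * v a)" for a
      using assms(3)
      by (intro tendsto_ennrealI tendsto_mult tendsto_const) (simp add: tendsto_fun_iff)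
  qed simp
  moreover have "esum (web X) (\<lambda>a. ennreal (x n a * v a)) \<le> 1" for n
    using x_clique v_dual clique_iff_esum by blast
  ultimately show "esum (web X) (\<lambda>a. ennreal (y a * v a)) \<le> 1" by (auto intro: LIMSEQ_le_const2)
qed

lemma clique_with_support:
  assumes "finite F" and "F \<subseteq> web X"
  obtains x where "x \<in> cliques X" and "\<And>a. a \<in> F \<Longrightarrow> 0 < x a" and "\<And>a. a \<notin> F \<Longrightarrow> x a = 0"
proof -
  have "\<exists>x\<in>cliques X. (\<forall>a\<in>F. 0 < x a) \<and> (\<forall>a. a \<notin> F \<longrightarrow> x a = 0)"
    using assms
  proof (induction F)
    case empty
    show ?case using clique_zero by (intro bexI[of _ 0]) auto
  next
    case (insert c F)
    then obtain x where x_clique: "x \<in> cliques X" and x_pos: "\<forall>a\<in>F. 0 < x a"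
        and x_eq_0: "\<forall>a. a \<notin> F \<longrightarrow> x a = 0" by auto
    obtain d where d_pos: "d > 0" and point_clique: "(\<lambda>b. if b = c then d else 0) \<in> cliques X"
      using insert.prems is_pcs by (auto simp: is_pcs_def)
    have "(\<lambda>a. 1/2 * x a + 1/2 * (if a = c then d else 0)) \<in> cliques X"
      using clique_subconvex[OF x_clique point_clique, of "1/2" "1/2"] by simp
    then show ?case
      using x_clique x_pos x_eq_0 d_pos point_clique nnvecs_nonneg[OF clique_nnvecs[OF x_clique]]
        insert.hyps(2) by (intro bexI) (auto simp: add_nonneg_pos)
  qed
  then show ?thesis using that by blast
qed

lemma dual_clique_positive:
  assumes a_web: "a \<in> web X"
  obtains v where "v \<in> dual_cliques" and "0 < v a"
proof -
  obtain B where x_bound: "\<And>x. x \<in> cliques X \<Longrightarrow> x a \<le> B" using clique_bound by blast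
  have "1 / max B 1 * x a \<le> 1" if "x \<in> cliques X" for x using x_bound[OF that] by simp
  then have "(\<lambda>b. if b = a then 1 / max B 1 else 0) \<in> dual_cliques"
    using clique_nnvecs by (intro point_mass_in_pdual a_web) auto
  then show ?thesis by (rule that) simp
qed

lemma dual_clique_bound:
  assumes a_web: "a \<in> web X"
  shows "\<exists>B. \<forall>v\<in>dual_cliques. v a \<le> B"
proof -
  obtain c where c_pos: "0 < c" and point_clique: "(\<lambda>b. if b = a then c else 0) \<in> cliques X"
    using a_web is_pcs by (auto simp: is_pcs_def)
  have "v a \<le> 1 / c" if "v \<in> dual_cliques" for v
    using pdual_coordinate_le[of "cliques X" "web X", OF _ that point_clique a_web] clique_nnvecs
      c_pos
    by (simp add: subset_eq pos_le_divide_eq)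
  then show ?thesis by blast
qed

text \<open>Dual cliques being positive somewhere at every point of the web, a pairing with all of them
  that is at most \<open>1\<close> forces finite values.\<close>

lemma ex_clique_ennreal_iff:
  "(\<exists>x\<in>cliques X. \<forall>a\<in>web X. e a = ennreal (x a)) \<longleftrightarrow>
     (\<forall>v\<in>dual_cliques. esum (web X) (\<lambda>a. e a * ennreal (v a)) \<le> 1)" (is "?L \<longleftrightarrow> ?R")
proof
  assume ?L
  then obtain x where x_clique: "x \<in> cliques X" and e_eq: "\<And>a. a \<in> web X \<Longrightarrow> e a = ennreal (x a)"
    by blast
  show ?R
  proof
    fix v assume v_dual: "v \<in> dual_cliques"
    have "esum (web X) (\<lambda>a. e a * ennreal (v a)) = esum (web X) (\<lambda>a. ennreal (x a * v a))"
      using dual_clique_nonneg[OF v_dual]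
      by (intro nn_integral_cong) (simp add: e_eq ennreal_mult'')
    also have "\<dots> \<le> 1" using x_clique v_dual clique_iff_esum by blast
    finally show "esum (web X) (\<lambda>a. e a * ennreal (v a)) \<le> 1" .
  qed
next
  assume right: ?R
  define x where "x a = (if a \<in> web X then enn2real (e a) else 0)" for a
  have e_eq: "e a = ennreal (x a)" if a_web: "a \<in> web X" for a
  proof -
    obtain v where v_dual: "v \<in> dual_cliques" and v_pos: "0 < v a"
      using dual_clique_positive[OF a_web] .
    have "e a * ennreal (v a) \<le> 1"
      using nn_integral_ge_point[OF a_web, of "\<lambda>a. e a * ennreal (v a)"] right v_dual
      by (metis order_trans)
    then have "e a \<noteq> \<infinity>" using v_pos by (auto simp: ennreal_top_mult top_unique)
    then show ?thesis using a_web by (simp add: x_def less_top)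
  qed
  have "x \<in> cliques X"
    unfolding clique_iff_esum
  proof (intro conjI ballI)
    show "x \<in> nnvecs (web X)" by (auto simp: x_def nnvecs_def)
    fix v assume v_dual: "v \<in> dual_cliques"
    have "esum (web X) (\<lambda>a. ennreal (x a * v a)) = esum (web X) (\<lambda>a. e a * ennreal (v a))"
      using dual_clique_nonneg[OF v_dual]
      by (intro nn_integral_cong) (simp add: e_eq ennreal_mult'')
    then show "esum (web X) (\<lambda>a. ennreal (x a * v a)) \<le> 1" using right v_dual by simp
  qed
  then show ?L using e_eq by blast
qed

end

section \<open>Cones\<close>

lemma parity_subsets_insert:
  assumes "finite I" and "a \<notin> I"
  shows "{J. J \<subseteq> insert a I \<and> even (card (insert a I - J)) = p} =
    insert a ` {J. J \<subseteq> I \<and> even (card (I - J)) = p} \<union> {J. J \<subseteq> I \<and> even (card (I - J)) = (\<not> p)}"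
    (is "?L = insert a ` ?S p \<union> ?S (\<not> p)")
proof (intro Set.equalityI subsetI)
  fix J assume "J \<in> ?L"
  then have J_subset: "J \<subseteq> insert a I" and J_parity: "even (card (insert a I - J)) = p" by simp_all
  show "J \<in> insert a ` ?S p \<union> ?S (\<not> p)"
  proof (cases "a \<in> J")
    case True
    then have "J = insert a (J - {a})" "insert a I - J = I - (J - {a})" using assms(2) by auto
    then have "J - {a} \<in> ?S p" using J_subset J_parity by simp blast
    then show ?thesis using \<open>J = insert a (J - {a})\<close> by blast
  next
    case False
    then have "insert a I - J = insert a (I - J)" by blast
    then have "J \<in> ?S (\<not> p)" using assms J_subset J_parity False by auto
    then show ?thesis ..
  qed
next
  fix J assume "J \<in> insert a ` ?S p \<union> ?S (\<not> p)"
  then show "J \<in> ?L"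
  proof
    assume "J \<in> insert a ` ?S p"
    then obtain K where J_eq: "J = insert a K" and K_in: "K \<in> ?S p" by blast
    then have "insert a I - J = I - K" using assms(2) by blast
    then show ?thesis using J_eq K_in by auto
  next
    assume "J \<in> ?S (\<not> p)"
    then have "insert a I - J = insert a (I - J)" "J \<subseteq> insert a I" using assms(2) by blast+
    then show ?thesis using assms \<open>J \<in> ?S (\<not> p)\<close> by simp
  qed
qed

lemma unit_ball_elem: "x \<in> unit_ball C \<Longrightarrow> x \<in> elems C"
  by (simp add: unit_ball_def)

locale cone =
  fixes C :: "'c mcone"
  assumes is_cone: "is_cone C"
begin

sublocale add: comm_monoid "cone_monoid C"
  rewrites "carrier (cone_monoid C) = elems C"
    and "monoid.mult (cone_monoid C) = cadd C"
    and "one (cone_monoid C) = czero C"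
  using is_cone by (simp_all add: is_cone_def cone_monoid_def)

lemmas csum_empty [simp] = add.finprod_empty[folded csum_def]
  and csum_insert = add.finprod_insert[folded csum_def]
  and csum_closed [simp] = add.finprod_closed[folded csum_def]
  and csum_cong = add.finprod_cong'[folded csum_def]
  and csum_Un_disjoint = add.finprod_Un_disjoint[folded csum_def]
  and csum_reindex = add.finprod_reindex[folded csum_def]

lemma scale_closed: "0 \<le> \<alpha> \<Longrightarrow> x \<in> elems C \<Longrightarrow> cscale C \<alpha> x \<in> elems C"
  and scale_add: "0 \<le> \<alpha> \<Longrightarrow> x \<in> elems C \<Longrightarrow> y \<in> elems C \<Longrightarrow>
    cscale C \<alpha> (cadd C x y) = cadd C (cscale C \<alpha> x) (cscale C \<alpha> y)"
  and add_scale: "0 \<le> \<alpha> \<Longrightarrow> 0 \<le> \<beta> \<Longrightarrow> x \<in> elems C \<Longrightarrow>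
    cscale C (\<alpha> + \<beta>) x = cadd C (cscale C \<alpha> x) (cscale C \<beta> x)"
  and scale_scale: "0 \<le> \<alpha> \<Longrightarrow> 0 \<le> \<beta> \<Longrightarrow> x \<in> elems C \<Longrightarrow>
    cscale C (\<alpha> * \<beta>) x = cscale C \<alpha> (cscale C \<beta> x)"
  and scale_one: "x \<in> elems C \<Longrightarrow> cscale C 1 x = x"
  and scale_zero_left: "x \<in> elems C \<Longrightarrow> cscale C 0 x = czero C"
  and scale_zero_right: "0 \<le> \<alpha> \<Longrightarrow> cscale C \<alpha> (czero C) = czero C"
  and norm_nonneg: "x \<in> elems C \<Longrightarrow> 0 \<le> cnorm C x"
  and norm_scale: "0 \<le> \<alpha> \<Longrightarrow> x \<in> elems C \<Longrightarrow> cnorm C (cscale C \<alpha> x) = \<alpha> * cnorm C x"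
  and norm_eq_0: "x \<in> elems C \<Longrightarrow> cnorm C x = 0 \<Longrightarrow> x = czero C"
  and norm_add_le: "x \<in> elems C \<Longrightarrow> y \<in> elems C \<Longrightarrow> cnorm C (cadd C x y) \<le> cnorm C x + cnorm C y"
  and norm_le_norm_add: "x \<in> elems C \<Longrightarrow> y \<in> elems C \<Longrightarrow> cnorm C x \<le> cnorm C (cadd C x y)"
  using is_cone by (simp_all add: is_cone_def)

lemma add_left_cancel: "x \<in> elems C \<Longrightarrow> y \<in> elems C \<Longrightarrow> z \<in> elems C \<Longrightarrow>
    cadd C x y = cadd C x z \<longleftrightarrow> y = z"
  using is_cone unfolding is_cone_def by metis

lemma cle_add: "y \<in> elems C \<Longrightarrow> cle C x (cadd C x y)"
  by (auto simp: cle_def)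

lemma unit_ball_cle: "y \<in> unit_ball C \<Longrightarrow> x \<in> elems C \<Longrightarrow> cle C x y \<Longrightarrow> x \<in> unit_ball C"
  using norm_le_norm_add by (fastforce simp: unit_ball_def cle_def)

lemma seq_lub_in_unit_ball:
  assumes "seq_complete C" and "nondecreasing C x" and "range x \<subseteq> unit_ball C"
    and "is_seq_lub C x s"
  shows "s \<in> unit_ball C"
proof -
  obtain t where "t \<in> unit_ball C" "is_seq_lub C x t"
    using assms(1-3) unfolding seq_complete_def by blast
  then show ?thesis
    using assms(4) by (intro unit_ball_cle[of t s]) (auto simp: is_seq_lub_def)
qed

lemma subset_sum_in_unit_ball:
  assumes "finite I" "J \<subseteq> I" and x_elem: "x \<in> elems C" and u_elem: "\<And>i. i \<in> I \<Longrightarrow> u i \<in> elems C"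
    and "cadd C x (csum C u I) \<in> unit_ball C"
  shows "cadd C x (csum C u J) \<in> unit_ball C"
proof (rule unit_ball_cle)
  have closed: "csum C u K \<in> elems C" if "K \<subseteq> I" for K
    using that u_elem by (intro csum_closed) auto
  have "csum C u I = csum C u (J \<union> (I - J))" using assms(2) by (simp add: Un_absorb1)
  also have "\<dots> = cadd C (csum C u J) (csum C u (I - J))"
    using assms(1,2) u_elem by (intro csum_Un_disjoint) (auto intro: finite_subset)
  finally have "cadd C x (csum C u I) = cadd C (cadd C x (csum C u J)) (csum C u (I - J))"
    using x_elem closed assms(2) by (simp add: add.m_assoc)
  then show "cle C (cadd C x (csum C u J)) (cadd C x (csum C u I))"
    using closed by (simp add: cle_add)
  show "cadd C x (csum C u J) \<in> elems C" using x_elem closed assms(2) by simp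
qed fact

subsection \<open>Additive maps are pre-stable\<close>

definition parity_sum :: "bool \<Rightarrow> ('i \<Rightarrow> 'c) \<Rightarrow> 'i set \<Rightarrow> 'c \<Rightarrow> 'c" where
  "parity_sum p u I x = csum C (\<lambda>J. cadd C x (csum C u J)) {J. J \<subseteq> I \<and> even (card (I - J)) = p}"

lemma parity_sum_closed:
  assumes "finite I" and "x \<in> elems C" and "u \<in> I \<rightarrow> elems C"
  shows "parity_sum p u I x \<in> elems C"
  unfolding parity_sum_def
proof (rule csum_closed, rule Pi_I)
  fix J assume "J \<in> {J. J \<subseteq> I \<and> even (card (I - J)) = p}"
  then have "u \<in> J \<rightarrow> elems C" using assms(3) by auto
  then show "cadd C x (csum C u J) \<in> elems C" using assms(2) by simp
qed

lemma parity_sum_insert: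
  assumes I_finite: "finite I" and a_notin: "a \<notin> I" and x_elem: "x \<in> elems C"
    and u_elem: "u \<in> insert a I \<rightarrow> elems C"
  shows "parity_sum p u (insert a I) x =
    cadd C (parity_sum p u I (cadd C x (u a))) (parity_sum (\<not> p) u I x)"
proof -
  let ?S = "\<lambda>p. {J. J \<subseteq> I \<and> even (card (I - J)) = p}" and ?t = "\<lambda>x J. cadd C x (csum C u J)"
  have J_finite: "finite J" and a_notin_J: "a \<notin> J" and u_J_elem: "u \<in> J \<rightarrow> elems C"
      if "J \<in> ?S p" for p J
    using that I_finite a_notin u_elem by (auto intro: finite_subset)
  have closed: "?t y J \<in> elems C" if "J \<in> ?S p" "y \<in> elems C" for p J y
    using u_J_elem[OF that(1)] that(2) by simp
  have insert: "?t x (insert a J) = ?t (cadd C x (u a)) J" if "J \<in> ?S p" for p J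
    using J_finite[OF that] a_notin_J[OF that] u_J_elem[OF that] x_elem u_elem
    by (simp add: csum_insert add.m_assoc)
  have fin: "finite (?S p)" for p
    by (rule finite_subset[of _ "Pow I"]) (use I_finite a_notin in auto)
  have inj: "inj_on (insert a) (?S p)" for p
    using a_notin by (auto simp: inj_on_def dest: a_notin_J intro!: insert_ident[THEN iffD1])
  have xa_elem: "cadd C x (u a) \<in> elems C" using x_elem u_elem by simp
  have "parity_sum p u (insert a I) x =
      cadd C (csum C (?t x) (insert a ` ?S p)) (csum C (?t x) (?S (\<not> p)))"
    unfolding parity_sum_def parity_subsets_insert[OF I_finite a_notin]
  proof (rule csum_Un_disjoint)
    show "insert a ` ?S p \<inter> ?S (\<not> p) = {}" using a_notin_J by blast
    show "?t x \<in> insert a ` ?S p \<rightarrow> elems C" "?t x \<in> ?S (\<not> p) \<rightarrow> elems C"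
      using closed[OF _ xa_elem] closed[OF _ x_elem] insert by (simp_all add: Pi_iff)
  qed (use fin in auto)
  also have "csum C (?t x) (insert a ` ?S p) = csum C (\<lambda>J. ?t x (insert a J)) (?S p)"
    using closed[OF _ xa_elem] insert by (intro csum_reindex inj) (simp add: Pi_iff)
  also have "\<dots> = csum C (?t (cadd C x (u a))) (?S p)"
    by (rule csum_cong[OF refl _ insert]) (use closed[OF _ xa_elem] in blast)+
  finally show ?thesis by (simp add: parity_sum_def)
qed

text \<open>The first difference of an affine function is constant, so its higher differences vanish.\<close>

lemma parity_sum_True_insert:
  assumes "finite I" and "a \<notin> I" and "x \<in> elems C" and "u \<in> insert a I \<rightarrow> elems C"
  shows "parity_sum True u (insert a I) x =
    cadd C (parity_sum False u (insert a I) x) (if I = {} then u a else czero C)"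
  using assms
proof (induction I arbitrary: x)
  case empty
  have "{J. J \<subseteq> {} \<and> even (card ({} - J)) = True} = {{}}"
      "{J. J \<subseteq> {} \<and> even (card ({} - J)) = False} = {}"
    by auto
  then show ?case using empty
    by (subst (1 2) parity_sum_insert) (auto simp: parity_sum_def csum_insert)
next
  case (insert b I)
  let ?T = "\<lambda>p. parity_sum p u (insert a I)" and ?\<delta> = "if I = {} then u a else czero C"
  have b_notin: "b \<notin> insert a I" and aI_finite: "finite (insert a I)"
      and u_bI_elem: "u \<in> insert b (insert a I) \<rightarrow> elems C"
    using insert.hyps insert.prems by auto
  have xb_elem: "cadd C x (u b) \<in> elems C" and \<delta>_elem: "?\<delta> \<in> elems C" using insert.prems by auto
  have closed: "?T p y \<in> elems C" if "y \<in> elems C" for p y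
    using that insert.hyps insert.prems by (intro parity_sum_closed) auto
  have parity_sums_eq: "?T True y = cadd C (?T False y) ?\<delta>" if "y \<in> elems C" for y
    using that insert.prems by (intro insert.IH) auto
  have "parity_sum True u (insert b (insert a I)) x =
      cadd C (?T True (cadd C x (u b))) (?T False x)"
    using parity_sum_insert[OF aI_finite b_notin insert.prems(2) u_bI_elem] by simp
  also have "\<dots> = cadd C (?T False (cadd C x (u b))) (?T True x)"
    using closed xb_elem \<delta>_elem insert.prems(2) by (simp add: parity_sums_eq add.m_ac)
  also have "\<dots> = parity_sum False u (insert b (insert a I)) x"
    using parity_sum_insert[OF aI_finite b_notin insert.prems(2) u_bI_elem] by simp
  finally show ?case
    using insert.prems aI_finite u_bI_elem by (simp add: insert_commute parity_sum_closed)
qed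

lemma parity_sum_False_cle_True:
  assumes "finite I" and "x \<in> elems C" and "u \<in> I \<rightarrow> elems C"
  shows "cle C (parity_sum False u I x) (parity_sum True u I x)"
proof (cases "I = {}")
  case True
  have "parity_sum False u {} x = czero C" "parity_sum True u {} x = cadd C (czero C) x"
    using assms(2) by (auto simp: parity_sum_def csum_insert cong: conj_cong)
  then show ?thesis using True assms(2) cle_add[of x "czero C"] by simp
next
  case False
  then obtain a where "a \<in> I" by blast
  then show ?thesis
    using assms parity_sum_True_insert[of "I - {a}" a x u] cle_add
    by (auto simp: insert_absorb)
qed

end

lemma additive_csum:
  assumes "cone C" "cone D" and f_closed: "f \<in> elems C \<rightarrow> elems D"
    and f_zero: "f (czero C) = czero D"
    and f_add: "\<And>x y. x \<in> elems C \<Longrightarrow> y \<in> elems C \<Longrightarrow> f (cadd C x y) = cadd D (f x) (f y)"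
    and "finite J" "u \<in> J \<rightarrow> elems C"
  shows "f (csum C u J) = csum D (\<lambda>j. f (u j)) J"
proof -
  interpret C: cone C by fact
  interpret D: cone D by fact
  show ?thesis using assms(6,7)
  proof (induction J)
    case (insert j J)
    then show ?case using f_closed f_zero f_add by (auto simp: C.csum_insert D.csum_insert Pi_iff)
  qed (simp add: f_zero)
qed

lemma additive_pre_stable:
  assumes "cone C" "cone D" and f_closed: "f \<in> elems C \<rightarrow> elems D"
    and f_zero: "f (czero C) = czero D"
    and f_add: "\<And>x y. x \<in> elems C \<Longrightarrow> y \<in> elems C \<Longrightarrow> f (cadd C x y) = cadd D (f x) (f y)"
  shows "pre_stable C D (restrict f (unit_ball C))"
  unfolding pre_stable_def
proof (intro allI impI, elim conjE)
  interpret C: cone C by fact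
  interpret D: cone D by fact
  fix n :: nat and x and u :: "nat \<Rightarrow> 'a"
  assume x_elem: "x \<in> elems C" and u_elem: "\<forall>i\<in>{1..n}. u i \<in> elems C"
      and sum_unit_ball: "cadd C x (csum C u {1..n}) \<in> unit_ball C"
  have fu_elem: "(\<lambda>i. f (u i)) \<in> {1..n} \<rightarrow> elems D" using u_elem f_closed f_zero f_add by auto
  have "csum D (\<lambda>J. restrict f (unit_ball C) (cadd C x (csum C u J))) {J. J \<subseteq> {1..n} \<and>
      even (n - card J) = p} =
      D.parity_sum p (\<lambda>i. f (u i)) {1..n} (f x)" for p
    unfolding D.parity_sum_def
  proof (rule D.csum_cong)
    show "(\<lambda>J. cadd D (f x) (csum D (\<lambda>i. f (u i)) J)) \<in>
        {J. J \<subseteq> {1..n} \<and> even (card ({1..n} - J)) = p} \<rightarrow> elems D"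
      using x_elem f_closed fu_elem by (auto intro!: D.add.m_closed D.csum_closed)
    show "{J. J \<subseteq> {1..n} \<and> even (n - card J) = p} = {J. J \<subseteq> {1..n} \<and> even (card ({1..n} - J)) = p}"
      by (auto simp: card_Diff_subset finite_subset)
    fix J assume "J \<in> {J. J \<subseteq> {1..n} \<and> even (card ({1..n} - J)) = p}"
    then have J_subset: "J \<subseteq> {1..n}" by simp
    then have J_finite: "finite J" and u_J_elem: "u \<in> J \<rightarrow> elems C"
      using u_elem by (auto intro: finite_subset)
    have "cadd C x (csum C u J) \<in> unit_ball C"
      by (rule C.subset_sum_in_unit_ball[OF _ J_subset x_elem _ sum_unit_ball]) (use u_elem in auto)
    then show "restrict f (unit_ball C) (cadd C x (csum C u J)) =
        cadd D (f x) (csum D (\<lambda>i. f (u i)) J)"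
      using x_elem J_finite u_J_elem f_add[OF x_elem C.csum_closed[OF u_J_elem]]
        additive_csum[OF assms J_finite u_J_elem] by simp
  qed
  from this[of True] this[of False]
  show "cle D
      (csum D (\<lambda>J. restrict f (unit_ball C) (cadd C x (csum C u J))) {J. J \<subseteq> {1..n} \<and>
        odd (n - card J)})
      (csum D (\<lambda>J. restrict f (unit_ball C) (cadd C x (csum C u J))) {J. J \<subseteq> {1..n} \<and>
        even (n - card J)})"
    using D.parity_sum_False_cle_True[OF _ _ fu_elem, of "f x"] x_elem f_closed by auto
qed

lemma linear_scott_LIMSEQ:
  assumes "linear_scott C l" and "nondecreasing C x" and "is_seq_lub C x s"
  shows "incseq (\<lambda>n. l (x n))" and "(\<lambda>n. l (x n)) \<longlonglongrightarrow> l s"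
proof -
  show inc: "incseq (\<lambda>n. l (x n))"
  proof (rule incseq_SucI)
    fix n
    have x_elem: "x n \<in> elems C" and "cle C (x n) (x (Suc n))"
      using assms(2) by (auto simp: nondecreasing_def)
    then obtain z where "z \<in> elems C" "x (Suc n) = cadd C (x n) z" by (auto simp: cle_def)
    then show "l (x n) \<le> l (x (Suc n))" using assms(1) x_elem by (simp add: linear_scott_def)
  qed
  have "bdd_above (range (\<lambda>n. l (x n)))" "l s = (SUP n. l (x n))"
    using assms by (simp_all add: linear_scott_def)
  then show "(\<lambda>n. l (x n)) \<longlonglongrightarrow> l s" using LIMSEQ_incseq_SUP[OF _ inc] by simp
qed

lemma linear_scottI:
  assumes "\<And>x. x \<in> elems C \<Longrightarrow> 0 \<le> l x"
    and "\<And>x y. x \<in> elems C \<Longrightarrow> y \<in> elems C \<Longrightarrow> l (cadd C x y) = l x + l y"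
    and "\<And>\<alpha> x. 0 \<le> \<alpha> \<Longrightarrow> x \<in> elems C \<Longrightarrow> l (cscale C \<alpha> x) = \<alpha> * l x"
    and inc: "\<And>x s. nondecreasing C x \<Longrightarrow> is_seq_lub C x s \<Longrightarrow> incseq (\<lambda>n. l (x n))"
    and lim: "\<And>x s. nondecreasing C x \<Longrightarrow> is_seq_lub C x s \<Longrightarrow> (\<lambda>n. l (x n)) \<longlonglongrightarrow> l s"
  shows "linear_scott C l"
  unfolding linear_scott_def
proof (intro conjI ballI allI impI; (elim conjE)?)
  fix x s assume x_nondecreasing: "nondecreasing C x" and s_lub: "is_seq_lub C x s"
  show bdd: "bdd_above (range (\<lambda>n. l (x n)))"
    using incseq_le[OF inc lim] x_nondecreasing s_lub by (auto intro!: bdd_aboveI[of _ "l s"])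
  show "l s = (SUP n. l (x n))"
    using LIMSEQ_incseq_SUP[OF bdd inc[OF x_nondecreasing s_lub]] lim[OF x_nondecreasing s_lub]
    by (rule LIMSEQ_unique[rotated])
qed (use assms in auto)

lemma linear_scott_sum:
  assumes "\<And>j. j \<in> J \<Longrightarrow> linear_scott C (l j)"
  shows "linear_scott C (\<lambda>x. \<Sum>j\<in>J. l j x)"
proof (rule linear_scottI)
  show "incseq (\<lambda>n. \<Sum>j\<in>J. l j (x n))" if "nondecreasing C x" "is_seq_lub C x s" for x s
    using linear_scott_LIMSEQ(1)[OF assms that] by (auto simp: incseq_def intro!: sum_mono)
  show "(\<lambda>n. \<Sum>j\<in>J. l j (x n)) \<longlonglongrightarrow> (\<Sum>j\<in>J. l j s)" if "nondecreasing C x" "is_seq_lub C x s" for x s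
    using linear_scott_LIMSEQ(2)[OF assms that] by (rule tendsto_sum)
qed (use assms in
    \<open>auto simp: linear_scott_def sum_nonneg sum.distrib sum_distrib_left intro!: sum.cong\<close>)

subsection \<open>Measurable paths\<close>

lemma meas_path_cong:
  assumes "\<And>s. s \<in> space (Rn n) \<Longrightarrow> \<gamma> s = \<gamma>' s"
  shows "meas_path C n \<gamma> \<longleftrightarrow> meas_path C n \<gamma>'"
proof -
  have "(\<lambda>(r, s). l r (\<gamma> s)) \<in> borel_measurable (Rn k \<Otimes>\<^sub>M Rn n) \<longleftrightarrow>
      (\<lambda>(r, s). l r (\<gamma>' s)) \<in> borel_measurable (Rn k \<Otimes>\<^sub>M Rn n)" for k l
    using assms by (intro measurable_cong) (auto simp: space_pair_measure)
  then show ?thesis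
    unfolding meas_path_def
    by (intro conj_cong ex_cong1 ball_cong all_cong1 refl) (simp_all add: assms)
qed

lemma meas_path_test_measurable:
  assumes "meas_path C n \<gamma>" and "l \<in> tests C k" and "r \<in> space (Rn k)"
  shows "(\<lambda>s. l r (\<gamma> s)) \<in> borel_measurable (Rn n)"
proof -
  have test: "(\<lambda>(r, s). l r (\<gamma> s)) \<in> borel_measurable (Rn k \<Otimes>\<^sub>M Rn n)"
    using assms(1,2) by (auto simp: meas_path_def)
  show ?thesis
    using measurable_compose[OF measurable_Pair1'[OF assms(3)] test] by simp
qed

subsection \<open>Linear isometries\<close>

locale cone_isometry = C: cone C for C :: "'c mcone" +
  fixes D :: "'d mcone" and f :: "'c \<Rightarrow> 'd"
  assumes complete: "seq_complete C"
    and bij: "bij_betw f (elems C) (elems D)"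
    and map_zero: "f (czero C) = czero D"
    and map_add: "x \<in> elems C \<Longrightarrow> y \<in> elems C \<Longrightarrow> f (cadd C x y) = cadd D (f x) (f y)"
    and map_scale: "0 \<le> \<alpha> \<Longrightarrow> x \<in> elems C \<Longrightarrow> f (cscale C \<alpha> x) = cscale D \<alpha> (f x)"
    and norm_map: "x \<in> elems C \<Longrightarrow> cnorm D (f x) = cnorm C x"
begin

abbreviation inverse :: "'d \<Rightarrow> 'c" where
  "inverse \<equiv> inv_into (elems C) f"

lemma elems_image: "elems D = f ` elems C"
  using bij by (simp add: bij_betw_def)

lemma map_closed: "x \<in> elems C \<Longrightarrow> f x \<in> elems D"
  by (simp add: elems_image)

lemma map_eq_iff: "x \<in> elems C \<Longrightarrow> y \<in> elems C \<Longrightarrow> f x = f y \<longleftrightarrow> x = y"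
  using bij by (auto simp: bij_betw_def inj_on_eq_iff)

lemma inverse_closed: "y \<in> elems D \<Longrightarrow> inverse y \<in> elems C"
  by (simp add: elems_image inv_into_into)

lemma map_inverse: "y \<in> elems D \<Longrightarrow> f (inverse y) = y"
  by (simp add: elems_image f_inv_into_f)

lemma inverse_map: "x \<in> elems C \<Longrightarrow> inverse (f x) = x"
  using bij by (simp add: bij_betw_def)

lemma comm_monoid_image: "comm_monoid (cone_monoid D)"
proof (rule comm_monoidI)
qed (auto simp: cone_monoid_def elems_image C.add.m_ac simp flip: map_add map_zero)

lemma is_cone_image: "is_cone D"
  unfolding is_cone_def elems_image ball_simps
  by (intro conjI comm_monoid_image allI ballI impI)
    (simp_all
        add: map_eq_iff norm_map C.scale_closed C.scale_add C.add_scale C.scale_scale C.scale_one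
      C.scale_zero_left C.scale_zero_right C.add_left_cancel C.norm_nonneg C.norm_scale C.norm_eq_0
      C.norm_add_le C.norm_le_norm_add flip: map_add map_scale map_zero)

sublocale D: cone D
  by (rule cone.intro) (rule is_cone_image)

lemma cle_map_iff: "x \<in> elems C \<Longrightarrow> y \<in> elems C \<Longrightarrow> cle D (f x) (f y) \<longleftrightarrow> cle C x y"
  by (auto simp: cle_def elems_image map_eq_iff simp flip: map_add)

lemma nondecreasing_map_iff:
  "(\<And>n. x n \<in> elems C) \<Longrightarrow> nondecreasing D (\<lambda>n. f (x n)) \<longleftrightarrow> nondecreasing C x"
  by (simp add: nondecreasing_def map_closed cle_map_iff)

lemma is_seq_lub_map_iff:
  "(\<And>n. x n \<in> elems C) \<Longrightarrow> s \<in> elems C \<Longrightarrow> is_seq_lub D (\<lambda>n. f (x n)) (f s) \<longleftrightarrow> is_seq_lub C x s"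
  by (simp add: is_seq_lub_def elems_image cle_map_iff)

lemma map_in_unit_ball_iff: "x \<in> elems C \<Longrightarrow> f x \<in> unit_ball D \<longleftrightarrow> x \<in> unit_ball C"
  by (simp add: unit_ball_def map_closed norm_map)

lemma map_unit_ball: "x \<in> unit_ball C \<Longrightarrow> f x \<in> unit_ball D"
  by (simp add: unit_ball_def map_closed norm_map)

lemma inverse_unit_ball:
  assumes "y \<in> unit_ball D"
  shows "inverse y \<in> unit_ball C"
proof -
  have "y \<in> elems D" using assms by (simp add: unit_ball_def)
  then show ?thesis
    using assms map_in_unit_ball_iff[of "inverse y"] by (simp add: inverse_closed map_inverse)
qed

lemma seq_complete_image: "seq_complete D"
  unfolding seq_complete_def
proof (intro allI impI, elim conjE)
  fix y assume y_nondecreasing: "nondecreasing D y" and ball: "range y \<subseteq> unit_ball D"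
  have map_y: "f (inverse (y n)) = y n" and inverse_y_elem: "inverse (y n) \<in> elems C" for n
    using y_nondecreasing by (simp_all add: nondecreasing_def map_inverse inverse_closed)
  have "nondecreasing C (\<lambda>n. inverse (y n))"
    using nondecreasing_map_iff[OF inverse_y_elem] y_nondecreasing by (simp add: map_y)
  moreover have "range (\<lambda>n. inverse (y n)) \<subseteq> unit_ball C" using ball inverse_unit_ball by blast
  ultimately obtain s where s_unit_ball: "s \<in> unit_ball C"
      and s_lub: "is_seq_lub C (\<lambda>n. inverse (y n)) s"
    using complete unfolding seq_complete_def by blast
  then have "s \<in> elems C" by (simp add: unit_ball_def)
  then have "is_seq_lub D y (f s)"
    using is_seq_lub_map_iff[OF inverse_y_elem] s_lub by (simp add: map_y)
  then show "\<exists>t\<in>unit_ball D. is_seq_lub D y t" using map_unit_ball[OF s_unit_ball] by blast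
qed

lemma inverse_isometry: "cone_isometry D C inverse"
proof
  show "seq_complete D" by (rule seq_complete_image)
  show "bij_betw inverse (elems D) (elems C)" by (rule bij_betw_inv_into[OF bij])
  show "inverse (czero D) = czero C" by (simp add: inverse_map flip: map_zero)
qed (auto simp: elems_image inverse_map norm_map C.scale_closed simp flip: map_add map_scale)

lemma stable_restrict: "stable C D (restrict f (unit_ball C))"
  unfolding stable_def
proof (intro conjI allI impI; (elim conjE)?)
  show "restrict f (unit_ball C) \<in> unit_ball C \<rightarrow>\<^sub>E elems D" by (simp add: unit_ball_def map_closed)
  show "pre_stable C D (restrict f (unit_ball C))"
    by (intro additive_pre_stable C.cone_axioms D.cone_axioms map_zero map_add)
      (simp add: map_closed)
  show "\<exists>B. \<forall>x\<in>unit_ball C. cnorm D (restrict f (unit_ball C) x) \<le> B"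
    by (intro exI[of _ 1]) (simp add: unit_ball_def norm_map)
next
  fix x s assume x_nondecreasing: "nondecreasing C x" and x_range: "range x \<subseteq> unit_ball C"
      and s_lub: "is_seq_lub C x s"
  have "s \<in> unit_ball C" by (rule C.seq_lub_in_unit_ball[OF complete x_nondecreasing x_range s_lub])
  moreover have "x n \<in> unit_ball C" "x n \<in> elems C" for n
    using x_range by (auto simp: unit_ball_def)
  moreover have "s \<in> elems C" using s_lub by (simp add: is_seq_lub_def)
  ultimately show "is_seq_lub D (\<lambda>n. restrict f (unit_ball C) (x n)) (restrict f (unit_ball C) s)"
    using s_lub by (simp add: is_seq_lub_map_iff)
qed

lemma linear_scott_image:
  assumes l_linear_scott: "linear_scott C (\<lambda>x. l (f x))"
  shows "linear_scott D l"
proof (rule linear_scottI)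
  fix y s assume y_nondecreasing: "nondecreasing D y" and s_lub: "is_seq_lub D y s"
  have map_y: "f (inverse (y n)) = y n" and inverse_y_elem: "inverse (y n) \<in> elems C" for n
    using y_nondecreasing by (simp_all add: nondecreasing_def map_inverse inverse_closed)
  have map_s: "f (inverse s) = s" and inverse_s_elem: "inverse s \<in> elems C"
    using s_lub by (simp_all add: is_seq_lub_def map_inverse inverse_closed)
  have "nondecreasing C (\<lambda>n. inverse (y n))"
    using nondecreasing_map_iff[OF inverse_y_elem] y_nondecreasing by (simp add: map_y)
  moreover have "is_seq_lub C (\<lambda>n. inverse (y n)) (inverse s)"
    using is_seq_lub_map_iff[OF inverse_y_elem inverse_s_elem] s_lub by (simp add: map_y map_s)
  ultimately show "incseq (\<lambda>n. l (y n))" "(\<lambda>n. l (y n)) \<longlonglongrightarrow> l s"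
    using linear_scott_LIMSEQ[OF l_linear_scott, of "\<lambda>n. inverse (y n)" "inverse s"]
    by (simp_all add: map_y map_s)
qed (use l_linear_scott in \<open>auto simp: elems_image linear_scott_def simp flip: map_add map_scale\<close>)

theorem cstab_iso_restrict:
  assumes "measurable_cone C" and "measurable_cone D"
    and path: "\<And>n \<gamma>. unitary_path C n \<gamma> \<Longrightarrow> meas_path D n (\<lambda>s. f (\<gamma> s))"
    and inverse_path: "\<And>n \<gamma>. unitary_path D n \<gamma> \<Longrightarrow> meas_path C n (\<lambda>s. inverse (\<gamma> s))"
  shows "cstab_iso C D (restrict f (unit_ball C))"
proof -
  interpret inv: cone_isometry D C inverse by (rule inverse_isometry)
  have "meas_path D n (\<lambda>s. restrict f (unit_ball C) (\<gamma> s))" if "unitary_path C n \<gamma>" for n \<gamma>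
    using path[OF that] that
      meas_path_cong[of n "\<lambda>s. restrict f (unit_ball C) (\<gamma> s)" "\<lambda>s. f (\<gamma> s)" D]
    by (simp add: unitary_path_def)
  then have "restrict f (unit_ball C) \<in> cstab_hom C D"
    using stable_restrict by (simp add: cstab_hom_def meas_stable_def map_unit_ball)
  moreover
  have "meas_path C n (\<lambda>s. restrict inverse (unit_ball D) (\<gamma> s))" if "unitary_path D n \<gamma>" for n \<gamma>
    using inverse_path[OF that] that
      meas_path_cong[of n "\<lambda>s. restrict inverse (unit_ball D) (\<gamma> s)" "\<lambda>s. inverse (\<gamma> s)" C]
    by (simp add: unitary_path_def)
  then have "restrict inverse (unit_ball D) \<in> cstab_hom D C"
    using inv.stable_restrict by (simp add: cstab_hom_def meas_stable_def inverse_unit_ball)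
  moreover have "cstab_comp C (restrict inverse (unit_ball D)) (restrict f (unit_ball C)) =
      cstab_id C"
    unfolding cstab_comp_def compose_def cstab_id_def
    by (rule restrict_ext) (simp add: map_unit_ball unit_ball_elem inverse_map)
  moreover have "cstab_comp D (restrict f (unit_ball C)) (restrict inverse (unit_ball D)) =
      cstab_id D"
    unfolding cstab_comp_def compose_def cstab_id_def
    by (rule restrict_ext) (simp add: inverse_unit_ball unit_ball_elem map_inverse)
  ultimately show ?thesis using assms(1,2) unfolding cstab_iso_def by blast
qed

end

section \<open>The cone of a probabilistic coherence space\<close>

lemma czero_Fm [simp]: "czero (Fm X) = 0"
  and cadd_Fm [simp]: "cadd (Fm X) x y = x + y"
  and cscale_Fm [simp]: "cscale (Fm X) c x = (\<lambda>a. c * x a)"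
  and tests_Fm: "tests (Fm X) n = {\<lambda>r x. 0} \<union> {\<lambda>r x. x a | a. a \<in> web X}"
  by (simp_all add: Fm_def fun_eq_iff)

lemma Fm_elem_iff: "x \<in> elems (Fm X) \<longleftrightarrow> (\<exists>c\<ge>0. \<exists>u\<in>cliques X. x = (\<lambda>a. c * u a))"
  by (auto simp: Fm_def)

lemma Fm_norm_eq: "cnorm (Fm X) x = Inf {1 / r | r. 0 < r \<and> (\<lambda>a. r * x a) \<in> cliques X}"
  by (simp add: Fm_def)

context coherence_space
begin

lemma clique_elem: "x \<in> cliques X \<Longrightarrow> x \<in> elems (Fm X)"
  unfolding Fm_elem_iff by (intro exI[of _ 1]) simp

lemma elem_nonneg: "x \<in> elems (Fm X) \<Longrightarrow> 0 \<le> x"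
  using clique_nonneg by (fastforce simp: Fm_elem_iff le_fun_def)

lemma elem_outside: "x \<in> elems (Fm X) \<Longrightarrow> a \<notin> web X \<Longrightarrow> x a = 0"
  using clique_outside by (auto simp: Fm_elem_iff)

lemma elem_nnvecs: "x \<in> elems (Fm X) \<Longrightarrow> x \<in> nnvecs (web X)"
  by (simp add: nnvecs_iff elem_nonneg elem_outside)

lemma scaled_clique_add:
  assumes "u \<in> cliques X" "v \<in> cliques X" and "0 \<le> s" "0 \<le> t"
  shows "\<exists>w\<in>cliques X. (\<lambda>a. s * u a) + (\<lambda>a. t * v a) = (\<lambda>a. (s + t) * w a)"
proof (cases "s + t = 0")
  case True
  then show ?thesis using assms by (intro bexI[OF _ clique_zero]) (auto simp: add_nonneg_eq_0_iff)
next
  case False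
  then have "0 < s + t" using assms by simp
  then have "(\<lambda>a. s / (s + t) * u a + t / (s + t) * v a) \<in> cliques X"
    using assms by (intro clique_subconvex) (auto simp flip: add_divide_distrib)
  then show ?thesis
    using False
    by (intro bexI[of _ "\<lambda>a. s / (s + t) * u a + t / (s + t) * v a"])
      (auto simp: fun_eq_iff distrib_left)
qed

lemma scaled_clique_antimono:
  assumes "u \<in> cliques X" and "0 \<le> c" and "0 \<le> y" and "y \<le> (\<lambda>a. c * u a)"
  shows "\<exists>v\<in>cliques X. y = (\<lambda>a. c * v a)"
proof (cases "c = 0")
  case True
  then have "y = (\<lambda>a. c * 0 a)"
    using assms(3,4) by (auto simp: le_fun_def fun_eq_iff intro: antisym)
  then show ?thesis using clique_zero by blast
next
  case False
  then have "(\<lambda>a. y a / c) \<in> cliques X"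
    using assms(2-4) by (intro clique_antimono[OF assms(1)]) (auto simp: le_fun_def field_simps)
  then show ?thesis using False by (intro bexI[of _ "\<lambda>a. y a / c"]) auto
qed

lemma ex_norm_scale:
  assumes "x \<in> elems (Fm X)"
  shows "{1 / r | r. 0 < r \<and> (\<lambda>a. r * x a) \<in> cliques X} \<noteq> {}"
proof -
  obtain c u where c_nonneg: "0 \<le> c" and u_clique: "u \<in> cliques X" and x_eq: "x = (\<lambda>a. c * u a)"
    using assms Fm_elem_iff by blast
  have "(\<lambda>a. c / (c + 1) * u a) \<in> cliques X" using c_nonneg by (intro clique_scale u_clique) auto
  then have "(\<lambda>a. 1 / (c + 1) * x a) \<in> cliques X" by (simp add: x_eq)
  moreover have "0 < 1 / (c + 1)" using c_nonneg by simp
  ultimately show ?thesis by blast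
qed

lemma norm_nonneg: "x \<in> elems (Fm X) \<Longrightarrow> 0 \<le> cnorm (Fm X) x"
  unfolding Fm_norm_eq by (rule cInf_greatest[OF ex_norm_scale]) auto

lemma divide_clique_if_norm_less:
  assumes "x \<in> elems (Fm X)" and "cnorm (Fm X) x < d"
  shows "(\<lambda>a. x a / d) \<in> cliques X"
proof -
  obtain r where r_pos: "0 < r" and r_clique: "(\<lambda>a. r * x a) \<in> cliques X" and r_less: "1 / r < d"
    using cInf_lessD[OF ex_norm_scale[OF assms(1)], of d] assms(2) by (auto simp: Fm_norm_eq)
  then have "0 < d" by (meson less_trans zero_less_divide_1_iff)
  then have "(\<lambda>a. 1 / (r * d) * (r * x a)) \<in> cliques X"
    using r_pos r_clique r_less by (intro clique_scale[OF r_clique]) (auto simp: field_simps)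
  then show ?thesis using r_pos by simp
qed

lemma norm_eq_0:
  assumes x_elem: "x \<in> elems (Fm X)" and "cnorm (Fm X) x = 0"
  shows "x = 0"
proof
  fix a
  obtain B where u_bound: "\<And>u. u \<in> cliques X \<Longrightarrow> u a \<le> B" using clique_bound by blast
  have x_le_scaled: "x a \<le> d * B" if "0 < d" for d
    using u_bound[OF divide_clique_if_norm_less[OF x_elem], of d] assms(2) that
    by (simp add: pos_divide_le_eq mult.commute)
  have "x a \<le> 0"
  proof (rule field_le_epsilon)
    fix e :: real assume "0 < e"
    moreover have "0 \<le> B" using u_bound[OF clique_zero] by simp
    ultimately have "0 < e / (B + 1)" "e / (B + 1) * B \<le> 0 + e" by (simp_all add: field_simps)
    then show "x a \<le> 0 + e" using x_le_scaled by (meson order_trans)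
  qed
  then show "x a = 0 a" using elem_nonneg[OF x_elem] by (simp add: le_fun_def antisym)
qed

lemma norm_scaled_clique_le:
  assumes u_clique: "u \<in> cliques X" and c_nonneg: "0 \<le> c"
  shows "cnorm (Fm X) (\<lambda>a. c * u a) \<le> c"
proof (rule dense_ge)
  fix d assume c_less: "c < d"
  have "(\<lambda>a. c / d * u a) \<in> cliques X" using c_nonneg c_less by (intro clique_scale u_clique) auto
  then have "1 / (1 / d) \<in> {1 / r | r. 0 < r \<and> (\<lambda>a. r * (c * u a)) \<in> cliques X}"
    using c_nonneg c_less by (intro CollectI exI[of _ "1 / d"]) simp
  then show "cnorm (Fm X) (\<lambda>a. c * u a) \<le> d"
    unfolding Fm_norm_eq by (intro cInf_lower[THEN order_trans]) (auto intro: bdd_belowI[of _ 0])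
qed

lemma norm_le_iff:
  assumes x_elem: "x \<in> elems (Fm X)" and c_nonneg: "0 \<le> c"
  shows "cnorm (Fm X) x \<le> c \<longleftrightarrow> (\<exists>u\<in>cliques X. x = (\<lambda>a. c * u a))"
proof
  assume norm_le: "cnorm (Fm X) x \<le> c"
  show "\<exists>u\<in>cliques X. x = (\<lambda>a. c * u a)"
  proof (cases "c = 0")
    case True
    then have "x = 0" using norm_le norm_nonneg[OF x_elem] by (intro norm_eq_0[OF x_elem]) simp
    then show ?thesis using True clique_zero by (intro bexI[of _ 0]) (auto simp: fun_eq_iff)
  next
    case False
    then have c_pos: "0 < c" using c_nonneg by simp
    have "(\<lambda>a. x a / c) \<in> cliques X"
    proof (rule clique_LIMSEQ[of "\<lambda>n a. x a / (c + 1 / real (Suc n))"])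
      show "(\<lambda>a. x a / (c + 1 / real (Suc n))) \<in> cliques X" for n
        by (intro divide_clique_if_norm_less[OF x_elem] le_less_trans[OF norm_le]) simp
      show "incseq (\<lambda>n a. x a / (c + 1 / real (Suc n)))"
        using elem_nonneg[OF x_elem] c_pos
        by (auto simp: incseq_def le_fun_def
            intro!: divide_left_mono add_left_mono mult_pos_pos add_pos_nonneg frac_le)
      have "(\<lambda>n. x a / (c + 1 / real (Suc n))) \<longlonglongrightarrow> x a / (c + 0)" for a
        using c_pos LIMSEQ_inverse_real_of_nat
        by (intro tendsto_intros) (auto simp: inverse_eq_divide)
      then show "(\<lambda>n a. x a / (c + 1 / real (Suc n))) \<longlonglongrightarrow> (\<lambda>a. x a / c)"
        by (simp add: tendsto_fun_iff)
    qed
    then show ?thesis using c_pos by (intro bexI[of _ "\<lambda>a. x a / c"]) auto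
  qed
qed (use norm_scaled_clique_le c_nonneg in blast)

lemma unit_ball_Fm: "unit_ball (Fm X) = cliques X"
  using norm_le_iff[of _ 1] clique_elem by (auto simp: unit_ball_def)

lemma norm_scale_clique:
  assumes "x \<in> elems (Fm X)"
  obtains u where "u \<in> cliques X" and "x = (\<lambda>a. cnorm (Fm X) x * u a)"
  using norm_le_iff[OF assms norm_nonneg[OF assms]] that by blast

lemma elem_antimono:
  assumes x_elem: "x \<in> elems (Fm X)" and y_nonneg: "0 \<le> y" and y_le: "y \<le> x"
  shows "y \<in> elems (Fm X)" and "cnorm (Fm X) y \<le> cnorm (Fm X) x"
proof -
  obtain u where u_clique: "u \<in> cliques X" and x_eq: "x = (\<lambda>a. cnorm (Fm X) x * u a)"
    by (rule norm_scale_clique[OF x_elem])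
  have ex_clique: "\<exists>v\<in>cliques X. y = (\<lambda>a. cnorm (Fm X) x * v a)"
    using y_nonneg y_le x_eq
    by (intro scaled_clique_antimono[OF u_clique norm_nonneg[OF x_elem]]) simp_all
  then show "y \<in> elems (Fm X)" using norm_nonneg[OF x_elem] Fm_elem_iff by blast
  then show "cnorm (Fm X) y \<le> cnorm (Fm X) x"
    using ex_clique norm_le_iff norm_nonneg[OF x_elem] by blast
qed

lemma add_elem:
  assumes x_elem: "x \<in> elems (Fm X)" and y_elem: "y \<in> elems (Fm X)"
  shows "x + y \<in> elems (Fm X)" and "cnorm (Fm X) (x + y) \<le> cnorm (Fm X) x + cnorm (Fm X) y"
proof -
  obtain u v where "u \<in> cliques X" "x = (\<lambda>a. cnorm (Fm X) x * u a)"
    and "v \<in> cliques X" "y = (\<lambda>a. cnorm (Fm X) y * v a)"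
    by (metis norm_scale_clique x_elem y_elem)
  then have ex_clique: "\<exists>w\<in>cliques X. x + y = (\<lambda>a. (cnorm (Fm X) x + cnorm (Fm X) y) * w a)"
    using scaled_clique_add[of u v "cnorm (Fm X) x" "cnorm (Fm X) y"] norm_nonneg x_elem y_elem
    by metis
  have "0 \<le> cnorm (Fm X) x + cnorm (Fm X) y" using norm_nonneg x_elem y_elem by simp
  then show "x + y \<in> elems (Fm X)" and "cnorm (Fm X) (x + y) \<le> cnorm (Fm X) x + cnorm (Fm X) y"
    using ex_clique norm_le_iff Fm_elem_iff by blast+
qed

lemma scale_elem:
  assumes x_elem: "x \<in> elems (Fm X)" and s_nonneg: "0 \<le> s"
  shows "(\<lambda>a. s * x a) \<in> elems (Fm X)" and "cnorm (Fm X) (\<lambda>a. s * x a) = s * cnorm (Fm X) x"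
proof -
  have scale: "(\<lambda>a. s * x a) \<in> elems (Fm X) \<and> cnorm (Fm X) (\<lambda>a. s * x a) \<le> s * cnorm (Fm X) x"
    if x_elem: "x \<in> elems (Fm X)" and s_nonneg: "0 \<le> s" for x s
  proof -
    obtain u where u_clique: "u \<in> cliques X" and x_eq: "x = (\<lambda>a. cnorm (Fm X) x * u a)"
      by (rule norm_scale_clique[OF x_elem])
    have "(\<lambda>a. s * x a) = (\<lambda>a. s * cnorm (Fm X) x * u a)" by (subst x_eq) (simp add: mult.assoc)
    then have "\<exists>u\<in>cliques X. (\<lambda>a. s * x a) = (\<lambda>a. s * cnorm (Fm X) x * u a)" using u_clique by blast
    moreover have "0 \<le> s * cnorm (Fm X) x" using s_nonneg norm_nonneg[OF x_elem] by simp
    ultimately show ?thesis using norm_le_iff Fm_elem_iff by blast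
  qed
  show sx_elem: "(\<lambda>a. s * x a) \<in> elems (Fm X)" using scale[OF x_elem s_nonneg] ..
  show "cnorm (Fm X) (\<lambda>a. s * x a) = s * cnorm (Fm X) x"
  proof (cases "s = 0")
    case True
    then show ?thesis using scale[OF x_elem s_nonneg] norm_nonneg[OF sx_elem] by simp
  next
    case False
    then have "cnorm (Fm X) x \<le> 1 / s * cnorm (Fm X) (\<lambda>a. s * x a)"
      using scale[OF sx_elem, of "1 / s"] s_nonneg by simp
    then show ?thesis
      using scale[OF x_elem s_nonneg] s_nonneg False by (simp add: field_simps antisym)
  qed
qed

lemma is_cone_Fm: "is_cone (Fm X)"
  unfolding is_cone_def czero_Fm cadd_Fm cscale_Fm
proof (intro conjI allI ballI impI)
  show "comm_monoid (cone_monoid (Fm X))"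
    by (rule comm_monoidI)
      (auto simp: cone_monoid_def add_elem(1) clique_elem[OF clique_zero] add_ac)
  fix x y assume "x \<in> elems (Fm X)" and "y \<in> elems (Fm X)"
  then show "cnorm (Fm X) x \<le> cnorm (Fm X) (x + y)"
    using elem_nonneg by (intro elem_antimono(2) add_elem(1)) auto
qed (auto simp: scale_elem add_elem norm_nonneg fun_eq_iff distrib_left distrib_right mult.assoc
    dest: norm_eq_0)

sublocale Fm: cone "Fm X"
  by (rule cone.intro) (rule is_cone_Fm)

lemma csum_Fm: "finite J \<Longrightarrow> u \<in> J \<rightarrow> elems (Fm X) \<Longrightarrow> csum (Fm X) u J = sum u J"
  by (induction J rule: finite_induct) (simp_all add: Fm.csum_insert Pi_iff)

lemma sum_elem: "finite J \<Longrightarrow> u \<in> J \<rightarrow> elems (Fm X) \<Longrightarrow> sum u J \<in> elems (Fm X)"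
  using Fm.csum_closed csum_Fm by metis

lemma cle_Fm_iff:
  assumes "x \<in> elems (Fm X)" and "y \<in> elems (Fm X)"
  shows "cle (Fm X) x y \<longleftrightarrow> x \<le> y"
proof
  show "x \<le> y" if "cle (Fm X) x y" using that elem_nonneg by (auto simp: cle_def)
  assume "x \<le> y"
  then have "y - x \<in> elems (Fm X)"
    using elem_nonneg[OF assms(1)] by (intro elem_antimono(1)[OF assms(2)]) (auto simp: le_fun_def)
  then show "cle (Fm X) x y" unfolding cle_def by (rule bexI[rotated]) simp
qed

lemma nondecreasing_Fm_iff: "nondecreasing (Fm X) x \<longleftrightarrow> (\<forall>n. x n \<in> elems (Fm X)) \<and> incseq x"
  by (auto simp: nondecreasing_def cle_Fm_iff incseq_Suc_iff)

lemma is_seq_lub_Fm_iff: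
  assumes x_elem: "\<And>n. x n \<in> elems (Fm X)" and inc: "incseq x"
  shows "is_seq_lub (Fm X) x s \<longleftrightarrow> s \<in> elems (Fm X) \<and> x \<longlonglongrightarrow> s"
proof
  assume lub: "is_seq_lub (Fm X) x s"
  then have s_elem: "s \<in> elems (Fm X)" by (simp add: is_seq_lub_def)
  have x_le_s: "x n \<le> s" for n using lub s_elem x_elem by (auto simp: is_seq_lub_def cle_Fm_iff)
  define t where "t a = (SUP n. x n a)" for a
  have bdd: "bdd_above (range (\<lambda>n. x n a))" for a
    using x_le_s by (auto simp: le_fun_def intro: bdd_aboveI[of _ "s a"])
  have lim: "x \<longlonglongrightarrow> t" unfolding t_def[abs_def] by (rule incseq_LIMSEQ_fun_SUP[OF inc bdd])
  have x_le_t: "x n \<le> t" for n by (rule incseq_LIMSEQ_fun_le[OF inc lim])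
  have t_le_s: "t \<le> s"
    unfolding t_def le_fun_def using x_le_s by (auto simp: le_fun_def intro: cSUP_least)
  have "t \<in> elems (Fm X)"
    using elem_nonneg[OF x_elem] x_le_t[of 0]
    by (intro elem_antimono(1)[OF s_elem _ t_le_s]) (rule order_trans)
  then have "s \<le> t" using lub x_le_t x_elem s_elem by (auto simp: is_seq_lub_def cle_Fm_iff)
  then show "s \<in> elems (Fm X) \<and> x \<longlonglongrightarrow> s" using t_le_s s_elem lim by (simp add: antisym)
next
  assume lim: "s \<in> elems (Fm X) \<and> x \<longlonglongrightarrow> s"
  then have "x n \<le> s" for n using incseq_LIMSEQ_fun_le[OF inc] by blast
  moreover have "s \<le> t" if "\<forall>n. x n \<le> t" for t
    using lim that by (auto simp: tendsto_fun_iff le_fun_def intro: LIMSEQ_le_const2)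
  ultimately show "is_seq_lub (Fm X) x s" using lim x_elem by (auto simp: is_seq_lub_def cle_Fm_iff)
qed

lemma seq_complete_Fm: "seq_complete (Fm X)"
  unfolding seq_complete_def unit_ball_Fm nondecreasing_Fm_iff
proof (intro allI impI, elim conjE)
  fix x assume x_elem: "\<forall>n. x n \<in> elems (Fm X)" and x_incseq: "incseq x"
      and cliques: "range x \<subseteq> cliques X"
  have "bdd_above (range (\<lambda>n. x n a))" for a
    using clique_bound[of a] cliques by (fastforce intro: bdd_aboveI)
  note lim = incseq_LIMSEQ_fun_SUP[OF x_incseq this]
  have sup: "(\<lambda>a. SUP n. x n a) \<in> cliques X"
    using cliques by (intro clique_LIMSEQ[OF _ x_incseq lim]) blast
  then show "\<exists>s\<in>cliques X. is_seq_lub (Fm X) x s"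
    using lim x_elem x_incseq by (intro bexI[OF _ sup]) (simp add: is_seq_lub_Fm_iff clique_elem)
qed

lemma linear_scott_FmI:
  assumes "\<And>x. x \<in> elems (Fm X) \<Longrightarrow> 0 \<le> l x"
    and add: "\<And>x y. x \<in> elems (Fm X) \<Longrightarrow> y \<in> elems (Fm X) \<Longrightarrow> l (x + y) = l x + l y"
    and "\<And>c x. 0 \<le> c \<Longrightarrow> x \<in> elems (Fm X) \<Longrightarrow> l (\<lambda>a. c * x a) = c * l x"
    and lim: "\<And>x s. incseq x \<Longrightarrow> (\<And>n. x n \<in> elems (Fm X)) \<Longrightarrow> s \<in> elems (Fm X) \<Longrightarrow> x \<longlonglongrightarrow> s \<Longrightarrow>
      (\<lambda>n. l (x n)) \<longlonglongrightarrow> l s"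
  shows "linear_scott (Fm X) l"
proof (rule linear_scottI)
  fix x s assume "nondecreasing (Fm X) x" and lub: "is_seq_lub (Fm X) x s"
  then have x_elem: "\<And>n. x n \<in> elems (Fm X)" and x_incseq: "incseq x"
    by (simp_all add: nondecreasing_Fm_iff)
  then show "(\<lambda>n. l (x n)) \<longlonglongrightarrow> l s" using lub by (simp add: is_seq_lub_Fm_iff lim)
  show "incseq (\<lambda>n. l (x n))"
  proof (rule incseq_SucI)
    fix n
    have "cle (Fm X) (x n) (x (Suc n))"
      using x_elem x_incseq by (simp add: cle_Fm_iff incseq_Suc_iff)
    then obtain z where "z \<in> elems (Fm X)" "x (Suc n) = x n + z" by (auto simp: cle_def)
    then show "l (x n) \<le> l (x (Suc n))" using assms(1) add x_elem by simp
  qed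
qed (use assms in auto)

lemma linear_scott_coordinate: "linear_scott (Fm X) (\<lambda>x. x a)"
  by (rule linear_scott_FmI) (use elem_nonneg in \<open>auto simp: le_fun_def tendsto_fun_iff\<close>)

lemma linear_scott_zero: "linear_scott (Fm X) (\<lambda>x. 0)"
  by (rule linear_scott_FmI) auto

lemma measurable_cone_Fm: "measurable_cone (Fm X)"
  unfolding measurable_cone_def
  by (auto simp: tests_Fm is_cone_Fm seq_complete_Fm linear_scott_coordinate linear_scott_zero)

lemma meas_path_Fm_iff:
  "meas_path (Fm X) n \<gamma> \<longleftrightarrow> (\<forall>s\<in>space (Rn n). \<gamma> s \<in> elems (Fm X)) \<and>
     (\<exists>B. \<forall>s\<in>space (Rn n). cnorm (Fm X) (\<gamma> s) \<le> B) \<and>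
     (\<forall>a\<in>web X. (\<lambda>s. \<gamma> s a) \<in> borel_measurable (Rn n))" (is "?L \<longleftrightarrow> ?R")
proof
  assume left: ?L
  have "(\<lambda>s. \<gamma> s a) \<in> borel_measurable (Rn n)" if "a \<in> web X" for a
    using meas_path_test_measurable[OF left, of "\<lambda>r x. x a" 0 "\<lambda>_. undefined"] that
    by (auto simp: tests_Fm space_PiM)
  then show ?R using left by (auto simp: meas_path_def)
next
  assume right: ?R
  then have "(\<lambda>p. \<gamma> (snd p) a) \<in> borel_measurable (Rn k \<Otimes>\<^sub>M Rn n)" if "a \<in> web X" for k a
    using that by (intro measurable_compose[OF measurable_snd]) auto
  then show ?L using right by (auto simp: meas_path_def tests_Fm case_prod_beta)
qed

lemma meas_path_Fm_coordinate:
  assumes "meas_path (Fm X) n \<gamma>"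
  shows "(\<lambda>s. \<gamma> s a) \<in> borel_measurable (Rn n)"
proof (cases "a \<in> web X")
  case False
  then have "\<gamma> s a = 0" if "s \<in> space (Rn n)" for s
    using assms that by (auto simp: meas_path_def elem_outside)
  then show ?thesis using measurable_cong[of "Rn n" "\<lambda>s. \<gamma> s a" "\<lambda>s. 0" borel] by simp
qed (use assms in \<open>simp add: meas_path_Fm_iff\<close>)

lemma unitary_path_Fm_iff:
  "unitary_path (Fm X) n \<gamma> \<longleftrightarrow> (\<forall>s\<in>space (Rn n). \<gamma> s \<in> cliques X) \<and>
     (\<forall>a\<in>web X. (\<lambda>s. \<gamma> s a) \<in> borel_measurable (Rn n))"
  by (auto simp: unitary_path_def meas_path_Fm_iff unit_ball_Fm[symmetric] unit_ball_def)

end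

section \<open>Finite differences\<close>

definition forward_diff :: "'v::ab_semigroup_add \<Rightarrow> ('v \<Rightarrow> 'w::ab_group_add) \<Rightarrow> 'v \<Rightarrow> 'w" where
  "forward_diff u g x = g (x + u) - g x"

lemma comp_fun_commute_forward_diff: "comp_fun_commute forward_diff"
  by standard (simp add: forward_diff_def fun_eq_iff add_ac)

definition iter_diff :: "'v::ab_semigroup_add multiset \<Rightarrow> ('v \<Rightarrow> 'w::ab_group_add) \<Rightarrow> 'v \<Rightarrow> 'w" where
  "iter_diff M g = fold_mset forward_diff g M"

lemma iter_diff_empty [simp]: "iter_diff {#} g = g"
  by (simp add: iter_diff_def)

lemma iter_diff_add_mset: "iter_diff (add_mset u M) g = forward_diff u (iter_diff M g)"
  and iter_diff_add_mset': "iter_diff (add_mset u M) g = iter_diff M (forward_diff u g)"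
  by (simp_all
    add: iter_diff_def comp_fun_commute.fold_mset_add_mset[OF comp_fun_commute_forward_diff]
      comp_fun_commute.fold_mset_fun_left_comm[OF comp_fun_commute_forward_diff])

lemma iter_diff_shift: "iter_diff M (\<lambda>x. g (x + v)) x = iter_diff M g (x + v)"
  by (induction M arbitrary: x) (simp_all add: iter_diff_add_mset forward_diff_def add_ac)

lemma iter_diff_add: "iter_diff M (\<lambda>x. g x + h x) x = iter_diff M g x + iter_diff M h x"
  by (induction M arbitrary: x) (simp_all add: iter_diff_add_mset forward_diff_def)

lemma iter_diff_zero [simp]: "iter_diff M (\<lambda>x. 0) x = 0"
  by (induction M arbitrary: x) (simp_all add: iter_diff_add_mset forward_diff_def)

lemma iter_diff_comp_additive:
  assumes "\<And>x y. L (x + y) = L x + L y"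
  shows "iter_diff M (\<lambda>x. g (L x)) x = iter_diff (image_mset L M) g (L x)"
  by (induction M arbitrary: x) (simp_all add: iter_diff_add_mset forward_diff_def assms)

lemma iter_diff_eq_alternating_sum:
  fixes g :: "'v::comm_monoid_add \<Rightarrow> 'w::comm_ring_1"
  assumes "finite I"
  shows "iter_diff (image_mset u (mset_set I)) g x =
      (\<Sum>J\<in>Pow I. (-1) ^ card (I - J) * g (x + sum u J))"
  using assms
proof (induction I arbitrary: x)
  case (insert a I)
  let ?s = "\<lambda>I x J. (-1) ^ card (I - J) * g (x + sum u J)"
  have a_notin: "a \<notin> J" and J_finite: "finite J" if "J \<in> Pow I" for J
    using that insert.hyps by (auto intro: finite_subset)
  have "(\<Sum>J\<in>Pow (insert a I). ?s (insert a I) x J) =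
      (\<Sum>J\<in>Pow I. ?s (insert a I) x J) + (\<Sum>J\<in>insert a ` Pow I. ?s (insert a I) x J)"
    unfolding Pow_insert using insert.hyps by (intro sum.union_disjoint) auto
  also have "(\<Sum>J\<in>insert a ` Pow I. ?s (insert a I) x J) =
      (\<Sum>J\<in>Pow I. ?s (insert a I) x (insert a J))"
    using a_notin
    by (intro sum.reindex_cong[where l = "insert a"]) (auto simp: inj_on_def dest: insert_ident)
  also have "\<dots> = (\<Sum>J\<in>Pow I. ?s I (x + u a) J)"
  proof (rule sum.cong[OF refl])
    fix J assume "J \<in> Pow I"
    then have "insert a I - insert a J = I - J" "sum u (insert a J) = u a + sum u J"
      using a_notin J_finite insert.hyps(2) by auto
    then show "?s (insert a I) x (insert a J) = ?s I (x + u a) J" by (simp add: add_ac)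
  qed
  also have "(\<Sum>J\<in>Pow I. ?s (insert a I) x J) = - (\<Sum>J\<in>Pow I. ?s I x J)"
    unfolding sum_negf[symmetric]
  proof (rule sum.cong[OF refl])
    fix J assume "J \<in> Pow I"
    then show "?s (insert a I) x J = - ?s I x J"
      using a_notin J_finite insert.hyps by (simp add: insert_Diff_if)
  qed
  finally show ?case
    using insert.hyps by (simp add: iter_diff_add_mset forward_diff_def insert.IH)
qed simp

lemma alternating_sum_eq_diff_parity:
  fixes h :: "'i set \<Rightarrow> 'w::comm_ring_1"
  assumes "finite I"
  shows "(\<Sum>J\<in>Pow I. (-1) ^ card (I - J) * h J) =
    (\<Sum>J | J \<subseteq> I \<and> even (card (I - J)). h J) - (\<Sum>J | J \<subseteq> I \<and> odd (card (I - J)). h J)"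
proof -
  have "Pow I = {J. J \<subseteq> I \<and> even (card (I - J))} \<union> {J. J \<subseteq> I \<and> odd (card (I - J))}" by auto
  then have "(\<Sum>J\<in>Pow I. (-1) ^ card (I - J) * h J) =
      (\<Sum>J | J \<subseteq> I \<and> even (card (I - J)). (-1) ^ card (I - J) * h J) +
      (\<Sum>J | J \<subseteq> I \<and> odd (card (I - J)). (-1) ^ card (I - J) * h J)"
    by (simp only:) (rule sum.union_disjoint, use assms in auto)
  also have "\<dots> = (\<Sum>J | J \<subseteq> I \<and> even (card (I - J)). h J) + (\<Sum>J | J \<subseteq> I \<and> odd (card (I - J)). - h J)"
    by (intro arg_cong2[where f = "(+)"] sum.cong) auto
  finally show ?thesis by (simp add: sum_negf)
qed

lemma indexed_multiset:
  obtains n and u :: "nat \<Rightarrow> 'a" where "M = image_mset u (mset_set {1..n})"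
proof -
  obtain us where us_mset: "mset us = M" using ex_mset by blast
  have "us = map (\<lambda>i. us ! (i - 1)) [1..<Suc (length us)]"
    by (rule nth_equalityI) (simp_all del: upt_Suc)
  then have "M = image_mset (\<lambda>i. us ! (i - 1)) (mset [1..<Suc (length us)])"
    using us_mset by (metis mset_map)
  then show ?thesis
    by (intro that) (simp add: atLeastLessThanSuc_atLeastAtMost del: upt_Suc)
qed

lemma sum_fun_apply [simp]: "sum f S a = (\<Sum>s\<in>S. f s a)"
  by (induction S rule: infinite_finite_induct) simp_all

section \<open>Absolutely monotone functions\<close>

definition absolutely_monotone_on :: "'v::ordered_ab_group_add set \<Rightarrow> ('v \<Rightarrow> real) \<Rightarrow> bool" where
  "absolutely_monotone_on B g \<longleftrightarrow>
     (\<forall>M x. 0 \<le> x \<and> (\<forall>u\<in>#M. 0 \<le> u) \<and> x + \<Sum>\<^sub># M \<in> B \<longrightarrow> 0 \<le> iter_diff M g x)"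

abbreviation absolutely_monotone :: "('v::ordered_ab_group_add \<Rightarrow> real) \<Rightarrow> bool" where
  "absolutely_monotone \<equiv> absolutely_monotone_on UNIV"

lemma absolutely_monotone_onD:
  "absolutely_monotone_on B g \<Longrightarrow> 0 \<le> x \<Longrightarrow> (\<And>u. u \<in># M \<Longrightarrow> 0 \<le> u) \<Longrightarrow> x + \<Sum>\<^sub># M \<in> B \<Longrightarrow> 0 \<le> iter_diff M g x"
  by (simp add: absolutely_monotone_on_def)

lemma absolutely_monotone_on_iff_indexed:
  "absolutely_monotone_on B g \<longleftrightarrow>
     (\<forall>n x (u :: nat \<Rightarrow> _). 0 \<le> x \<and> (\<forall>i\<in>{1..n}. 0 \<le> u i) \<and> x + sum u {1..n} \<in> B \<longrightarrow>
        0 \<le> iter_diff (image_mset u (mset_set {1..n})) g x)" (is "_ \<longleftrightarrow> ?R")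
proof
  show ?R if "absolutely_monotone_on B g"
    using that by (auto intro!: absolutely_monotone_onD[of B] simp: sum_unfold_sum_mset)
  assume right: ?R
  show "absolutely_monotone_on B g"
    unfolding absolutely_monotone_on_def
  proof (intro allI impI, elim conjE)
    fix M x assume x_nonneg: "0 \<le> x" and M_nonneg: "\<forall>u\<in>#M. 0 \<le> u" and sum_in: "x + \<Sum>\<^sub># M \<in> B"
    obtain n and u :: "nat \<Rightarrow> 'a" where M_eq: "M = image_mset u (mset_set {1..n})"
      by (rule indexed_multiset)
    have "\<forall>i\<in>{1..n}. 0 \<le> u i" "x + sum u {1..n} \<in> B"
      using M_nonneg sum_in by (simp_all add: M_eq sum_unfold_sum_mset)
    then show "0 \<le> iter_diff M g x" using right x_nonneg unfolding M_eq by blast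
  qed
qed

lemma absolutely_monotone_on_nonneg: "absolutely_monotone_on B g \<Longrightarrow> 0 \<le> x \<Longrightarrow> x \<in> B \<Longrightarrow> 0 \<le> g x"
  using absolutely_monotone_onD[of B g x "{#}"] by simp

lemma absolutely_monotone_on_mono:
  assumes "absolutely_monotone_on B g" and "0 \<le> x" and "x \<le> y" and "y \<in> B"
  shows "g x \<le> g y"
  using absolutely_monotone_onD[OF assms(1,2), of "{#y - x#}"] assms(3,4)
  by (simp add: iter_diff_add_mset forward_diff_def)

lemma absolutely_monotone_on_subset:
  "absolutely_monotone_on B g \<Longrightarrow> A \<subseteq> B \<Longrightarrow> absolutely_monotone_on A g"
  by (auto simp: absolutely_monotone_on_def)

lemma absolutely_monotone_on_comp_additive:
  assumes "absolutely_monotone_on B g" and L_add: "\<And>x y. L (x + y) = L x + L y"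
    and L_nonneg: "\<And>x. 0 \<le> x \<Longrightarrow> 0 \<le> L x"
    and "L ` A \<subseteq> B"
  shows "absolutely_monotone_on A (\<lambda>x. g (L x))"
  unfolding absolutely_monotone_on_def
proof (intro allI impI, elim conjE)
  fix M x assume x_nonneg: "0 \<le> x" and M_nonneg: "\<forall>u\<in>#M. 0 \<le> u" and "x + \<Sum>\<^sub># M \<in> A"
  have "L 0 = 0" using L_add[of 0 0] by simp
  then have "L (\<Sum>\<^sub># M) = \<Sum>\<^sub># (image_mset L M)" by (induction M) (simp_all add: L_add)
  then have "L x + \<Sum>\<^sub># (image_mset L M) \<in> B" using \<open>x + \<Sum>\<^sub># M \<in> A\<close> assms(4) L_add by force
  then show "0 \<le> iter_diff M (\<lambda>x. g (L x)) x"
    unfolding iter_diff_comp_additive[of L, OF L_add]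
    using x_nonneg M_nonneg L_nonneg by (intro absolutely_monotone_onD[OF assms(1)]) auto
qed

lemma absolutely_monotone_mult:
  assumes "absolutely_monotone g" and "absolutely_monotone h"
  shows "absolutely_monotone (\<lambda>x. g x * h x)"
proof -
  have "0 \<le> iter_diff M (\<lambda>x. g x * h x) x"
    if "\<forall>u\<in>#M. 0 \<le> u" "0 \<le> x" "absolutely_monotone g" "absolutely_monotone h" for M x g h
    using that
  proof (induction M arbitrary: g h)
    case empty
    then show ?case by (simp add: absolutely_monotone_on_nonneg)
  next
    case (add u M)
    have "absolutely_monotone (forward_diff u k)" if "absolutely_monotone k" for k
      using that add.prems(1) absolutely_monotone_onD[OF that, of _ "add_mset u _"]
      by (auto simp: absolutely_monotone_on_def[of _ "forward_diff u k"] iter_diff_add_mset')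
    moreover have "absolutely_monotone (\<lambda>x. h (x + u))"
      using add.prems absolutely_monotone_onD[OF add.prems(4)] add_nonneg_nonneg
      by (auto simp: absolutely_monotone_on_def[of _ "\<lambda>x. h (x + u)"] iter_diff_shift)
    ultimately have "0 \<le>
        iter_diff M (\<lambda>x. forward_diff u g x * h (x + u)) x +
        iter_diff M (\<lambda>x. g x * forward_diff u h x) x"
      using add.prems by (intro add_nonneg_nonneg add.IH) auto
    moreover have "forward_diff u (\<lambda>x. g x * h x) =
        (\<lambda>x. forward_diff u g x * h (x + u) + g x * forward_diff u h x)"
      by (simp add: forward_diff_def fun_eq_iff algebra_simps)
    ultimately show ?case by (simp add: iter_diff_add_mset' iter_diff_add)
  qed
  then show ?thesis using assms unfolding absolutely_monotone_on_def[of _ "\<lambda>x. g x * h x"] by blast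
qed

lemma absolutely_monotone_const:
  assumes "0 \<le> c"
  shows "absolutely_monotone (\<lambda>x. c)"
  unfolding absolutely_monotone_on_def
proof (intro allI impI)
  fix M and x :: 'a
  show "0 \<le> iter_diff M (\<lambda>x. c) x"
    by (cases M) (simp_all add: assms iter_diff_add_mset' forward_diff_def[abs_def])
qed

lemma absolutely_monotone_additive:
  fixes l :: "'v::ordered_ab_group_add \<Rightarrow> real"
  assumes add: "\<And>x y. l (x + y) = l x + l y" and nonneg: "\<And>x. 0 \<le> x \<Longrightarrow> 0 \<le> l x"
  shows "absolutely_monotone l"
  unfolding absolutely_monotone_on_def
proof (intro allI impI, elim conjE)
  fix M :: "'v multiset" and x :: 'v assume x_nonneg: "0 \<le> x" and M_nonneg: "\<forall>u\<in>#M. 0 \<le> u"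
  show "0 \<le> iter_diff M l x"
  proof (cases M)
    case empty
    then show ?thesis using nonneg x_nonneg by simp
  next
    case (add u N)
    have "forward_diff u l = (\<lambda>x. l u)" by (simp add: forward_diff_def fun_eq_iff assms(1))
    moreover have "absolutely_monotone (\<lambda>x. l u)"
      using M_nonneg nonneg add by (intro absolutely_monotone_const) simp
    ultimately show ?thesis
      using x_nonneg M_nonneg add
      by (auto simp: iter_diff_add_mset' intro!: absolutely_monotone_onD[of UNIV])
  qed
qed

lemma absolutely_monotone_mpow: "absolutely_monotone (\<lambda>x. mpow x \<mu>)"
proof (induction \<mu>)
  case (add a \<mu>)
  have "absolutely_monotone (\<lambda>x. x a)"
    by (rule absolutely_monotone_additive) (simp_all add: le_fun_def)
  then show ?case using add by (simp add: absolutely_monotone_mult)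
qed (simp add: absolutely_monotone_const)

lemma has_sum_sum:
  fixes f :: "'i \<Rightarrow> 'a \<Rightarrow> 'b::{topological_comm_monoid_add, comm_monoid_add}"
  assumes "\<And>i. i \<in> I \<Longrightarrow> (f i has_sum s i) A"
  shows "((\<lambda>a. \<Sum>i\<in>I. f i a) has_sum (\<Sum>i\<in>I. s i)) A"
  using assms by (induction I rule: infinite_finite_induct) (auto intro!: has_sum_add)

lemma absolutely_monotone_on_has_sum:
  fixes B :: "'v::ordered_ab_group_add set"
  assumes mono: "\<And>i. i \<in> S \<Longrightarrow> absolutely_monotone_on B (g i)"
    and sum: "\<And>x. x \<in> B \<Longrightarrow> ((\<lambda>i. g i x) has_sum h x) S"
    and down: "\<And>x y. 0 \<le> x \<Longrightarrow> x \<le> y \<Longrightarrow> y \<in> B \<Longrightarrow> x \<in> B"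
  shows "absolutely_monotone_on B h"
  unfolding absolutely_monotone_on_iff_indexed
proof (intro allI impI, elim conjE)
  fix n x and u :: "nat \<Rightarrow> 'v"
  assume x_nonneg: "0 \<le> x" and u_nonneg: "\<forall>i\<in>{1..n}. 0 \<le> u i" and sum_in: "x + sum u {1..n} \<in> B"
  let ?M = "image_mset u (mset_set {1..n})"
  have subset_sum_in: "x + sum u J \<in> B" if "J \<in> Pow {1..n}" for J
  proof (rule down[OF _ _ sum_in])
    show "0 \<le> x + sum u J" using x_nonneg u_nonneg that by (intro add_nonneg_nonneg sum_nonneg) auto
    show "x + sum u J \<le> x + sum u {1..n}"
      using u_nonneg that by (intro add_left_mono sum_mono2) auto
  qed
  have "((\<lambda>i. iter_diff ?M (g i) x) has_sum iter_diff ?M h x) S"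
    by (auto simp: iter_diff_eq_alternating_sum
      intro!: has_sum_sum has_sum_cmult_right sum subset_sum_in)
  moreover have "0 \<le> iter_diff ?M (g i) x" if "i \<in> S" for i
    using mono[OF that] x_nonneg u_nonneg sum_in
    unfolding absolutely_monotone_on_iff_indexed by blast
  ultimately show "0 \<le> iter_diff ?M h x" by (rule has_sum_nonneg)
qed

context coherence_space
begin

lemma subset_sum_clique:
  assumes "finite I" "J \<subseteq> I" and "x \<in> elems (Fm X)" and u_elem: "u \<in> I \<rightarrow> elems (Fm X)"
    and "x + sum u I \<in> cliques X"
  shows "x + sum u J \<in> cliques X"
proof -
  have "u \<in> J \<rightarrow> elems (Fm X)" "finite J" using u_elem assms(1,2) by (auto intro: finite_subset)
  then show ?thesis
    using Fm.subset_sum_in_unit_ball[of I J x u] assms csum_Fm[of I u] csum_Fm[of J u]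
    by (auto simp: unit_ball_Fm Pi_iff)
qed

lemma summands_elem_iff:
  assumes "finite I" and "x + sum u I \<in> cliques X"
  shows "x \<in> elems (Fm X) \<and> u \<in> I \<rightarrow> elems (Fm X) \<longleftrightarrow> 0 \<le> x \<and> (\<forall>i\<in>I. 0 \<le> u i)"
proof
  show "0 \<le> x \<and> (\<forall>i\<in>I. 0 \<le> u i)" if "x \<in> elems (Fm X) \<and> u \<in> I \<rightarrow> elems (Fm X)"
    using that elem_nonneg by (auto simp: Pi_iff)
  assume nonneg: "0 \<le> x \<and> (\<forall>i\<in>I. 0 \<le> u i)"
  have elem: "y \<in> elems (Fm X)" if "0 \<le> y" "y \<le> x + sum u I" for y
    using that by (intro clique_elem clique_antimono[OF assms(2)])
  have "x \<in> elems (Fm X)" using nonneg by (intro elem) (auto intro!: sum_nonneg)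
  moreover have "u i \<in> elems (Fm X)" if "i \<in> I" for i
    using nonneg that assms(1) by (intro elem add_increasing member_le_sum) auto
  ultimately show "x \<in> elems (Fm X) \<and> u \<in> I \<rightarrow> elems (Fm X)" by blast
qed

end

locale coherence_space_pair = X: coherence_space X + Y: coherence_space Y
  for X :: "'a pcs" and Y :: "'b pcs"
begin

abbreviation parity_csum ::
  "(nat \<Rightarrow> bool) \<Rightarrow> nat \<Rightarrow> (('a \<Rightarrow> real) \<Rightarrow> 'b \<Rightarrow> real) \<Rightarrow> (nat \<Rightarrow> 'a \<Rightarrow> real) \<Rightarrow> ('a \<Rightarrow> real) \<Rightarrow> 'b \<Rightarrow> real"
where
  "parity_csum P n \<phi> u x \<equiv>
     csum (Fm Y) (\<lambda>J. \<phi> (cadd (Fm X) x (csum (Fm X) u J))) {J. J \<subseteq> {1..n} \<and> P (n - card J)}"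

context
  fixes \<phi> x n and u :: "nat \<Rightarrow> 'a \<Rightarrow> real"
  assumes \<phi>_closed: "\<phi> \<in> cliques X \<rightarrow> elems (Fm Y)"
    and x_elem: "x \<in> elems (Fm X)" and u_elem: "u \<in> {1..n} \<rightarrow> elems (Fm X)"
    and sum_clique: "x + sum u {1..n} \<in> cliques X"
begin

lemma parity_csum_eq_sum:
  "parity_csum P n \<phi> u x = (\<Sum>J | J \<subseteq> {1..n} \<and> P (card ({1..n} - J)). \<phi> (x + sum u J))"
  and parity_csum_elem: "parity_csum P n \<phi> u x \<in> elems (Fm Y)"
proof -
  let ?S = "{J. J \<subseteq> {1..n} \<and> P (n - card J)}"
  have summand: "\<phi> (cadd (Fm X) x (csum (Fm X) u J)) = \<phi> (x + sum u J)"
      "\<phi> (x + sum u J) \<in> elems (Fm Y)"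
    if J_subset: "J \<subseteq> {1..n}" for J
  proof -
    have "finite J" "u \<in> J \<rightarrow> elems (Fm X)" using J_subset u_elem by (auto intro: finite_subset)
    then show "\<phi> (cadd (Fm X) x (csum (Fm X) u J)) = \<phi> (x + sum u J)" by (simp add: X.csum_Fm)
    show "\<phi> (x + sum u J) \<in> elems (Fm Y)"
      using X.subset_sum_clique[OF _ J_subset x_elem u_elem sum_clique] \<phi>_closed by auto
  qed
  have "finite ?S" by (rule finite_subset[of _ "Pow {1..n}"]) auto
  moreover have "(\<lambda>J. \<phi> (x + sum u J)) \<in> ?S \<rightarrow> elems (Fm Y)" using summand(2) by auto
  moreover have "parity_csum P n \<phi> u x = csum (Fm Y) (\<lambda>J. \<phi> (x + sum u J)) ?S"
    using summand by (intro Y.Fm.csum_cong) auto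
  ultimately have "parity_csum P n \<phi> u x = (\<Sum>J\<in>?S. \<phi> (x + sum u J))"
    and "parity_csum P n \<phi> u x \<in> elems (Fm Y)"
    by (simp_all add: Y.csum_Fm Y.sum_elem)
  moreover have "?S = {J. J \<subseteq> {1..n} \<and> P (card ({1..n} - J))}"
    by (auto simp: card_Diff_subset finite_subset)
  ultimately show "parity_csum P n \<phi> u x =
      (\<Sum>J | J \<subseteq> {1..n} \<and> P (card ({1..n} - J)). \<phi> (x + sum u J))"
    and "parity_csum P n \<phi> u x \<in> elems (Fm Y)" by simp_all
qed

lemma parity_csum_cle_iff:
  "cle (Fm Y) (parity_csum odd n \<phi> u x) (parity_csum even n \<phi> u x) \<longleftrightarrow>
     (\<forall>b. 0 \<le> iter_diff (image_mset u (mset_set {1..n})) (\<lambda>x. \<phi> x b) x)"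
proof -
  have "iter_diff (image_mset u (mset_set {1..n})) (\<lambda>x. \<phi> x b) x =
      parity_csum even n \<phi> u x b - parity_csum odd n \<phi> u x b" for b
    unfolding parity_csum_eq_sum[of even] parity_csum_eq_sum[of "\<lambda>k. odd k"]
    by (simp add: iter_diff_eq_alternating_sum alternating_sum_eq_diff_parity)
  then show ?thesis
    unfolding Y.cle_Fm_iff[OF parity_csum_elem[of "\<lambda>k. odd k"] parity_csum_elem[of even]] le_fun_def
    by (simp only: diff_ge_0_iff_ge)
qed

end

lemma pre_stable_Fm_iff:
  assumes \<phi>_closed: "\<phi> \<in> cliques X \<rightarrow> elems (Fm Y)"
  shows "pre_stable (Fm X) (Fm Y) \<phi> \<longleftrightarrow> (\<forall>b. absolutely_monotone_on (cliques X) (\<lambda>x. \<phi> x b))"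
proof -
  have pointwise: "(x \<in> elems (Fm X) \<and> (\<forall>i\<in>{1..n}. u i \<in> elems (Fm X)) \<and>
        cadd (Fm X) x (csum (Fm X) u {1..n}) \<in> cliques X \<longrightarrow>
      cle (Fm Y) (parity_csum odd n \<phi> u x) (parity_csum even n \<phi> u x)) \<longleftrightarrow>
    (0 \<le> x \<and> (\<forall>i\<in>{1..n}. 0 \<le> u i) \<and> x + sum u {1..n} \<in> cliques X \<longrightarrow>
      (\<forall>b. 0 \<le> iter_diff (image_mset u (mset_set {1..n})) (\<lambda>x. \<phi> x b) x))"
      (is "(?A \<longrightarrow> ?C) \<longleftrightarrow> (?B \<longrightarrow> ?D)")
    for n x and u :: "nat \<Rightarrow> 'a \<Rightarrow> real"
  proof -
    note summands = X.summands_elem_iff[of "{1..n}" x u]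
    have "?A \<longleftrightarrow> ?B" using summands X.csum_Fm[of "{1..n}" u] by (auto simp: Pi_iff)
    moreover have "?C \<longleftrightarrow> ?D" if ?B
      using that summands by (intro parity_csum_cle_iff[OF \<phi>_closed]) auto
    ultimately show ?thesis by blast
  qed
  show ?thesis
    unfolding pre_stable_def X.unit_ball_Fm pointwise absolutely_monotone_on_iff_indexed by blast
qed

lemma stable_Fm_iff:
  "stable (Fm X) (Fm Y) \<phi> \<longleftrightarrow>
     \<phi> \<in> cliques X \<rightarrow>\<^sub>E elems (Fm Y) \<and>
     (\<forall>b. absolutely_monotone_on (cliques X) (\<lambda>x. \<phi> x b)) \<and>
     (\<forall>x s. range x \<subseteq> cliques X \<and> incseq x \<and> x \<longlonglongrightarrow> s \<longrightarrow> (\<lambda>n. \<phi> (x n)) \<longlonglongrightarrow> \<phi> s) \<and>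
     (\<exists>B. \<forall>x\<in>cliques X. cnorm (Fm Y) (\<phi> x) \<le> B)"
proof (cases
    "\<phi> \<in> cliques X \<rightarrow>\<^sub>E elems (Fm Y) \<and> (\<forall>b. absolutely_monotone_on (cliques X) (\<lambda>x. \<phi> x b))")
  case True
  then have \<phi>_closed: "\<phi> \<in> cliques X \<rightarrow> elems (Fm Y)" by auto
  have lub: "is_seq_lub (Fm Y) (\<lambda>n. \<phi> (x n)) (\<phi> s) \<longleftrightarrow> (\<lambda>n. \<phi> (x n)) \<longlonglongrightarrow> \<phi> s"
    if x_range: "range x \<subseteq> cliques X" and x_incseq: "incseq x" and x_lim: "x \<longlonglongrightarrow> s" for x s
  proof -
    have x_clique: "x n \<in> cliques X" for n using x_range by blast
    moreover have "s \<in> cliques X" by (rule X.clique_LIMSEQ[OF x_clique x_incseq x_lim])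
    moreover have "\<phi> (x m) b \<le> \<phi> (x n) b" if "m \<le> n" for m n b
      using True x_incseq that x_clique X.clique_nonneg
      by (intro absolutely_monotone_on_mono[of "cliques X" "\<lambda>x. \<phi> x b"]) (auto simp: incseq_def)
    then have "incseq (\<lambda>n. \<phi> (x n))" by (simp add: incseq_def le_fun_def)
    ultimately show ?thesis using \<phi>_closed by (subst Y.is_seq_lub_Fm_iff) auto
  qed
  have "nondecreasing (Fm X) x \<and> range x \<subseteq> cliques X \<and> is_seq_lub (Fm X) x s \<longleftrightarrow>
      range x \<subseteq> cliques X \<and> incseq x \<and> x \<longlonglongrightarrow> s" for x s
  proof (cases "range x \<subseteq> cliques X \<and> incseq x")
    case True
    then have x_clique: "x n \<in> cliques X" for n by blast
    moreover have "s \<in> elems (Fm X)" if "x \<longlonglongrightarrow> s"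
      using True that by (intro X.clique_elem X.clique_LIMSEQ[OF x_clique]) auto
    moreover have "x n \<in> elems (Fm X)" for n by (rule X.clique_elem[OF x_clique])
    ultimately show ?thesis using True by (auto simp: X.nondecreasing_Fm_iff X.is_seq_lub_Fm_iff)
  qed (auto simp: X.nondecreasing_Fm_iff)
  then show ?thesis
    using True \<phi>_closed lub by (simp add: stable_def X.unit_ball_Fm pre_stable_Fm_iff)
next
  case False
  then show ?thesis by (auto simp: stable_def X.unit_ball_Fm pre_stable_Fm_iff PiE_iff Pi_iff)
qed

end

section \<open>Matrices and power series\<close>

lemma web_exp [simp]: "web (pcs_exp X Y) = mfin (web X) \<times> web Y"
  and cliques_exp [simp]: "cliques (pcs_exp X Y) = pcoh_hom X Y"
  by (simp_all add: pcs_exp_def)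

text \<open>Unlike \<open>hat\<close>, this distinguishes a divergent series from one with sum \<open>0\<close>.\<close>

definition ehat :: "'a pcs \<Rightarrow> ('a multiset \<times> 'b \<Rightarrow> real) \<Rightarrow> ('a \<Rightarrow> real) \<Rightarrow> 'b \<Rightarrow> ennreal" where
  "ehat X f x b = esum (mfin (web X)) (\<lambda>\<mu>. ennreal (f (\<mu>, b) * mpow x \<mu>))"

definition bang_tensor :: "('a \<Rightarrow> real) \<Rightarrow> ('b \<Rightarrow> real) \<Rightarrow> 'a multiset \<times> 'b \<Rightarrow> real" where
  "bang_tensor x v = (\<lambda>(\<mu>, b). mpow x \<mu> * v b)"

lemma hat_scale: "hat X (\<lambda>p. c * f p) x = (\<lambda>b. c * hat X f x b)"
  by (simp add: hat_def infsum_cmult_right' mult.assoc)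

lemma ehat_eq_iff_has_sum:
  assumes "0 \<le> f" and "0 \<le> x" and "0 \<le> c"
  shows "ehat X f x b = ennreal c \<longleftrightarrow> ((\<lambda>\<mu>. f (\<mu>, b) * mpow x \<mu>) has_sum c) (mfin (web X))"
proof -
  have "0 \<le> f (\<mu>, b) * mpow x \<mu>" for \<mu> using assms(1,2) by (simp add: le_fun_def mpow_nonneg)
  then show ?thesis unfolding ehat_def using assms(3) by (subst has_sum_iff_esum) simp_all
qed

lemma hat_eqI: "((\<lambda>\<mu>. f (\<mu>, b) * mpow x \<mu>) has_sum c) (mfin (web X)) \<Longrightarrow> hat X f x b = c"
  by (simp add: hat_def infsumI)

lemma esum_bang_tensor:
  assumes f_nonneg: "0 \<le> f" and x_nonneg: "0 \<le> x" and v_nonneg: "0 \<le> v"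
    and "countable (web X)" "countable B"
  shows "esum (mfin (web X) \<times> B) (\<lambda>p. ennreal (f p * bang_tensor x v p)) =
      esum B (\<lambda>b. ehat X f x b * ennreal (v b))"
proof -
  have nonneg: "0 \<le> f p" "0 \<le> mpow x \<mu>" "0 \<le> v b" for p \<mu> b
    using x_nonneg
    by (simp_all add: nonneg_fun_apply[OF f_nonneg] nonneg_fun_apply[OF v_nonneg] mpow_nonneg)
  have "ennreal (f (\<mu>, b) * bang_tensor x v (\<mu>, b)) = ennreal (f (\<mu>, b) * mpow x \<mu>) * ennreal (v b)"
      for \<mu> b
    using nonneg(1)[of "(\<mu>, b)"] nonneg(2,3)
    by (simp add: bang_tensor_def mult.assoc flip: ennreal_mult)
  then have "esum (mfin (web X) \<times> B) (\<lambda>p. ennreal (f p * bang_tensor x v p)) =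
      esum (mfin (web X)) (\<lambda>\<mu>. esum B (\<lambda>b. ennreal (f (\<mu>, b) * mpow x \<mu>) * ennreal (v b)))"
    by (simp add: esum_product_iterated)
  also have "\<dots> =
      esum B (\<lambda>b. esum (mfin (web X)) (\<lambda>\<mu>. ennreal (f (\<mu>, b) * mpow x \<mu>) * ennreal (v b)))"
    using assms(4,5) by (intro nn_integral_count_space_nn_integral) auto
  also have "\<dots> = esum B (\<lambda>b. ehat X f x b * ennreal (v b))"
    by (simp add: ehat_def nn_integral_multc)
  finally show ?thesis .
qed

lemma (in coherence_space) mpow_outside: "x \<in> cliques X \<Longrightarrow> \<mu> \<notin> mfin (web X) \<Longrightarrow> mpow x \<mu> = 0"
  by (rule mpow_eq_0[OF clique_outside])

context coherence_space_pair
begin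

lemma pcoh_homI:
  assumes f_nnvecs: "f \<in> nnvecs (mfin (web X) \<times> web Y)"
    and y_clique: "\<And>x. x \<in> cliques X \<Longrightarrow> y x \<in> cliques Y"
    and ehat: "\<And>x b. x \<in> cliques X \<Longrightarrow> b \<in> web Y \<Longrightarrow> ehat X f x b = ennreal (y x b)"
  shows "f \<in> pcoh_hom X Y" and "\<And>x. x \<in> cliques X \<Longrightarrow> hat X f x = y x"
proof -
  have sum: "((\<lambda>\<mu>. f (\<mu>, b) * mpow x \<mu>) has_sum y x b) (mfin (web X))"
      if x_clique: "x \<in> cliques X" for x b
  proof (cases "b \<in> web Y")
    case True
    have "0 \<le> f" "0 \<le> x" "0 \<le> y x b"
      using f_nnvecs X.clique_nonneg[OF x_clique] Y.clique_nonneg[OF y_clique[OF x_clique]]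
      by (simp_all add: nnvecs_iff le_fun_def)
    then show ?thesis using ehat[OF x_clique True] by (simp add: ehat_eq_iff_has_sum)
  next
    case False
    then show ?thesis
      using f_nnvecs Y.clique_outside[OF y_clique[OF x_clique] False] by (simp add: nnvecs_iff)
  qed
  then show "hat X f x = y x" if "x \<in> cliques X" for x using that by (auto intro: hat_eqI)
  then show "f \<in> pcoh_hom X Y"
    using f_nnvecs y_clique has_sum_imp_summable[OF sum] by (simp add: pcoh_hom_def)
qed

lemma ehat_pcoh_hom:
  assumes "f \<in> pcoh_hom X Y" and "x \<in> cliques X" and "b \<in> web Y"
  shows "ehat X f x b = ennreal (hat X f x b)"
proof -
  have "f \<in> nnvecs (mfin (web X) \<times> web Y)" and "hat X f x \<in> cliques Y"
    and sum: "(\<lambda>\<mu>. f (\<mu>, b) * mpow x \<mu>) summable_on mfin (web X)"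
    using assms by (simp_all add: pcoh_hom_def)
  then have "0 \<le> f" "0 \<le> x" "0 \<le> hat X f x b"
    using X.clique_nonneg[OF assms(2)] Y.clique_nonneg by (simp_all add: nnvecs_iff le_fun_def)
  then show ?thesis using has_sum_infsum[OF sum] by (simp add: ehat_eq_iff_has_sum hat_def)
qed

lemma pcoh_hom_iff:
  "f \<in> pcoh_hom X Y \<longleftrightarrow> f \<in> nnvecs (mfin (web X) \<times> web Y) \<and>
     (\<forall>x\<in>cliques X. \<exists>y\<in>cliques Y. \<forall>b\<in>web Y. ehat X f x b = ennreal (y b))"
proof
  show "f \<in> nnvecs (mfin (web X) \<times> web Y) \<and>
      (\<forall>x\<in>cliques X. \<exists>y\<in>cliques Y. \<forall>b\<in>web Y. ehat X f x b = ennreal (y b))"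
    if "f \<in> pcoh_hom X Y"
    using that ehat_pcoh_hom by (auto simp: pcoh_hom_def)
  assume f_values: "f \<in> nnvecs (mfin (web X) \<times> web Y) \<and>
      (\<forall>x\<in>cliques X. \<exists>y\<in>cliques Y. \<forall>b\<in>web Y. ehat X f x b = ennreal (y b))"
  then obtain y where "\<And>x. x \<in> cliques X \<Longrightarrow> y x \<in> cliques Y"
    and "\<And>x b. x \<in> cliques X \<Longrightarrow> b \<in> web Y \<Longrightarrow> ehat X f x b = ennreal (y x b)" by metis
  then show "f \<in> pcoh_hom X Y" using f_values pcoh_homI(1) by blast
qed

definition exp_tests :: "('a multiset \<times> 'b \<Rightarrow> real) set" where
  "exp_tests = {bang_tensor x v | x v. x \<in> cliques X \<and> v \<in> Y.dual_cliques}"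

lemma exp_tests_nnvecs: "exp_tests \<subseteq> nnvecs (mfin (web X) \<times> web Y)"
proof
  fix t assume "t \<in> exp_tests"
  then obtain x v where x_clique: "x \<in> cliques X" and v_nnvecs: "v \<in> nnvecs (web Y)"
      and t_eq: "t = bang_tensor x v"
    using pdual_subset_nnvecs unfolding exp_tests_def by blast
  have "0 \<le> mpow x \<mu>" "\<mu> \<notin> mfin (web X) \<Longrightarrow> mpow x \<mu> = 0" "0 \<le> v b" "b \<notin> web Y \<Longrightarrow> v b = 0" for \<mu> b
    using x_clique v_nnvecs X.clique_nonneg X.mpow_outside
    by (simp_all add: mpow_nonneg nnvecs_iff le_fun_def)
  then show "t \<in> nnvecs (mfin (web X) \<times> web Y)"
    by (auto simp: t_eq bang_tensor_def nnvecs_iff le_fun_def)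
qed

lemma pcoh_hom_eq_pdual: "pcoh_hom X Y = pdual (mfin (web X) \<times> web Y) exp_tests"
proof -
  have "(\<forall>x\<in>cliques X. \<exists>y\<in>cliques Y. \<forall>b\<in>web Y. ehat X f x b = ennreal (y b)) \<longleftrightarrow>
      (\<forall>t\<in>exp_tests. esum (mfin (web X) \<times> web Y) (\<lambda>p. ennreal (f p * t p)) \<le> 1)"
    if f_nnvecs: "f \<in> nnvecs (mfin (web X) \<times> web Y)" for f
  proof -
    have "esum (mfin (web X) \<times> web Y) (\<lambda>p. ennreal (f p * bang_tensor x v p)) =
        esum (web Y) (\<lambda>b. ehat X f x b * ennreal (v b))"
            if "x \<in> cliques X" "v \<in> Y.dual_cliques" for x v
      using f_nnvecs X.clique_nonneg[OF that(1)] Y.dual_clique_nonneg[OF that(2)] X.countable_web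
        Y.countable_web
      by (intro esum_bang_tensor) (simp_all add: nnvecs_iff le_fun_def)
    then show ?thesis unfolding Y.ex_clique_ennreal_iff by (fastforce simp: exp_tests_def)
  qed
  then show ?thesis unfolding set_eq_iff pcoh_hom_iff pdual_iff_esum[OF exp_tests_nnvecs] by blast
qed

lemma is_pcs_exp: "is_pcs (pcs_exp X Y)"
  unfolding pcs_exp_def pcoh_hom_eq_pdual
proof (rule is_pcs_pdual[OF _ exp_tests_nnvecs])
  show "countable (mfin (web X) \<times> web Y)"
    by (simp add: countable_mfin X.countable_web Y.countable_web)
  fix p assume "p \<in> mfin (web X) \<times> web Y"
  then obtain \<mu> b where p_eq: "p = (\<mu>, b)" and \<mu>_support: "set_mset \<mu> \<subseteq> web X"
      and b_web: "b \<in> web Y"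
    by (auto simp: mfin_def)
  show "\<exists>t\<in>exp_tests. 0 < t p"
  proof -
    obtain x where "x \<in> cliques X" "\<And>a. a \<in># \<mu> \<Longrightarrow> 0 < x a"
      using X.clique_with_support[OF finite_set_mset \<mu>_support] by metis
    moreover obtain v where "v \<in> Y.dual_cliques" "0 < v b" using Y.dual_clique_positive[OF b_web] .
    ultimately have "bang_tensor x v \<in> exp_tests" "0 < bang_tensor x v p"
      by (auto simp: exp_tests_def bang_tensor_def p_eq mpow_pos)
    then show ?thesis by blast
  qed
  show "\<exists>B. \<forall>t\<in>exp_tests. t p \<le> B"
  proof -
    obtain B where x_bound: "\<And>a x. x \<in> cliques X \<Longrightarrow> x a \<le> B a" using X.clique_bound by metis
    obtain K where v_bound: "\<And>v. v \<in> Y.dual_cliques \<Longrightarrow> v b \<le> K"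
      using Y.dual_clique_bound[OF b_web] by blast
    have "bang_tensor x v p \<le> mpow B \<mu> * K" if "x \<in> cliques X" "v \<in> Y.dual_cliques" for x v
    proof -
      have "mpow x \<mu> \<le> mpow B \<mu>" "0 \<le> mpow x \<mu>"
        using X.clique_nonneg x_bound that(1) by (simp_all add: mpow_mono mpow_nonneg le_fun_def)
      then show ?thesis
        using v_bound Y.dual_clique_nonneg that(2)
        by (auto simp: bang_tensor_def p_eq intro!: mult_mono)
    qed
    then show ?thesis by (auto simp: exp_tests_def)
  qed
qed

sublocale XY: coherence_space "pcs_exp X Y"
  by (rule coherence_space.intro) (rule is_pcs_exp)

lemma pcoh_hom_elem: "f \<in> pcoh_hom X Y \<Longrightarrow> f \<in> elems (Fm (pcs_exp X Y))"
  using XY.clique_elem by simp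

lemma exp_elem_outside: "f \<in> elems (Fm (pcs_exp X Y)) \<Longrightarrow> \<mu> \<notin> mfin (web X) \<or> b \<notin> web Y \<Longrightarrow> f (\<mu>, b) = 0"
  using XY.elem_outside by auto

lemma hat_has_sum:
  assumes f_elem: "f \<in> elems (Fm (pcs_exp X Y))" and x_clique: "x \<in> cliques X"
  shows "((\<lambda>\<mu>. f (\<mu>, b) * mpow x \<mu>) has_sum hat X f x b) (mfin (web X))"
proof (cases "b \<in> web Y")
  case True
  obtain c g where g_hom: "g \<in> pcoh_hom X Y" and f_eq: "f = (\<lambda>p. c * g p)"
    using f_elem by (auto simp: Fm_elem_iff)
  have "((\<lambda>\<mu>. g (\<mu>, b) * mpow x \<mu>) has_sum hat X g x b) (mfin (web X))"
    unfolding hat_def using g_hom x_clique True by (intro has_sum_infsum) (simp add: pcoh_hom_def)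
  from has_sum_cmult_right[OF this, of c] show ?thesis
    unfolding f_eq hat_scale by (simp add: mult.assoc)
next
  case False
  then show ?thesis using exp_elem_outside[OF f_elem] by (simp add: hat_def)
qed

lemma hat_elem:
  assumes f_elem: "f \<in> elems (Fm (pcs_exp X Y))" and x_clique: "x \<in> cliques X"
  shows "hat X f x \<in> elems (Fm Y)" and "cnorm (Fm Y) (hat X f x) \<le> cnorm (Fm (pcs_exp X Y)) f"
proof -
  let ?c = "cnorm (Fm (pcs_exp X Y)) f"
  obtain g where g_hom: "g \<in> pcoh_hom X Y" and "f = (\<lambda>p. ?c * g p)"
    using XY.norm_scale_clique[OF f_elem] by auto
  then have "hat X f x = (\<lambda>b. ?c * hat X g x b)" by (metis hat_scale)
  moreover have "hat X g x \<in> cliques Y" using g_hom x_clique by (simp add: pcoh_hom_def)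
  ultimately have ex_clique: "\<exists>y\<in>cliques Y. hat X f x = (\<lambda>b. ?c * y b)" by blast
  then show elem: "hat X f x \<in> elems (Fm Y)" using XY.norm_nonneg[OF f_elem] Fm_elem_iff by blast
  show "cnorm (Fm Y) (hat X f x) \<le> ?c"
    using Y.norm_le_iff[OF elem XY.norm_nonneg[OF f_elem]] ex_clique by simp
qed

lemma hat_nonneg: "f \<in> elems (Fm (pcs_exp X Y)) \<Longrightarrow> x \<in> cliques X \<Longrightarrow> 0 \<le> hat X f x b"
  using Y.elem_nonneg[OF hat_elem(1)] by (simp add: le_fun_def)

lemma ehat_eq_hat:
  assumes "f \<in> elems (Fm (pcs_exp X Y))" and "x \<in> cliques X"
  shows "ehat X f x b = ennreal (hat X f x b)"
  using assms hat_has_sum[OF assms] hat_nonneg[OF assms]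
  by (subst ehat_eq_iff_has_sum) (auto simp: XY.elem_nonneg X.clique_nonneg)

lemma hat_add:
  assumes "f \<in> elems (Fm (pcs_exp X Y))" and "g \<in> elems (Fm (pcs_exp X Y))" and "x \<in> cliques X"
  shows "hat X (f + g) x = hat X f x + hat X g x"
proof
  fix b
  show "hat X (f + g) x b = (hat X f x + hat X g x) b"
    using has_sum_add[OF hat_has_sum[OF assms(1,3), of b] hat_has_sum[OF assms(2,3), of b]]
    by (intro hat_eqI) (simp add: distrib_right)
qed

lemma hat_LIMSEQ:
  assumes F_elem: "\<And>n. F n \<in> elems (Fm (pcs_exp X Y))" and f_elem: "f \<in> elems (Fm (pcs_exp X Y))"
    and F_incseq: "incseq F" and F_lim: "F \<longlonglongrightarrow> f"
    and x_clique: "\<And>n. x n \<in> cliques X" and y_clique: "y \<in> cliques X" and x_incseq: "incseq x"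
    and x_lim: "x \<longlonglongrightarrow> y"
  shows "(\<lambda>n. hat X (F n) (x n)) \<longlonglongrightarrow> hat X f y"
proof -
  have "(\<lambda>n. hat X (F n) (x n) b) \<longlonglongrightarrow> hat X f y b" for b
  proof -
    have "(\<lambda>n. ehat X (F n) (x n) b) \<longlonglongrightarrow> ehat X f y b"
      unfolding ehat_def
    proof (rule nn_integral_LIMSEQ)
      have "F m (\<mu>, b) * mpow (x m) \<mu> \<le> F n (\<mu>, b) * mpow (x n) \<mu>" if "m \<le> n" for m n \<mu>
        using that F_incseq x_incseq XY.elem_nonneg[OF F_elem] X.clique_nonneg[OF x_clique]
        by (intro mult_mono mpow_mono mpow_nonneg) (auto simp: incseq_def le_fun_def)
      then show "incseq (\<lambda>n \<mu>. ennreal (F n (\<mu>, b) * mpow (x n) \<mu>))"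
        by (auto simp: incseq_def le_fun_def intro: ennreal_leI)
      show "(\<lambda>n. ennreal (F n (\<mu>, b) * mpow (x n) \<mu>)) \<longlonglongrightarrow> ennreal (f (\<mu>, b) * mpow y \<mu>)" for \<mu>
        using F_lim x_lim
        by (intro tendsto_ennrealI tendsto_mult tendsto_mpow) (simp_all add: tendsto_fun_iff)
    qed simp
    then show ?thesis
      using hat_nonneg F_elem f_elem F_incseq F_lim x_clique y_clique x_incseq x_lim
      by (intro tendsto_ennrealD) (simp_all add: ehat_eq_hat)
  qed
  then show ?thesis by (simp add: tendsto_fun_iff)
qed

lemma borel_measurable_hat:
  assumes f_elem: "\<And>s. s \<in> space M \<Longrightarrow> f s \<in> elems (Fm (pcs_exp X Y))"
    and x_clique: "\<And>s. s \<in> space M \<Longrightarrow> x s \<in> cliques X"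
    and f_meas: "\<And>p. (\<lambda>s. f s p) \<in> borel_measurable M"
    and x_meas: "\<And>a. (\<lambda>s. x s a) \<in> borel_measurable M"
  shows "(\<lambda>s. hat X (f s) (x s) b) \<in> borel_measurable M"
proof -
  have "(\<lambda>s. ehat X (f s) (x s) b) \<in> borel_measurable M"
    unfolding ehat_def mpow_def using f_meas x_meas countable_mfin[OF X.countable_web]
    by (intro borel_measurable_esum measurable_compose[OF _ measurable_ennreal]
      borel_measurable_times
        borel_measurable_prod borel_measurable_power) auto
  then have "(\<lambda>s. enn2real (ehat X (f s) (x s) b)) \<in> borel_measurable M" by simp
  moreover have "enn2real (ehat X (f s) (x s) b) = hat X (f s) (x s) b" if "s \<in> space M" for s
    using ehat_eq_hat hat_nonneg f_elem[OF that] x_clique[OF that] by simp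
  ultimately show ?thesis by (subst measurable_cong) auto
qed

lemma Fm_map_apply: "x \<in> cliques X \<Longrightarrow> Fm_map X f x = hat X f x"
  by (simp add: Fm_map_def X.unit_ball_Fm)

lemma absolutely_monotone_on_Fm_map:
  assumes f_elem: "f \<in> elems (Fm (pcs_exp X Y))"
  shows "absolutely_monotone_on (cliques X) (\<lambda>x. Fm_map X f x b)"
proof (rule absolutely_monotone_on_has_sum)
  have "absolutely_monotone (\<lambda>x. f (\<mu>, b) * mpow x \<mu>)" for \<mu>
    using nonneg_fun_apply[OF XY.elem_nonneg[OF f_elem]]
    by (intro absolutely_monotone_mult absolutely_monotone_const absolutely_monotone_mpow)
  then show "absolutely_monotone_on (cliques X) (\<lambda>x. f (\<mu>, b) * mpow x \<mu>)" for \<mu>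
    by (rule absolutely_monotone_on_subset) simp
  show "((\<lambda>\<mu>. f (\<mu>, b) * mpow x \<mu>) has_sum Fm_map X f x b) (mfin (web X))" if "x \<in> cliques X" for x
    using hat_has_sum[OF f_elem that] by (simp add: Fm_map_apply that)
qed (rule X.clique_antimono)

lemma stable_Fm_map:
  assumes f_elem: "f \<in> elems (Fm (pcs_exp X Y))"
  shows "stable (Fm X) (Fm Y) (Fm_map X f)"
  unfolding stable_Fm_iff
proof (intro conjI allI impI; (elim conjE)?)
  show "Fm_map X f \<in> cliques X \<rightarrow>\<^sub>E elems (Fm Y)"
    using hat_elem(1)[OF f_elem] by (auto simp: Fm_map_def X.unit_ball_Fm)
  show "\<exists>B. \<forall>x\<in>cliques X. cnorm (Fm Y) (Fm_map X f x) \<le> B"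
    using hat_elem(2)[OF f_elem] by (auto simp: Fm_map_apply)
  show "absolutely_monotone_on (cliques X) (\<lambda>x. Fm_map X f x b)" for b
    by (rule absolutely_monotone_on_Fm_map[OF f_elem])
  fix x s assume "range x \<subseteq> cliques X" and inc: "incseq x" "x \<longlonglongrightarrow> s"
  then have x_clique: "x n \<in> cliques X" for n by blast
  have s_clique: "s \<in> cliques X" by (rule X.clique_LIMSEQ[OF x_clique inc])
  show "(\<lambda>n. Fm_map X f (x n)) \<longlonglongrightarrow> Fm_map X f s"
    using hat_LIMSEQ[OF f_elem f_elem _ _ x_clique s_clique inc]
    by (simp add: Fm_map_apply x_clique s_clique)
qed

lemma Fm_map_in_meas_stable:
  assumes f_elem: "f \<in> elems (Fm (pcs_exp X Y))"
  shows "Fm_map X f \<in> meas_stable (Fm X) (Fm Y)"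
proof -
  have "meas_path (Fm Y) n (\<lambda>r. Fm_map X f (\<gamma> r))" if \<gamma>_unitary: "unitary_path (Fm X) n \<gamma>" for n \<gamma>
    unfolding Y.meas_path_Fm_iff
  proof (intro conjI ballI)
    have \<gamma>_clique: "\<gamma> s \<in> cliques X" if "s \<in> space (Rn n)" for s
      using \<gamma>_unitary that by (simp add: X.unitary_path_Fm_iff)
    show "Fm_map X f (\<gamma> s) \<in> elems (Fm Y)" if "s \<in> space (Rn n)" for s
      using hat_elem(1)[OF f_elem] \<gamma>_clique[OF that] by (simp add: Fm_map_apply)
    show "\<exists>B. \<forall>s\<in>space (Rn n). cnorm (Fm Y) (Fm_map X f (\<gamma> s)) \<le> B"
      using hat_elem(2)[OF f_elem \<gamma>_clique] \<gamma>_clique by (auto simp: Fm_map_apply)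
    fix b
    have "(\<lambda>s. hat X f (\<gamma> s) b) \<in> borel_measurable (Rn n)"
      using f_elem \<gamma>_clique \<gamma>_unitary
      by (intro borel_measurable_hat) (auto simp: unitary_path_def X.meas_path_Fm_coordinate)
    then show "(\<lambda>s. Fm_map X f (\<gamma> s) b) \<in> borel_measurable (Rn n)"
      by (rule measurable_cong[THEN iffD1, rotated]) (simp add: \<gamma>_clique Fm_map_apply)
  qed
  then show ?thesis using stable_Fm_map[OF f_elem] by (simp add: meas_stable_def)
qed

lemma Fm_map_in_cstab_hom: "f \<in> pcoh_hom X Y \<Longrightarrow> Fm_map X f \<in> cstab_hom (Fm X) (Fm Y)"
  using Fm_map_in_meas_stable[OF pcoh_hom_elem]
  by (simp add: cstab_hom_def X.unit_ball_Fm Y.unit_ball_Fm Fm_map_apply pcoh_hom_def)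

end

section \<open>Identities and composition\<close>

context coherence_space
begin

lemma ehat_pcoh_id:
  assumes "a \<in> web X"
  shows "ehat X (pcoh_id X) x a = ennreal (x a)"
proof -
  have "ehat X (pcoh_id X) x a = (\<Sum>\<mu>\<in>{{#a#}}. ennreal (pcoh_id X (\<mu>, a) * mpow x \<mu>))"
    unfolding ehat_def
    using assms by (intro nn_integral_count_space') (auto simp: pcoh_id_def mfin_def)
  then show ?thesis using assms by (simp add: pcoh_id_def)
qed

lemma pcoh_id_in_pcoh_hom: "pcoh_id X \<in> pcoh_hom X X"
  and hat_pcoh_id: "x \<in> cliques X \<Longrightarrow> hat X (pcoh_id X) x = x"
proof -
  interpret XX: coherence_space_pair X X ..
  have "pcoh_id X \<in> nnvecs (mfin (web X) \<times> web X)"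
    by (auto simp: nnvecs_def pcoh_id_def mfin_def)
  note hom = XX.pcoh_homI[OF this, of "\<lambda>x. x"]
  show "pcoh_id X \<in> pcoh_hom X X" by (rule hom(1)) (simp_all add: ehat_pcoh_id)
  show "hat X (pcoh_id X) x = x" if "x \<in> cliques X"
    by (rule hom(2)) (simp_all add: ehat_pcoh_id that)
qed

lemma Fm_map_pcoh_id: "Fm_map X (pcoh_id X) = cstab_id (Fm X)"
  unfolding Fm_map_def cstab_id_def by (rule restrict_ext) (simp add: unit_ball_Fm hat_pcoh_id)

end

definition multiset_lists :: "'a set \<Rightarrow> nat \<Rightarrow> 'a multiset list set" where
  "multiset_lists A n = {ms. length ms = n \<and> set ms \<subseteq> mfin A}"

lemma bij_betw_multiset_lists_Suc:
  "bij_betw (\<lambda>(m, ms). m # ms) (mfin A \<times> multiset_lists A n) (multiset_lists A (Suc n))"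
  by (rule bij_betw_byWitness[where f' = "\<lambda>ms. (hd ms, tl ms)"])
    (auto simp: multiset_lists_def length_Suc_conv)

lemma finite_submultisets: "finite {\<nu>. \<nu> \<subseteq># (\<mu> :: 'a multiset)}"
proof -
  have "{\<nu>. \<nu> \<subseteq># \<mu>} \<subseteq> mset ` {xs. set xs \<subseteq> set_mset \<mu> \<and> length xs \<le> size \<mu>}"
  proof
    fix \<nu> assume "\<nu> \<in> {\<nu>. \<nu> \<subseteq># \<mu>}"
    moreover obtain xs where "mset xs = \<nu>" using ex_mset by blast
    ultimately show "\<nu> \<in> mset ` {xs. set xs \<subseteq> set_mset \<mu> \<and> length xs \<le> size \<mu>}"
      using set_mset_mono[of \<nu> \<mu>] size_mset_mono[of \<nu> \<mu>] by (intro image_eqI[of _ _ xs]) auto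
  qed
  then show ?thesis by (rule finite_subset) (simp add: finite_lists_length_le)
qed

lemma finite_lists_sum_list: "finite {ms. length ms = n \<and> sum_list ms = (\<mu> :: 'a multiset)}"
proof (rule finite_subset)
  have "m \<subseteq># sum_list ms" if "m \<in> set ms" for m :: "'a multiset" and ms
    using that by (induction ms) (auto intro: subset_mset.order_trans)
  then show "{ms. length ms = n \<and> sum_list ms = \<mu>} \<subseteq> {ms. set ms \<subseteq> {m. m \<subseteq># \<mu>} \<and> length ms = n}"
    by auto
qed (simp add: finite_lists_length_eq finite_submultisets)

lemma multiset_lists_iff_sum_list: "ms \<in> multiset_lists A n \<longleftrightarrow> length ms = n \<and> sum_list ms \<in> mfin A"
proof -
  have "set_mset (sum_list ms) = (\<Union>m\<in>set ms. set_mset m)" by (induction ms) auto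
  then show ?thesis by (auto simp: multiset_lists_def mfin_def)
qed

text \<open>Multiplying out a product of power series: a choice of one monomial per factor is a list of
  multisets, and the sum of the list is the exponent of the resulting monomial.\<close>

lemma esum_multiset_lists_prod:
  assumes f_nonneg: "0 \<le> f" and x_nonneg: "0 \<le> x"
  shows "esum (multiset_lists (web X) (length bs))
      (\<lambda>ms. ennreal ((\<Prod>i<length bs. f (ms ! i, bs ! i)) * mpow x (sum_list ms))) =
        (\<Prod>b\<leftarrow>bs. ehat X f x b)"
proof (induction bs)
  case Nil
  have "multiset_lists (web X) 0 = {[]}" by (auto simp: multiset_lists_def)
  then show ?case by (simp add: nn_integral_count_space_finite)
next
  case (Cons b bs)
  let ?g = "\<lambda>bs ms. (\<Prod>i<length bs. f (ms ! i, bs ! i)) * mpow x (sum_list ms)"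
  have nonneg: "0 \<le> ?g bs ms" "0 \<le> f (m, b) * mpow x m" for ms m
    using x_nonneg by (simp_all add: prod_nonneg mpow_nonneg nonneg_fun_apply[OF f_nonneg])
  have "?g (b # bs) (m # ms) = f (m, b) * mpow x m * ?g bs ms" for m ms
    by (simp add: prod.lessThan_Suc_shift del: prod.lessThan_Suc)
  then have split: "ennreal (?g (b # bs) (m # ms)) =
      ennreal (f (m, b) * mpow x m) * ennreal (?g bs ms)" for m ms
    using ennreal_mult[OF nonneg(2,1)] by metis
  have "esum (multiset_lists (web X) (length (b # bs))) (\<lambda>ms. ennreal (?g (b # bs) ms)) =
      esum (mfin (web X) \<times> multiset_lists (web X) (length bs))
        (\<lambda>p. ennreal (?g (b # bs) ((\<lambda>(m, ms). m # ms) p)))"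
    using nn_integral_bij_count_space[OF bij_betw_multiset_lists_Suc[of "web X" "length bs"],
        where f = "\<lambda>ms. ennreal (?g (b # bs) ms)"] by simp
  also have "\<dots> = esum (mfin (web X)) (\<lambda>m. esum (multiset_lists (web X) (length bs))
      (\<lambda>ms. ennreal (f (m, b) * mpow x m) * ennreal (?g bs ms)))"
    unfolding esum_product_iterated prod.case split ..
  also have "\<dots> = ehat X f x b * esum (multiset_lists (web X) (length bs)) (\<lambda>ms. ennreal (?g bs ms))"
    by (simp add: nn_integral_cmult nn_integral_multc ehat_def)
  finally show ?case by (simp add: Cons)
qed

lemma esum_promotion:
  assumes f_nonneg: "0 \<le> f" and x_nonneg: "0 \<le> x" and "countable (web X)"
  shows "esum (mfin (web X)) (\<lambda>\<mu>. ennreal (promotion f \<mu> \<nu> * mpow x \<mu>)) = (\<Prod>b\<in>#\<nu>. ehat X f x b)"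
proof -
  define bs where "bs = (SOME bs. mset bs = \<nu>)"
  have bs_mset: "mset bs = \<nu>" unfolding bs_def using ex_mset by (rule someI_ex)
  let ?n = "length bs" and ?A = "mfin (web X)"
  let ?g = "\<lambda>ms. (\<Prod>i<?n. f (ms ! i, bs ! i)) * mpow x (sum_list ms)"
  let ?S = "\<lambda>\<mu>. {ms. length ms = ?n \<and> sum_list ms = \<mu>}"
  have nonneg: "0 \<le> ?g ms" for ms
    using x_nonneg by (simp_all add: prod_nonneg mpow_nonneg nonneg_fun_apply[OF f_nonneg])
  have "(\<Prod>b\<in>#\<nu>. ehat X f x b) = esum (multiset_lists (web X) ?n) (\<lambda>ms. ennreal (?g ms))"
    by (simp add: esum_multiset_lists_prod[OF f_nonneg x_nonneg] prod_mset_prod_list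
      flip: bs_mset mset_map)
  also have "\<dots> =
      esum (multiset_lists (web X) ?n) (\<lambda>ms. esum ?A (\<lambda>\<mu>. ennreal (?g ms) *
      indicator {sum_list ms} \<mu>))"
  proof (rule nn_integral_cong)
    fix ms assume "ms \<in> space (count_space (multiset_lists (web X) ?n))"
    then show "ennreal (?g ms) = esum ?A (\<lambda>\<mu>. ennreal (?g ms) * indicator {sum_list ms} \<mu>)"
      by (subst nn_integral_count_space'[of "{sum_list ms}"])
        (auto simp: multiset_lists_iff_sum_list)
  qed
  also have "\<dots> =
      esum ?A (\<lambda>\<mu>. esum (multiset_lists (web X) ?n) (\<lambda>ms. ennreal (?g ms) *
      indicator {sum_list ms} \<mu>))"
    using assms(3) by (intro nn_integral_count_space_nn_integral countable_mfin) auto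
  also have "\<dots> = esum ?A (\<lambda>\<mu>. ennreal (promotion f \<mu> \<nu> * mpow x \<mu>))"
  proof (rule nn_integral_cong)
    fix \<mu> assume "\<mu> \<in> space (count_space ?A)"
    then have "esum (multiset_lists (web X) ?n) (\<lambda>ms. ennreal (?g ms) * indicator {sum_list ms} \<mu>) =
        (\<Sum>ms\<in>?S \<mu>. ennreal (?g ms) * indicator {sum_list ms} \<mu>)"
      by (intro nn_integral_count_space' finite_lists_sum_list)
        (auto simp: multiset_lists_iff_sum_list indicator_def)
    also have "\<dots> = (\<Sum>ms\<in>?S \<mu>. ennreal (?g ms))" by (intro sum.cong) auto
    also have "\<dots> = ennreal (\<Sum>ms\<in>?S \<mu>. ?g ms)" by (rule sum_ennreal) (rule nonneg)
    also have "(\<Sum>ms\<in>?S \<mu>. ?g ms) = promotion f \<mu> \<nu> * mpow x \<mu>"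
      by (simp add: promotion_def Let_def sum_distrib_right flip: bs_def)
    finally show
        "esum (multiset_lists (web X) ?n) (\<lambda>ms. ennreal (?g ms) * indicator {sum_list ms} \<mu>) =
        ennreal (promotion f \<mu> \<nu> * mpow x \<mu>)" .
  qed
  finally show ?thesis by simp
qed

lemma promotion_nonneg: "0 \<le> f \<Longrightarrow> 0 \<le> promotion f \<mu> \<nu>"
  by (simp add: promotion_def Let_def sum_nonneg prod_nonneg nonneg_fun_apply[of f])

lemma promotion_outside:
  assumes "\<And>m b. m \<notin> mfin A \<Longrightarrow> f (m, b) = 0" and "\<mu> \<notin> mfin A"
  shows "promotion f \<mu> \<nu> = 0"
  unfolding promotion_def Let_def
proof (rule sum.neutral, rule ballI)
  let ?bs = "SOME bs. mset bs = \<nu>"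
  fix ms assume "ms \<in> {ms. length ms = length ?bs \<and> sum_list ms = \<mu>}"
  then have ms_length: "length ms = length ?bs" and "ms \<notin> multiset_lists A (length ms)"
    using assms(2) by (auto simp: multiset_lists_iff_sum_list)
  then obtain m where "m \<in> set ms" "m \<notin> mfin A" by (auto simp: multiset_lists_def)
  then obtain i where "i < length ms" "ms ! i \<notin> mfin A" by (auto simp: in_set_conv_nth)
  then show "(\<Prod>i<length ?bs. f (ms ! i, ?bs ! i)) = 0"
    using assms(1) ms_length by (intro prod_zero) auto
qed

lemma prod_mset_ennreal: "0 \<le> y \<Longrightarrow> (\<Prod>b\<in>#\<nu>. ennreal (y b)) = ennreal (mpow y \<nu>)"
  by (induction \<nu>) (simp_all add: ennreal_mult' nonneg_fun_apply[of y])

locale coherence_space_triple = XY: coherence_space_pair X Y + YZ: coherence_space_pair Y Z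
  for X :: "'a pcs" and Y :: "'b pcs" and Z :: "'c pcs"
begin

sublocale XZ: coherence_space_pair X Z
  ..

lemma esum_composite_coefficients:
  assumes f_hom: "f \<in> pcoh_hom X Y" and g_hom: "g \<in> pcoh_hom Y Z" and x_clique: "x \<in> cliques X"
  shows "esum (mfin (web X)) (\<lambda>\<mu>. esum (mfin (web Y)) (\<lambda>\<nu>. ennreal (g (\<nu>, c) * promotion f \<mu> \<nu>)) *
      ennreal (mpow x \<mu>)) =
    ennreal (hat Y g (hat X f x) c)"
proof -
  note f_elem = XY.pcoh_hom_elem[OF f_hom] and g_elem = YZ.pcoh_hom_elem[OF g_hom]
  have f_nonneg: "0 \<le> f" and g_nonneg: "0 \<le> g"
    using XY.XY.elem_nonneg[OF f_elem] YZ.XY.elem_nonneg[OF g_elem] .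
  have x_nonneg: "0 \<le> x" by (rule XY.X.clique_nonneg[OF x_clique])
  have fx_clique: "hat X f x \<in> cliques Y" using f_hom x_clique by (simp add: pcoh_hom_def)
  then have fx_nonneg: "0 \<le> hat X f x" by (rule XY.Y.clique_nonneg)
  have promotion: "esum (mfin (web X)) (\<lambda>\<mu>. ennreal (promotion f \<mu> \<nu> * mpow x \<mu>)) =
      ennreal (mpow (hat X f x) \<nu>)" for \<nu>
    using XY.X.countable_web
    by (simp add: esum_promotion[OF f_nonneg x_nonneg] XY.ehat_eq_hat[OF f_elem x_clique]
      prod_mset_ennreal[OF fx_nonneg])
  have "ennreal (g (\<nu>, c) * promotion f \<mu> \<nu>) * ennreal (mpow x \<mu>) =
      ennreal (g (\<nu>, c)) * ennreal (promotion f \<mu> \<nu> * mpow x \<mu>)" for \<mu> \<nu>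
    using nonneg_fun_apply[OF g_nonneg] promotion_nonneg[OF f_nonneg] mpow_nonneg[OF x_nonneg]
    by (simp add: mult.assoc flip: ennreal_mult)
  then have
      "esum (mfin (web X)) (\<lambda>\<mu>. esum (mfin (web Y)) (\<lambda>\<nu>. ennreal (g (\<nu>, c) * promotion f \<mu> \<nu>)) *
      ennreal (mpow x \<mu>)) =
      esum (mfin (web X)) (\<lambda>\<mu>. esum (mfin (web Y)) (\<lambda>\<nu>. ennreal (g (\<nu>, c)) *
          ennreal (promotion f \<mu> \<nu> * mpow x \<mu>)))"
    by (simp flip: nn_integral_multc)
  also have "\<dots> =
      esum (mfin (web Y)) (\<lambda>\<nu>. esum (mfin (web X)) (\<lambda>\<mu>. ennreal (g (\<nu>, c)) *
      ennreal (promotion f \<mu> \<nu> * mpow x \<mu>)))"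
    using XY.Y.countable_web by (intro nn_integral_count_space_nn_integral countable_mfin) auto
  also have "\<dots> = esum (mfin (web Y)) (\<lambda>\<nu>. ennreal (g (\<nu>, c) * mpow (hat X f x) \<nu>))"
    using nonneg_fun_apply[OF g_nonneg] mpow_nonneg[OF fx_nonneg]
    by (simp add: nn_integral_cmult promotion ennreal_mult)
  also have "\<dots> = ennreal (hat Y g (hat X f x) c)"
    using YZ.ehat_eq_hat[OF g_elem fx_clique] by (simp add: ehat_def)
  finally show ?thesis .
qed

lemma composite_coefficient_finite:
  assumes f_hom: "f \<in> pcoh_hom X Y" and g_hom: "g \<in> pcoh_hom Y Z" and \<mu>_mfin: "\<mu> \<in> mfin (web X)"
  shows "esum (mfin (web Y)) (\<lambda>\<nu>. ennreal (g (\<nu>, c) * promotion f \<mu> \<nu>)) =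
      ennreal (pcoh_comp Y g f (\<mu>, c))"
proof -
  have f_nonneg: "0 \<le> f" and g_nonneg: "0 \<le> g"
    using XY.XY.elem_nonneg[OF XY.pcoh_hom_elem[OF f_hom]]
      YZ.XY.elem_nonneg[OF YZ.pcoh_hom_elem[OF g_hom]] .
  have nonneg: "0 \<le> g (\<nu>, c) * promotion f \<mu> \<nu>" for \<nu>
    by (intro mult_nonneg_nonneg nonneg_fun_apply[OF g_nonneg] promotion_nonneg f_nonneg)
  obtain x where x_clique: "x \<in> cliques X" and x_pos: "\<And>a. a \<in># \<mu> \<Longrightarrow> 0 < x a"
    using XY.X.clique_with_support[of "set_mset \<mu>"] \<mu>_mfin
    by (metis finite_set_mset mfin_def mem_Collect_eq)
  let ?e = "\<lambda>\<mu>. esum (mfin (web Y)) (\<lambda>\<nu>. ennreal (g (\<nu>, c) * promotion f \<mu> \<nu>))"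
  have "?e \<mu> * ennreal (mpow x \<mu>) \<le> ennreal (hat Y g (hat X f x) c)"
    using nn_integral_ge_point[OF \<mu>_mfin, of "\<lambda>\<mu>. ?e \<mu> * ennreal (mpow x \<mu>)"]
      esum_composite_coefficients[OF f_hom g_hom x_clique] by simp
  moreover have "0 < mpow x \<mu>" using x_pos by (rule mpow_pos)
  ultimately have "?e \<mu> < \<infinity>"
    by (cases "?e \<mu>") (auto simp: ennreal_top_mult top_unique)
  then show ?thesis
    using nonneg esum_eq_infsum[of "mfin (web Y)" "\<lambda>\<nu>. g (\<nu>, c) * promotion f \<mu> \<nu>"]
    by (simp add: pcoh_comp_def summable_on_iff_esum)
qed

lemma pcoh_comp_in_pcoh_hom:
  assumes f_hom: "f \<in> pcoh_hom X Y" and g_hom: "g \<in> pcoh_hom Y Z"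
  shows "pcoh_comp Y g f \<in> pcoh_hom X Z"
    and "\<And>x. x \<in> cliques X \<Longrightarrow> hat X (pcoh_comp Y g f) x = hat Y g (hat X f x)"
proof -
  let ?h = "pcoh_comp Y g f"
  have f_elem: "f \<in> elems (Fm (pcs_exp X Y))" and g_elem: "g \<in> elems (Fm (pcs_exp Y Z))"
    using XY.pcoh_hom_elem[OF f_hom] YZ.pcoh_hom_elem[OF g_hom] .
  have f_nonneg: "0 \<le> f" and g_nonneg: "0 \<le> g"
    using XY.XY.elem_nonneg[OF f_elem] YZ.XY.elem_nonneg[OF g_elem] .
  have nonneg: "0 \<le> ?h p" for p
    by (cases p)
      (auto simp: pcoh_comp_def
        intro!: infsum_nonneg mult_nonneg_nonneg nonneg_fun_apply[OF
        g_nonneg] promotion_nonneg f_nonneg)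
  have zero: "?h (\<mu>, c) = 0" if "\<mu> \<notin> mfin (web X) \<or> c \<notin> web Z" for \<mu> c
  proof -
    have "g (\<nu>, c) * promotion f \<mu> \<nu> = 0" for \<nu>
      using that YZ.exp_elem_outside[OF g_elem, of \<nu> c] promotion_outside[of "web X" f \<mu> \<nu>]
        XY.exp_elem_outside[OF f_elem]
      by auto
    then show ?thesis unfolding pcoh_comp_def prod.case by (simp only: infsum_0_simp)
  qed
  have h_nnvecs: "?h \<in> nnvecs (mfin (web X) \<times> web Z)" using nonneg zero by (auto simp: nnvecs_def)
  have ehat: "ehat X ?h x c = ennreal (hat Y g (hat X f x) c)" if x_clique: "x \<in> cliques X" for x c
    unfolding ehat_def esum_composite_coefficients[OF f_hom g_hom x_clique, symmetric]
  proof (rule nn_integral_cong)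
    fix \<mu> assume "\<mu> \<in> space (count_space (mfin (web X)))"
    then show "ennreal (?h (\<mu>, c) * mpow x \<mu>) =
        esum (mfin (web Y)) (\<lambda>\<nu>. ennreal (g (\<nu>, c) * promotion f \<mu> \<nu>)) * ennreal (mpow x \<mu>)"
      using composite_coefficient_finite[OF f_hom g_hom]
        mpow_nonneg[OF XY.X.clique_nonneg[OF x_clique]]
      by (simp add: ennreal_mult'')
  qed
  have clique: "hat Y g (hat X f x) \<in> cliques Z" if "x \<in> cliques X" for x
    using f_hom g_hom that by (simp add: pcoh_hom_def)
  show "?h \<in> pcoh_hom X Z" by (rule XZ.pcoh_homI(1)[OF h_nnvecs clique ehat])
  show "hat X ?h x = hat Y g (hat X f x)" if "x \<in> cliques X" for x
    by (rule XZ.pcoh_homI(2)[OF h_nnvecs clique ehat that])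
qed

lemma Fm_map_pcoh_comp:
  assumes f_hom: "f \<in> pcoh_hom X Y" and g_hom: "g \<in> pcoh_hom Y Z"
  shows "Fm_map X (pcoh_comp Y g f) = cstab_comp (Fm X) (Fm_map Y g) (Fm_map X f)"
  unfolding Fm_map_def[of X "pcoh_comp Y g f"] cstab_comp_def compose_def
proof (rule restrict_ext)
  fix x assume "x \<in> unit_ball (Fm X)"
  then have x_clique: "x \<in> cliques X" by (simp add: XY.X.unit_ball_Fm)
  moreover have "hat X f x \<in> cliques Y" using f_hom x_clique by (simp add: pcoh_hom_def)
  ultimately show "hat X (pcoh_comp Y g f) x = Fm_map Y g (Fm_map X f x)"
    by (simp add: XY.Fm_map_apply YZ.Fm_map_apply pcoh_comp_in_pcoh_hom(2)[OF f_hom g_hom])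
qed

end

section \<open>Coefficients of power series\<close>

definition power_series_on ::
  "'a set \<Rightarrow> ('a \<Rightarrow> real) set \<Rightarrow> ('a multiset \<Rightarrow> real) \<Rightarrow> (('a \<Rightarrow> real) \<Rightarrow> real) \<Rightarrow> bool" where
  "power_series_on A B c g \<longleftrightarrow> 0 \<le> c \<and> (\<forall>x\<in>B. ((\<lambda>\<mu>. c \<mu> * mpow x \<mu>) has_sum g x) (mfin A))"

lemma power_series_on_nonneg: "power_series_on A B c g \<Longrightarrow> 0 \<le> c \<mu>"
  by (simp add: power_series_on_def le_fun_def)

lemma power_series_on_has_sum: "power_series_on A B c g \<Longrightarrow> x \<in> B \<Longrightarrow>
    ((\<lambda>\<mu>. c \<mu> * mpow x \<mu>) has_sum g x) (mfin A)"
  by (simp add: power_series_on_def)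

lemma has_sum_mfin_support:
  assumes "F \<subseteq> A" and "\<And>a. a \<notin> F \<Longrightarrow> x a = 0"
  shows "((\<lambda>\<mu>. c \<mu> * mpow x \<mu>) has_sum s) (mfin A) \<longleftrightarrow> ((\<lambda>\<mu>. c \<mu> * mpow x \<mu>) has_sum s) (mfin F)"
  using mfin_mono[OF assms(1)] mpow_eq_0[of F x, OF assms(2)] by (intro has_sum_cong_neutral) auto

lemma power_series_on_restrict:
  assumes "power_series_on A B c g" and "F \<subseteq> A" and "B' \<subseteq> B" and "\<And>x a. x \<in> B' \<Longrightarrow> a \<notin> F \<Longrightarrow> x a = 0"
  shows "power_series_on F B' c g"
  unfolding power_series_on_def
proof (intro conjI ballI)
  show "0 \<le> c" using assms(1) by (simp add: power_series_on_def)
  show "((\<lambda>\<mu>. c \<mu> * mpow x \<mu>) has_sum g x) (mfin F)" if "x \<in> B'" for x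
    using power_series_on_has_sum[OF assms(1)] assms(3) that
    by (subst has_sum_mfin_support[OF assms(2) assms(4)[OF that], symmetric]) auto
qed

lemma power_series_has_sum_LIMSEQ:
  assumes c_nonneg: "0 \<le> c" and x_nonneg: "\<And>n. 0 \<le> x n" and x_incseq: "incseq x" and x_lim: "x \<longlonglongrightarrow> y"
    and sum: "\<And>n. ((\<lambda>\<mu>. c \<mu> * mpow (x n) \<mu>) has_sum s n) A" and lim: "s \<longlonglongrightarrow> l"
  shows "((\<lambda>\<mu>. c \<mu> * mpow y \<mu>) has_sum l) A"
proof -
  have term_nonneg: "0 \<le> c \<mu> * mpow x \<mu>" if "0 \<le> x" for \<mu> x
    using c_nonneg that by (simp add: le_fun_def mpow_nonneg)
  have s_nonneg: "0 \<le> s n" for n using sum[of n] term_nonneg[OF x_nonneg] by (rule has_sum_nonneg)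
  have y_nonneg: "0 \<le> y"
    using x_nonneg[of 0] incseq_LIMSEQ_fun_le[OF x_incseq x_lim] by (rule order_trans)
  have "(\<lambda>n. esum A (\<lambda>\<mu>. ennreal (c \<mu> * mpow (x n) \<mu>))) \<longlonglongrightarrow> esum A (\<lambda>\<mu>. ennreal (c \<mu> * mpow y \<mu>))"
  proof (rule nn_integral_LIMSEQ)
    have "c \<mu> * mpow (x m) \<mu> \<le> c \<mu> * mpow (x n) \<mu>" if "m \<le> n" for m n \<mu>
      using that c_nonneg x_nonneg x_incseq
      by (intro mult_left_mono mpow_mono) (auto simp: incseq_def le_fun_def)
    then show "incseq (\<lambda>n \<mu>. ennreal (c \<mu> * mpow (x n) \<mu>))"
      by (auto simp: incseq_def le_fun_def intro: ennreal_leI)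
    show "(\<lambda>n. ennreal (c \<mu> * mpow (x n) \<mu>)) \<longlonglongrightarrow> ennreal (c \<mu> * mpow y \<mu>)" for \<mu>
      using x_lim by (intro tendsto_ennrealI tendsto_mult tendsto_const tendsto_mpow)
  qed simp
  moreover have "esum A (\<lambda>\<mu>. ennreal (c \<mu> * mpow (x n) \<mu>)) = ennreal (s n)" for n
    using sum[of n] s_nonneg term_nonneg[OF x_nonneg] by (simp add: has_sum_iff_esum)
  ultimately have "esum A (\<lambda>\<mu>. ennreal (c \<mu> * mpow y \<mu>)) = ennreal l"
    using tendsto_ennrealI[OF lim] LIMSEQ_unique by fastforce
  moreover have "0 \<le> l" using lim s_nonneg by (intro LIMSEQ_le_const) auto
  ultimately show ?thesis using term_nonneg[OF y_nonneg] by (simp add: has_sum_iff_esum)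
qed

lemma power_series_remainder:
  fixes c :: "nat \<Rightarrow> real"
  assumes c_nonneg: "\<And>j. 0 \<le> c j" and t_pos: "0 < t" and t_le: "t \<le> w"
    and g_has_sum: "((\<lambda>j. c j * t ^ j) has_sum g) UNIV"
    and h_has_sum: "((\<lambda>j. c j * w ^ j) has_sum h) UNIV"
  shows "\<bar>(g - (\<Sum>i<j. c i * t ^ i)) / t ^ j - c j\<bar> \<le> t * (h / w ^ Suc j)"
proof -
  have w_pos: "0 < w" using t_pos t_le by simp
  define R where "R = g - (\<Sum>i<Suc j. c i * t ^ i)"
  have R_sums: "(\<lambda>i. c (i + Suc j) * t ^ (i + Suc j)) sums R"
    unfolding R_def by (rule sums_split_initial_segment[OF has_sum_imp_sums[OF g_has_sum]])
  have tail_sums: "(\<lambda>i. c (i + Suc j) * w ^ (i + Suc j)) sums (h - (\<Sum>i<Suc j. c i * w ^ i))"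
    by (rule sums_split_initial_segment[OF has_sum_imp_sums[OF h_has_sum]])
  have "R \<le> (t / w) ^ Suc j * (h - (\<Sum>i<Suc j. c i * w ^ i))"
  proof (rule sums_le[OF _ R_sums sums_mult[OF tail_sums]])
    fix i
    have "t ^ (i + Suc j) = (t / w) ^ (i + Suc j) * w ^ (i + Suc j)"
      using w_pos by (simp add: power_divide)
    also have "\<dots> \<le> (t / w) ^ Suc j * w ^ (i + Suc j)"
      using t_pos t_le w_pos by (intro mult_right_mono power_decreasing) auto
    finally show "c (i + Suc j) * t ^ (i + Suc j) \<le>
        (t / w) ^ Suc j * (c (i + Suc j) * w ^ (i + Suc j))"
      using c_nonneg by (metis mult.left_commute mult_left_mono)
  qed
  also have "\<dots> \<le> (t / w) ^ Suc j * h"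
    using t_pos t_le w_pos c_nonneg
    by (intro mult_left_mono)
      (auto intro!: sum_nonneg mult_nonneg_nonneg simp del: sum.lessThan_Suc)
  also have "\<dots> = t ^ j * (t * (h / w ^ Suc j))" by (simp add: power_divide)
  finally have "R / t ^ j \<le> t * (h / w ^ Suc j)"
    using t_pos t_le by (simp add: pos_divide_le_eq mult.commute)
  moreover have "0 \<le> R" using sums_le[OF _ sums_zero R_sums] c_nonneg t_pos t_le by simp
  moreover have "(g - (\<Sum>i<j. c i * t ^ i)) / t ^ j - c j = R / t ^ j"
    using t_pos t_le by (simp add: R_def field_simps)
  ultimately show ?thesis using t_pos t_le by simp
qed

lemma coefficient_borel_measurable_real:
  fixes c :: "nat \<Rightarrow> 's \<Rightarrow> real"
  assumes w_pos: "0 < w" and c_nonneg: "\<And>j s. s \<in> space M \<Longrightarrow> 0 \<le> c j s"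
    and sums: "\<And>t s. 0 \<le> t \<Longrightarrow> t \<le> w \<Longrightarrow> s \<in> space M \<Longrightarrow> ((\<lambda>j. c j s * t ^ j) has_sum g t s) UNIV"
    and meas: "\<And>t. 0 \<le> t \<Longrightarrow> t \<le> w \<Longrightarrow> g t \<in> borel_measurable M"
  shows "c j \<in> borel_measurable M"
proof (induction j rule: less_induct)
  case (less j)
  define t where "t n = w * inverse (real (Suc n))" for n
  have t_pos: "0 < t n" and t_le: "t n \<le> w" for n using w_pos by (auto simp: t_def field_simps)
  have "t \<longlonglongrightarrow> w * 0" unfolding t_def by (intro tendsto_mult tendsto_const LIMSEQ_inverse_real_of_nat)
  then have t_lim: "t \<longlonglongrightarrow> 0" by simp
  define q where "q n s = (g (t n) s - (\<Sum>i<j. c i s * t n ^ i)) / t n ^ j" for n s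
  show ?case
  proof (rule borel_measurable_LIMSEQ_real)
    show "q n \<in> borel_measurable M" for n
      unfolding q_def using less meas[of "t n"] t_pos[of n] t_le[of n]
      by (intro borel_measurable_divide borel_measurable_diff borel_measurable_sum
        borel_measurable_times) auto
    fix s assume s_space: "s \<in> space M"
    have bound: "norm (q n s - c j s) \<le> t n * (g w s / w ^ Suc j)" for n
      unfolding real_norm_def q_def
      using sums[of "t n" s] sums[of w s] t_pos[of n] t_le[of n] s_space c_nonneg w_pos
      by (intro power_series_remainder) auto
    have "(\<lambda>n. t n * (g w s / w ^ Suc j)) \<longlonglongrightarrow> 0" using t_lim by (rule tendsto_mult_left_zero)
    with always_eventually[OF allI[OF bound]] have "(\<lambda>n. q n s - c j s) \<longlonglongrightarrow> 0"
      by (rule Lim_null_comparison)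
    then show "(\<lambda>n. q n s) \<longlonglongrightarrow> c j s" by (simp add: LIM_zero_iff)
  qed
qed

lemma bij_betw_mfin_insert:
  assumes "a \<notin> F"
  shows "bij_betw (\<lambda>(j, \<nu>). \<nu> + replicate_mset j a) (UNIV \<times> mfin F) (mfin (insert a F))"
proof (rule bij_betw_byWitness[where f' = "\<lambda>\<mu>. (count \<mu> a, filter_mset (\<lambda>b. b \<noteq> a) \<mu>)"])
  have "filter_mset (\<lambda>b. b \<noteq> a) \<nu> = \<nu>" "count \<nu> a = 0" if "\<nu> \<in> mfin F" for \<nu>
    using that assms by (auto simp: mfin_def filter_mset_eq_conv count_eq_zero_iff)
  then show
      "\<forall>p\<in>UNIV \<times> mfin F. (\<lambda>\<mu>. (count \<mu> a, filter_mset (\<lambda>b. b \<noteq> a) \<mu>)) ((\<lambda>(j, \<nu>). \<nu> +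
      replicate_mset j a) p) = p"
    by auto
  show "\<forall>\<mu>\<in>mfin (insert a F). (\<lambda>(j, \<nu>). \<nu> +
      replicate_mset j a) (count \<mu> a, filter_mset (\<lambda>b. b \<noteq> a) \<mu>) = \<mu>"
    by (auto simp: multiset_eq_iff)
qed (auto simp: mfin_def split: if_splits)

lemma mpow_fun_upd_replicate_mset:
  assumes "a \<notin> F" and "\<nu> \<in> mfin F"
  shows "mpow (x(a := \<tau>)) (\<nu> + replicate_mset j a) = mpow x \<nu> * \<tau> ^ j"
proof -
  have "mpow (x(a := \<tau>)) \<nu> = mpow x \<nu>" using assms by (intro mpow_cong) (auto simp: mfin_def)
  then show ?thesis by simp
qed

text \<open>The coefficient of the \<open>j\<close>-th power of \<open>x a\<close>, a power series in the remaining variables.\<close>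

definition slice :: "'a set \<Rightarrow> 'a \<Rightarrow> ('a multiset \<Rightarrow> real) \<Rightarrow> nat \<Rightarrow> ('a \<Rightarrow> real) \<Rightarrow> real" where
  "slice F a c j x = (\<Sum>\<^sub>\<infinity>\<nu>\<in>mfin F. c (\<nu> + replicate_mset j a) * mpow x \<nu>)"

context
  fixes F :: "'a set" and a and c g and w :: "'a \<Rightarrow> real"
  assumes a_notin: "a \<notin> F" and w_pos: "0 < w a"
    and series: "power_series_on (insert a F) {0..w} c g"
begin

lemma has_sum_fun_upd:
  assumes "x \<in> {0..w}" and "0 \<le> \<tau>" and "\<tau> \<le> w a"
  shows "((\<lambda>\<mu>. c \<mu> * mpow (x(a := \<tau>)) \<mu>) has_sum g (x(a := \<tau>))) (mfin (insert a F))"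
  using assms by (intro power_series_on_has_sum[OF series]) (auto simp: le_fun_def)

lemma slice_has_sum:
  assumes x_box: "x \<in> {0..w}"
  shows "((\<lambda>\<nu>. c (\<nu> + replicate_mset j a) * mpow x \<nu>) has_sum slice F a c j x) (mfin F)"
proof -
  have "(\<lambda>\<mu>. c \<mu> * mpow (x(a := w a)) \<mu>) summable_on mfin (insert a F)"
    using w_pos by (intro has_sum_imp_summable[OF has_sum_fun_upd[OF x_box]]) simp_all
  then have "(\<lambda>\<mu>. c \<mu> * mpow (x(a := w a)) \<mu>) summable_on (\<lambda>\<nu>. \<nu> + replicate_mset j a) ` mfin F"
    by (rule summable_on_subset_banach) (auto simp: mfin_def split: if_splits)
  then have
      "(\<lambda>\<nu>. c (\<nu> + replicate_mset j a) *
      mpow (x(a := w a)) (\<nu> + replicate_mset j a)) summable_on mfin F"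
    by (subst (asm) summable_on_reindex) (auto simp: inj_on_def o_def)
  then have "(\<lambda>\<nu>. c (\<nu> + replicate_mset j a) * mpow x \<nu> * w a ^ j) summable_on mfin F"
    by (rule summable_on_cong[THEN iffD1, rotated])
      (simp add: mpow_fun_upd_replicate_mset[OF a_notin] del: mpow_union)
  from summable_on_cmult_left[OF this, of "1 / w a ^ j"] show ?thesis
    using w_pos unfolding slice_def by (intro has_sum_infsum) simp
qed

lemma power_series_on_slice:
  "power_series_on F {0..w} (\<lambda>\<nu>. c (\<nu> + replicate_mset j a)) (slice F a c j)"
  using slice_has_sum power_series_on_nonneg[OF series]
  by (simp add: power_series_on_def le_fun_def)

lemma slice_nonneg:
  assumes "x \<in> {0..w}"
  shows "0 \<le> slice F a c j x"
  using assms power_series_on_nonneg[OF series]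
  by (intro has_sum_nonneg[OF slice_has_sum]) (simp_all add: mpow_nonneg)

lemma slices_has_sum:
  assumes "x \<in> {0..w}" and "0 \<le> \<tau>" and "\<tau> \<le> w a"
  shows "((\<lambda>j. slice F a c j x * \<tau> ^ j) has_sum g (x(a := \<tau>))) UNIV"
proof (rule has_sum_SigmaD)
  let ?f = "\<lambda>\<mu>. c \<mu> * mpow (x(a := \<tau>)) \<mu>" and ?h = "\<lambda>(j, \<nu>). \<nu> + replicate_mset j a"
  have "((\<lambda>p. ?f (?h p)) has_sum g (x(a := \<tau>))) (UNIV \<times> mfin F)"
    using has_sum_fun_upd[OF assms]
    by (subst has_sum_reindex_bij_betw[OF bij_betw_mfin_insert[OF a_notin], of ?f])
  then show
      "((\<lambda>(j, \<nu>). c (\<nu> + replicate_mset j a) * mpow x \<nu> * \<tau> ^ j) has_sum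
      g (x(a := \<tau>))) (UNIV \<times> mfin F)"
    by (rule has_sum_cong[THEN iffD1, rotated])
      (auto simp: mpow_fun_upd_replicate_mset[OF a_notin] simp del: mpow_union)
  show "((\<lambda>\<nu>. (\<lambda>(j, \<nu>). c (\<nu> + replicate_mset j a) * mpow x \<nu> * \<tau> ^ j) (j, \<nu>)) has_sum
      slice F a c j x * \<tau> ^ j) (mfin F)"
    for j
    using has_sum_cmult_left[OF slice_has_sum[OF assms(1), of j]] by simp
qed

end

text \<open>One lemma serves two purposes: it gives measurability of the coefficient maps, and over the
  trivial \<open>\<sigma>\<close>-algebra on \<open>bool\<close> it says that coefficients are determined by the values.\<close>

lemma coefficient_borel_measurable:
  fixes c :: "'a multiset \<Rightarrow> 's \<Rightarrow> real"
  assumes "finite F" and w_nonneg: "0 \<le> w" and w_pos: "\<And>a. a \<in> F \<Longrightarrow> 0 < w a"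
    and "\<And>s. s \<in> space M \<Longrightarrow> power_series_on F {0..w} (\<lambda>\<mu>. c \<mu> s) (\<lambda>x. g x s)"
    and "\<And>x. x \<in> {0..w} \<Longrightarrow> g x \<in> borel_measurable M"
    and "\<mu> \<in> mfin F"
  shows "c \<mu> \<in> borel_measurable M"
  using assms
proof (induction F arbitrary: c g \<mu>)
  case empty
  have zero: "0 \<in> {0..w}" using w_nonneg by simp
  have "c {#} s = g 0 s" if "s \<in> space M" for s
    using power_series_on_has_sum[OF empty.prems(3)[OF that] zero]
    by (simp add: has_sum_finite_iff zero_fun_def)
  moreover have "g 0 \<in> borel_measurable M" by (rule empty.prems(4)[OF zero])
  ultimately show ?case using empty.prems(5) measurable_cong[of M "c {#}" "g 0" borel] by simp
next
  case (insert a F)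
  have w_pos: "0 < w a" using insert.prems(2) by simp
  let ?h = "\<lambda>j x s. slice F a (\<lambda>\<mu>. c \<mu> s) j x"
  note series = insert.prems(3)
  have h_meas: "?h j x \<in> borel_measurable M" if x_box: "x \<in> {0..w}" for j x
  proof (rule coefficient_borel_measurable_real[OF w_pos, where g = "\<lambda>\<tau>. g (x(a := \<tau>))"])
    show "g (x(a := \<tau>)) \<in> borel_measurable M" if "0 \<le> \<tau>" "\<tau> \<le> w a" for \<tau>
      using x_box that by (intro insert.prems(4)) (auto simp: le_fun_def)
    show "0 \<le> ?h j x s" if "s \<in> space M" for j s
      by (rule slice_nonneg[OF insert.hyps(2) w_pos series[OF that] x_box])
    show "((\<lambda>j. ?h j x s * \<tau> ^ j) has_sum g (x(a := \<tau>)) s) UNIV"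
        if "0 \<le> \<tau>" "\<tau> \<le> w a" "s \<in> space M" for \<tau> s
      by (rule slices_has_sum[OF insert.hyps(2) w_pos series[OF that(3)] x_box that(1,2)])
  qed
  have "\<mu> \<in> (\<lambda>(j, \<nu>). \<nu> + replicate_mset j a) ` (UNIV \<times> mfin F)"
    using insert.prems(5) bij_betw_imp_surj_on[OF bij_betw_mfin_insert[OF insert.hyps(2)]] by simp
  then obtain j \<nu> where \<mu>_eq: "\<mu> = \<nu> + replicate_mset j a" and \<nu>_mfin: "\<nu> \<in> mfin F" by auto
  have "c (\<nu> + replicate_mset j a) \<in> borel_measurable M"
  proof (rule insert.IH[of "\<lambda>\<nu>. c (\<nu> + replicate_mset j a)" "?h j"])
    show "power_series_on F {0..w} (\<lambda>\<nu>. c (\<nu> + replicate_mset j a) s) (\<lambda>x. ?h j x s)"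
        if "s \<in> space M" for s
      by (rule power_series_on_slice[OF insert.hyps(2) w_pos series[OF that]])
    show "?h j x \<in> borel_measurable M" if "x \<in> {0..w}" for x by (rule h_meas[OF that])
  qed (use insert.prems(1,2) \<nu>_mfin in auto)
  then show ?case by (simp add: \<mu>_eq)
qed

lemma power_series_on_coefficient_unique:
  assumes "finite F" and "0 \<le> w" and "\<And>a. a \<in> F \<Longrightarrow> 0 < w a"
    and c_series: "power_series_on F {0..w} c g" and d_series: "power_series_on F {0..w} d g"
    and \<mu>_mfin: "\<mu> \<in> mfin F"
  shows "c \<mu> = d \<mu>"
proof -
  let ?M = "sigma (UNIV :: bool set) {}" and ?f = "\<lambda>s. if s then c \<mu> else d \<mu>"
  have "?f \<in> borel_measurable ?M"
  proof (rule coefficient_borel_measurable[OF assms(1-3), where g = "\<lambda>x s. g x" and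
      c = "\<lambda>\<mu> s. if s then c \<mu> else d \<mu>"])
    show "power_series_on F {0..w} (\<lambda>\<mu>. if s then c \<mu> else d \<mu>) g" for s
      using c_series d_series by (cases s) simp_all
  qed (use \<mu>_mfin in auto)
  then have "?f -` {c \<mu>} \<inter> space ?M \<in> sets ?M" by (rule measurable_sets) simp
  then have "?f -` {c \<mu>} \<in> {{}, UNIV}" by (simp add: sigma_sets_empty_eq)
  moreover have "True \<in> ?f -` {c \<mu>}" by simp
  ultimately have "False \<in> ?f -` {c \<mu>}" by blast
  then show ?thesis by simp
qed

context coherence_space_pair
begin

lemma power_series_on_hat:
  assumes f_elem: "f \<in> elems (Fm (pcs_exp X Y))"
  shows "power_series_on (web X) (cliques X) (\<lambda>\<mu>. f (\<mu>, b)) (\<lambda>x. hat X f x b)"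
  using hat_has_sum[OF f_elem] nonneg_fun_apply[OF XY.elem_nonneg[OF f_elem]]
  by (simp add: power_series_on_def le_fun_def)

lemma power_series_on_hat_box:
  assumes f_elem: "f \<in> elems (Fm (pcs_exp X Y))" and w_clique: "w \<in> cliques X"
    and "F \<subseteq> web X" "\<And>a. a \<notin> F \<Longrightarrow> w a = 0"
  shows "power_series_on F {0..w} (\<lambda>\<mu>. f (\<mu>, b)) (\<lambda>x. hat X f x b)"
proof (rule power_series_on_restrict[OF power_series_on_hat[OF f_elem] assms(3)])
  show "{0..w} \<subseteq> cliques X" using X.clique_antimono[OF w_clique] by auto
  show "x a = 0" if "x \<in> {0..w}" "a \<notin> F" for x a
    using that assms(4)[OF that(2)] by (auto simp: le_fun_def intro: antisym dest!: spec[of _ a])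
qed

lemma hat_eqD:
  assumes f_elem: "f \<in> elems (Fm (pcs_exp X Y))" and g_elem: "g \<in> elems (Fm (pcs_exp X Y))"
    and hat_eq: "\<And>x. x \<in> cliques X \<Longrightarrow> hat X f x = hat X g x"
  shows "f = g"
proof (rule ext, clarify)
  fix \<mu> b
  show "f (\<mu>, b) = g (\<mu>, b)"
  proof (cases "\<mu> \<in> mfin (web X)")
    case True
    then have \<mu>_support: "set_mset \<mu> \<subseteq> web X" by (simp add: mfin_def)
    obtain w where w_clique: "w \<in> cliques X" and w_pos: "\<And>a. a \<in># \<mu> \<Longrightarrow> 0 < w a"
        and w_eq_0: "\<And>a. a \<notin># \<mu> \<Longrightarrow> w a = 0"
      using X.clique_with_support[OF finite_set_mset \<mu>_support] by metis
    have "hat X g x = hat X f x" if "x \<in> {0..w}" for x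
      using that X.clique_antimono[OF w_clique, of x] hat_eq by simp
    then have "power_series_on (set_mset \<mu>) {0..w} (\<lambda>\<mu>. g (\<mu>, b)) (\<lambda>x. hat X f x b)"
      using power_series_on_hat_box[OF g_elem w_clique \<mu>_support w_eq_0, of b]
      by (simp add: power_series_on_def)
    then show ?thesis
      using power_series_on_hat_box[OF f_elem w_clique \<mu>_support w_eq_0, of b]
        X.clique_nonneg[OF w_clique] w_pos
      by (intro power_series_on_coefficient_unique[of "set_mset \<mu>" w "\<lambda>\<mu>. f (\<mu>, b)" _
        "\<lambda>\<mu>. g (\<mu>, b)"]) auto
  qed (simp add: exp_elem_outside f_elem g_elem)
qed

lemma matrix_entry_borel_measurable:
  assumes f_elem: "\<And>s. s \<in> space M \<Longrightarrow> f s \<in> elems (Fm (pcs_exp X Y))"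
    and meas: "\<And>x. x \<in> cliques X \<Longrightarrow> (\<lambda>s. hat X (f s) x b) \<in> borel_measurable M"
    and \<mu>_mfin: "\<mu> \<in> mfin (web X)"
  shows "(\<lambda>s. f s (\<mu>, b)) \<in> borel_measurable M"
proof -
  have \<mu>_support: "set_mset \<mu> \<subseteq> web X" using \<mu>_mfin by (simp add: mfin_def)
  obtain w where w_clique: "w \<in> cliques X" and w_pos: "\<And>a. a \<in># \<mu> \<Longrightarrow> 0 < w a"
      and w_eq_0: "\<And>a. a \<notin># \<mu> \<Longrightarrow> w a = 0"
    using X.clique_with_support[OF finite_set_mset \<mu>_support] by metis
  show ?thesis
  proof (rule coefficient_borel_measurable[where F = "set_mset \<mu>" and w = w and
      g = "\<lambda>x s. hat X (f s) x b"])
    show "power_series_on (set_mset \<mu>) {0..w} (\<lambda>\<mu>. f s (\<mu>, b)) (\<lambda>x. hat X (f s) x b)"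
        if "s \<in> space M" for s
      by (rule power_series_on_hat_box[OF f_elem[OF that] w_clique \<mu>_support w_eq_0])
    show "(\<lambda>s. hat X (f s) x b) \<in> borel_measurable M" if "x \<in> {0..w}" for x
      using that X.clique_antimono[OF w_clique, of x] by (intro meas) simp
  qed (use w_clique w_pos w_eq_0 X.clique_nonneg in auto)
qed

end

section \<open>Newton's expansion\<close>

definition mset_choose :: "'a multiset \<Rightarrow> 'a multiset \<Rightarrow> nat" where
  "mset_choose \<kappa> \<mu> = (\<Prod>a\<in>set_mset \<mu>. count \<kappa> a choose count \<mu> a)"

lemma mset_choose_superset:
  assumes "finite F" and "\<mu> \<in> mfin F"
  shows "mset_choose \<kappa> \<mu> = (\<Prod>a\<in>F. count \<kappa> a choose count \<mu> a)"
  unfolding mset_choose_def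
  using assms by (intro prod.mono_neutral_left) (auto simp: mfin_def not_in_iff)

lemma mset_choose_eq_0:
  assumes "\<not> \<mu> \<subseteq># \<kappa>"
  shows "mset_choose \<kappa> \<mu> = 0"
proof -
  obtain a where count_less: "count \<kappa> a < count \<mu> a"
    using assms by (auto simp: subseteq_mset_def not_le)
  then have "a \<in># \<mu>" by (metis count_eq_zero_iff not_less_zero)
  then show ?thesis
    unfolding mset_choose_def using count_less by (intro prod_zero) (auto intro!: bexI[of _ a])
qed

lemma mset_choose_pos: "\<mu> \<subseteq># \<kappa> \<Longrightarrow> 0 < mset_choose \<kappa> \<mu>"
  unfolding mset_choose_def by (intro prod_pos) (simp add: mset_subset_eq_count zero_less_binomial)

lemma mset_choose_add_mset:
  "mset_choose (add_mset a \<kappa>) \<mu> =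
      mset_choose \<kappa> \<mu> + (if a \<in># \<mu> then mset_choose \<kappa> (\<mu> - {#a#}) else 0)"
proof -
  let ?r = "\<Prod>b\<in>set_mset \<mu> - {a}. count \<kappa> b choose count \<mu> b"
  have split: "mset_choose \<kappa>' \<mu>' =
      (count \<kappa>' a choose count \<mu>' a) * (\<Prod>b\<in>set_mset \<mu> - {a}. count \<kappa>' b choose count \<mu>' b)"
    if "set_mset \<mu>' \<subseteq> set_mset \<mu>" for \<kappa>' \<mu>'
    using that mset_choose_superset[of "insert a (set_mset \<mu>)" \<mu>' \<kappa>']
    by (simp add: mfin_def prod.insert_remove subset_insertI2)
  have "(\<Prod>b\<in>set_mset \<mu> - {a}. count (add_mset a \<kappa>) b choose count \<mu> b) = ?r"
    and "(\<Prod>b\<in>set_mset \<mu> - {a}. count \<kappa> b choose count (\<mu> - {#a#}) b) = ?r"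
    by (auto intro!: prod.cong split: if_splits)
  then have "mset_choose (add_mset a \<kappa>) \<mu> = (Suc (count \<kappa> a) choose count \<mu> a) * ?r"
    and "mset_choose \<kappa> \<mu> = (count \<kappa> a choose count \<mu> a) * ?r"
    and "mset_choose \<kappa> (\<mu> - {#a#}) = (count \<kappa> a choose (count \<mu> a - 1)) * ?r"
    using split[of \<mu>] split[of "\<mu> - {#a#}" \<kappa>] by (simp_all add: diff_subset_eq_self set_mset_mono)
  moreover have "(Suc (count \<kappa> a) choose count \<mu> a) =
      (count \<kappa> a choose count \<mu> a) + (if a \<in># \<mu> then count \<kappa> a choose (count \<mu> a - 1) else 0)"
    by (cases "count \<mu> a") (auto simp: not_in_iff)
  ultimately show ?thesis by (simp add: distrib_right)
qed

lemma newton_expansion: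
  fixes g :: "'v::comm_monoid_add \<Rightarrow> real"
  shows "g (x + (\<Sum>a\<in>#\<kappa>. h a)) =
      (\<Sum>\<mu> | \<mu> \<subseteq># \<kappa>. real (mset_choose \<kappa> \<mu>) * iter_diff (image_mset h \<mu>) g x)"
proof (induction \<kappa> arbitrary: g)
  case empty
  have "{\<mu>. \<mu> \<subseteq># {#}} = {{#}}" by auto
  then show ?case by (simp add: mset_choose_def)
next
  case (add a \<kappa>)
  let ?M = "\<lambda>\<mu>. iter_diff (image_mset h \<mu>) g x" and ?C = "\<lambda>\<mu>. real (mset_choose \<kappa> \<mu>)"
  let ?S = "{\<mu>. \<mu> \<subseteq># add_mset a \<kappa>}"
  have "g (x + (\<Sum>a\<in>#add_mset a \<kappa>. h a)) = g (x + (\<Sum>a\<in>#\<kappa>. h a) + h a)" by (simp add: add_ac)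
  also have "\<dots> = (\<Sum>\<mu> | \<mu> \<subseteq># \<kappa>. ?C \<mu> * iter_diff (image_mset h \<mu>) g (x + h a))"
    using add.IH[of "\<lambda>x. g (x + h a)"] by (simp add: iter_diff_shift)
  also have "\<dots> = (\<Sum>\<mu> | \<mu> \<subseteq># \<kappa>. ?C \<mu> * ?M \<mu>) + (\<Sum>\<mu> | \<mu> \<subseteq># \<kappa>. ?C \<mu> * ?M (add_mset a \<mu>))"
    unfolding sum.distrib[symmetric]
    by (intro sum.cong) (auto simp: iter_diff_add_mset forward_diff_def algebra_simps)
  also have "(\<Sum>\<mu> | \<mu> \<subseteq># \<kappa>. ?C \<mu> * ?M \<mu>) = (\<Sum>\<mu>\<in>?S. ?C \<mu> * ?M \<mu>)"
    by (rule sum.mono_neutral_left)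
      (auto simp: finite_submultisets mset_choose_eq_0 intro: subset_mset.order_trans[of _ \<kappa>])
  also have "(\<Sum>\<mu> | \<mu> \<subseteq># \<kappa>. ?C \<mu> * ?M (add_mset a \<mu>)) =
      (\<Sum>\<mu> | \<mu> \<subseteq># add_mset a \<kappa> \<and> a \<in># \<mu>. ?C (\<mu> - {#a#}) * ?M \<mu>)"
    by (rule sum.reindex_bij_witness[where i = "\<lambda>\<mu>. \<mu> - {#a#}" and j = "add_mset a"])
      (auto simp: subset_eq_diff_conv)
  also have "\<dots> = (\<Sum>\<mu>\<in>?S. (if a \<in># \<mu> then ?C (\<mu> - {#a#}) else 0) * ?M \<mu>)"
    by (rule sum.mono_neutral_cong_left) (auto simp: finite_submultisets)
  also have "(\<Sum>\<mu>\<in>?S. ?C \<mu> * ?M \<mu>) + \<dots> = (\<Sum>\<mu>\<in>?S. real (mset_choose (add_mset a \<kappa>) \<mu>) * ?M \<mu>)"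
    unfolding sum.distrib[symmetric] mset_choose_add_mset
    by (intro sum.cong) (auto simp: algebra_simps)
  finally show ?case .
qed

lemma choose_le_power_mult:
  assumes "m \<le> n" and "0 < n"
  shows "real (m choose j) \<le> (real m / real n) ^ j * real (n choose j)"
proof (cases "j \<le> m")
  case True
  have "(\<Prod>i = 0..<j. real m - real i) \<le> (\<Prod>i = 0..<j. real m / real n * (real n - real i))"
  proof (rule prod_mono)
    fix i assume "i \<in> {0..<j}"
    then have i_less: "i < m" using True by simp
    have "real m * real i \<le> real n * real i" using assms by (intro mult_right_mono) auto
    then show "0 \<le> real m - real i \<and> real m - real i \<le> real m / real n * (real n - real i)"
      using i_less assms by (simp add: field_simps)
  qed
  also have "\<dots> = (real m / real n) ^ j * (\<Prod>i = 0..<j. real n - real i)"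
    by (simp add: prod.distrib del: times_divide_eq_left)
  finally have "(\<Prod>i = 0..<j. real m - real i) / fact j \<le>
      (real m / real n) ^ j * (\<Prod>i = 0..<j. real n - real i) / fact j"
    by (rule divide_right_mono) simp
  then show ?thesis by (simp add: binomial_gbinomial gbinomial_prod_rev)
qed (simp add: binomial_eq_0)

lemma choose_ratio_LIMSEQ:
  fixes m n :: "nat \<Rightarrow> nat"
  assumes n_at_top: "filterlim n at_top sequentially"
    and ratio_lim: "(\<lambda>k. real (m k) / real (n k)) \<longlonglongrightarrow> t"
  shows "(\<lambda>k. real (m k choose j) / real (n k choose j)) \<longlonglongrightarrow> t ^ j"
proof -
  let ?q = "\<lambda>k i. (real (m k) / real (n k) - real i / real (n k)) / (1 - real i / real (n k))"
  have real_n_at_top: "filterlim (\<lambda>k. real (n k)) at_top sequentially"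
    using n_at_top by (rule filterlim_compose[OF filterlim_real_sequentially])
  have "(\<lambda>k. real i / real (n k)) \<longlonglongrightarrow> 0" for i
    by (rule tendsto_divide_0[OF tendsto_const filterlim_at_top_imp_at_infinity[OF real_n_at_top]])
  then have "(\<lambda>k. \<Prod>i = 0..<j. ?q k i) \<longlonglongrightarrow> (\<Prod>i = 0..<j. (t - 0) / (1 - 0))"
    by (intro tendsto_prod tendsto_divide tendsto_diff ratio_lim tendsto_const) auto
  then have "(\<lambda>k. \<Prod>i = 0..<j. ?q k i) \<longlonglongrightarrow> t ^ j" by simp
  moreover have "\<forall>\<^sub>F k in sequentially. (\<Prod>i = 0..<j. ?q k i) =
      real (m k choose j) / real (n k choose j)"
    using n_at_top[unfolded filterlim_at_top, rule_format, of 1]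
  proof eventually_elim
    case (elim k)
    then have "?q k i = (real (m k) - real i) / (real (n k) - real i)" for i
      by (simp add: divide_simps)
    then show ?case by (simp add: binomial_gbinomial gbinomial_prod_rev prod_dividef)
  qed
  ultimately show ?thesis by (rule Lim_transform_eventually)
qed

lemma count_repeat_mset_set: "finite F \<Longrightarrow>
    count (repeat_mset n (mset_set F)) a = (if a \<in> F then n else 0)"
  by (simp add: count_mset_set')

lemma mset_choose_le_mpow_mult:
  assumes "finite F" and "0 < n" and \<kappa>_subset: "\<kappa> \<subseteq># repeat_mset n (mset_set F)"
    and \<mu>_mfin: "\<mu> \<in> mfin F"
  shows "real (mset_choose \<kappa> \<mu>) \<le>
      mpow (\<lambda>a. real (count \<kappa> a) / real n) \<mu> * real (mset_choose (repeat_mset n (mset_set F)) \<mu>)"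
proof -
  have "real (mset_choose \<kappa> \<mu>) = (\<Prod>a\<in>F. real (count \<kappa> a choose count \<mu> a))"
    by (simp add: mset_choose_superset[OF assms(1) \<mu>_mfin])
  also have "\<dots> \<le> (\<Prod>a\<in>F. (real (count \<kappa> a) / real n) ^ count \<mu> a * real (n choose count \<mu> a))"
  proof (rule prod_mono)
    fix a assume "a \<in> F"
    then have "count \<kappa> a \<le> n"
      using mset_subset_eq_count[OF \<kappa>_subset, of a] assms(1)
      by (simp add: count_repeat_mset_set del: count_repeat_mset)
    then show "0 \<le> real (count \<kappa> a choose count \<mu> a) \<and>
        real (count \<kappa> a choose count \<mu> a) \<le>
          (real (count \<kappa> a) / real n) ^ count \<mu> a * real (n choose count \<mu> a)"
      using choose_le_power_mult assms(2) by simp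
  qed
  also have "\<dots> =
      mpow (\<lambda>a. real (count \<kappa> a) / real n) \<mu> * real (mset_choose (repeat_mset n (mset_set F)) \<mu>)"
    using assms(1)
    by (simp add: mpow_superset[OF assms(1) \<mu>_mfin] mset_choose_superset[OF assms(1) \<mu>_mfin]
      prod.distrib count_repeat_mset_set
        del: count_repeat_mset)
  finally show ?thesis .
qed

lemma mset_choose_ratio_LIMSEQ:
  assumes "finite F" and n_at_top: "filterlim n at_top sequentially" and \<mu>_mfin: "\<mu> \<in> mfin F"
    and lim: "\<And>a. a \<in> F \<Longrightarrow> (\<lambda>k. real (count (\<kappa> k) a) / real (n k)) \<longlonglongrightarrow> t a"
  shows "(\<lambda>k. real (mset_choose (\<kappa> k) \<mu>) / real (mset_choose (repeat_mset (n k) (mset_set F)) \<mu>)) \<longlonglongrightarrow>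
      mpow t \<mu>"
proof -
  have "(\<lambda>k. \<Prod>a\<in>F. real (count (\<kappa> k) a choose count \<mu> a) / real (n k choose count \<mu> a)) \<longlonglongrightarrow>
      (\<Prod>a\<in>F. t a ^ count \<mu> a)"
    using lim by (intro tendsto_prod choose_ratio_LIMSEQ[OF n_at_top]) simp
  then show ?thesis
    using assms(1)
    by (simp add: mpow_superset[OF assms(1) \<mu>_mfin] mset_choose_superset[OF assms(1) \<mu>_mfin]
      prod_dividef count_repeat_mset_set
        del: count_repeat_mset)
qed

section \<open>Absolutely monotone functions on the cube\<close>

lemma has_sum_dominated_convergence:
  fixes f :: "nat \<Rightarrow> 'a \<Rightarrow> real"
  assumes f_nonneg: "\<And>k a. a \<in> A \<Longrightarrow> 0 \<le> f k a" and f_le: "\<And>k a. a \<in> A \<Longrightarrow> f k a \<le> w a"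
    and w_summable: "w summable_on A"
    and lim: "\<And>a. a \<in> A \<Longrightarrow> (\<lambda>k. f k a) \<longlonglongrightarrow> l a" and sum: "\<And>k. (f k has_sum s) A"
  shows "(l has_sum s) A"
proof -
  have w_nonneg: "0 \<le> w a" if "a \<in> A" for a
    using f_nonneg[OF that] f_le[OF that] order_trans by blast
  have l_nonneg: "0 \<le> l a" if "a \<in> A" for a
    using f_nonneg[OF that] by (intro LIMSEQ_le_const[OF lim[OF that]]) simp
  have s_nonneg: "0 \<le> s" using has_sum_nonneg[OF sum f_nonneg] .
  have "(\<lambda>k. esum A (\<lambda>a. ennreal (f k a))) \<longlonglongrightarrow> esum A (\<lambda>a. ennreal (l a))"
  proof (rule nn_integral_dominated_convergence[where w = "\<lambda>a. ennreal (w a)"])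
    show "AE a in count_space A. ennreal (f k a) \<le> ennreal (w a)" for k
      using f_le by (auto simp: AE_count_space intro: ennreal_leI)
    show "esum A (\<lambda>a. ennreal (w a)) < \<infinity>"
      using w_summable w_nonneg by (simp add: summable_on_iff_esum)
    show "AE a in count_space A. (\<lambda>k. ennreal (f k a)) \<longlonglongrightarrow> ennreal (l a)"
      using lim by (auto simp: AE_count_space intro: tendsto_ennrealI)
  qed auto
  moreover have "esum A (\<lambda>a. ennreal (f k a)) = ennreal s" for k
    using sum f_nonneg s_nonneg by (simp add: has_sum_iff_esum)
  ultimately show ?thesis using l_nonneg s_nonneg by (simp add: has_sum_iff_esum LIMSEQ_const_iff)
qed

lemma mpow_summable_on:
  assumes "finite F" and "\<And>a. a \<in> F \<Longrightarrow> 0 \<le> t a \<and> t a < 1"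
  shows "mpow t summable_on mfin F"
  using assms
proof (induction F)
  case empty
  then show ?case by simp
next
  case (insert a F)
  have t_nonneg: "0 \<le> t a" and t_less: "t a < 1" using insert.prems by auto
  have "(\<lambda>j. t a ^ j) summable_on UNIV"
    using t_nonneg t_less summable_geometric[of "t a"]
    by (simp add: summable_on_UNIV_nonneg_real_iff)
  then have "(\<lambda>(j, \<nu>). t a ^ j * mpow t \<nu>) summable_on UNIV \<times> mfin F"
  proof (intro summable_on_SigmaI)
    have "mpow t summable_on mfin F" using insert by simp
    then show
        "((\<lambda>\<nu>. case (j, \<nu>) of (j, \<nu>) \<Rightarrow> t a ^ j * mpow t \<nu>) has_sum
        t a ^ j * infsum (mpow t) (mfin F)) (mfin F)" for j
      by (simp add: has_sum_cmult_right has_sum_infsum)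
    show "(\<lambda>j. t a ^ j * infsum (mpow t) (mfin F)) summable_on UNIV"
      using \<open>(\<lambda>j. t a ^ j) summable_on UNIV\<close> by (rule summable_on_cmult_left)
    show "0 \<le> (case (j, \<nu>) of (j, \<nu>) \<Rightarrow> t a ^ j * mpow t \<nu>)" if "\<nu> \<in> mfin F" for j \<nu>
      using that insert.prems
      by (auto simp: mpow_def mfin_def intro!: mult_nonneg_nonneg prod_nonneg)
  qed
  then have "(\<lambda>p. mpow t (case p of (j, \<nu>) \<Rightarrow> \<nu> + replicate_mset j a)) summable_on UNIV \<times> mfin F"
    by (simp add: case_prod_unfold mult.commute)
  then show ?case
    using summable_on_reindex_bij_betw[OF bij_betw_mfin_insert[OF insert.hyps(2)], of "mpow t"]
    by simp
qed

text \<open>Rounding strictly below \<open>x\<close> keeps the coordinates of the approximating dyadic points below \<open>1\<close>,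
  where the monomials are summable.\<close>

definition dyadic_below :: "nat \<Rightarrow> real \<Rightarrow> nat" where
  "dyadic_below k x = nat (\<lceil>2 ^ k * x\<rceil> - 1)"

lemma dyadic_below_zero [simp]: "dyadic_below k 0 = 0"
  by (simp add: dyadic_below_def)

lemma dyadic_below_less: "x \<le> 1 \<Longrightarrow> dyadic_below k x < 2 ^ k"
proof -
  assume "x \<le> 1"
  then have "\<lceil>2 ^ k * x\<rceil> \<le> 2 ^ k" by (simp add: ceiling_le_iff)
  then show ?thesis by (auto simp: dyadic_below_def nat_less_iff)
qed

lemma dyadic_below_bounds:
  assumes "0 \<le> x"
  shows "2 ^ k * x - 1 \<le> real (dyadic_below k x)" and "real (dyadic_below k x) \<le> 2 ^ k * x"
proof -
  have "0 \<le> 2 ^ k * x" using assms by simp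
  then show "2 ^ k * x - 1 \<le> real (dyadic_below k x)" and "real (dyadic_below k x) \<le> 2 ^ k * x"
    unfolding dyadic_below_def by linarith+
qed

lemma dyadic_below_double: "2 * dyadic_below k x \<le> dyadic_below (Suc k) x"
proof -
  have "2 * (\<lceil>y\<rceil> - 1) \<le> \<lceil>2 * y\<rceil> - 1" for y :: real
    using ceiling_correct[of y] less_ceiling_iff[of "2 * (\<lceil>y\<rceil> - 1)" "2 * y"] by simp
  from this[of "2 ^ k * x"]
  have "nat (2 * (\<lceil>2 ^ k * x\<rceil> - 1)) \<le> dyadic_below (Suc k) x"
    by (simp add: dyadic_below_def nat_mono mult.assoc)
  then show ?thesis by (simp add: dyadic_below_def nat_mult_distrib)
qed

lemma incseq_dyadic_below: "incseq (\<lambda>k. real (dyadic_below k x) / 2 ^ k)"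
proof (rule incseq_SucI)
  fix k
  have "real (2 * dyadic_below k x) \<le> real (dyadic_below (Suc k) x)"
    using dyadic_below_double by (simp only: of_nat_le_iff)
  then show "real (dyadic_below k x) / 2 ^ k \<le> real (dyadic_below (Suc k) x) / 2 ^ Suc k"
    by (simp add: field_simps)
qed

lemma dyadic_below_LIMSEQ:
  assumes "0 \<le> x"
  shows "(\<lambda>k. real (dyadic_below k x) / 2 ^ k) \<longlonglongrightarrow> x"
proof (rule real_tendsto_sandwich)
  show "\<forall>\<^sub>F k in sequentially. x - (1/2) ^ k \<le> real (dyadic_below k x) / 2 ^ k"
    using dyadic_below_bounds(1)[OF assms]
    by (intro always_eventually)
      (simp add: diff_le_eq power_one_over flip: add_divide_distrib, simp add: field_simps)
  show "\<forall>\<^sub>F k in sequentially. real (dyadic_below k x) / 2 ^ k \<le> x"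
    using dyadic_below_bounds(2)[OF assms] by (auto simp: field_simps intro!: always_eventually)
  show "(\<lambda>k. x - (1/2) ^ k) \<longlonglongrightarrow> x"
    using tendsto_diff[OF tendsto_const[of x] LIMSEQ_realpow_zero[of "1/2::real"]] by simp
qed simp

locale unit_cube =
  fixes F :: "'a set" and g :: "('a \<Rightarrow> real) \<Rightarrow> real"
  assumes finite: "finite F"
    and absolutely_monotone: "absolutely_monotone_on {0..indicator F} g"
    and left_continuous: "range y \<subseteq> {0..indicator F} \<Longrightarrow> incseq y \<Longrightarrow> y \<longlonglongrightarrow> z \<Longrightarrow> (\<lambda>k. g (y k)) \<longlonglongrightarrow> g z"
begin

definition step :: "nat \<Rightarrow> 'a \<Rightarrow> 'a \<Rightarrow> real" where
  "step k a = (\<lambda>b. if b = a then 1 / 2 ^ k else 0)"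

definition grid :: "nat \<Rightarrow> 'a multiset" where
  "grid k = repeat_mset (2 ^ k) (mset_set F)"

definition newton_coeff :: "nat \<Rightarrow> 'a multiset \<Rightarrow> real" where
  "newton_coeff k \<mu> = real (mset_choose (grid k) \<mu>) * iter_diff (image_mset (step k) \<mu>) g 0"

lemma count_grid: "count (grid k) a = (if a \<in> F then 2 ^ k else 0)"
  unfolding grid_def by (rule count_repeat_mset_set[OF finite])

lemma subset_grid_iff: "\<kappa> \<subseteq># grid k \<longleftrightarrow> \<kappa> \<in> mfin F \<and> (\<forall>a. count \<kappa> a \<le> 2 ^ k)"
proof -
  have "count \<kappa> a \<le> count (grid k) a \<longleftrightarrow> (a \<in># \<kappa> \<longrightarrow> a \<in> F) \<and> count \<kappa> a \<le> 2 ^ k" for a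
    by (auto simp: count_grid not_in_iff)
  then show ?thesis by (auto simp: subseteq_mset_def mfin_def)
qed

lemma sum_step: "(\<Sum>a\<in>#\<kappa>. step k a) = (\<lambda>b. real (count \<kappa> b) / 2 ^ k)"
  by (induction \<kappa>) (auto simp: step_def fun_eq_iff add_divide_distrib)

lemma grid_point_in_cube: "\<kappa> \<subseteq># grid k \<Longrightarrow> (\<lambda>b. real (count \<kappa> b) / 2 ^ k) \<in> {0..indicator F}"
  by (auto simp: subset_grid_iff mfin_def le_fun_def indicator_def not_in_iff dest!: contra_subsetD)

lemma iter_diff_step_nonneg: "\<mu> \<subseteq># grid k \<Longrightarrow> 0 \<le> iter_diff (image_mset (step k) \<mu>) g 0"
  using grid_point_in_cube[of \<mu> k]
  by (intro absolutely_monotone_onD[OF absolutely_monotone])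
    (auto simp: sum_step step_def le_fun_def)

lemma newton_coeff_nonneg: "0 \<le> newton_coeff k \<mu>"
  using iter_diff_step_nonneg[of \<mu> k] mset_choose_eq_0[of \<mu> "grid k"]
  by (cases "\<mu> \<subseteq># grid k") (auto simp: newton_coeff_def)

lemma grid_point_has_sum:
  assumes \<kappa>_subset: "\<kappa> \<subseteq># grid k"
  shows "((\<lambda>\<mu>. newton_coeff k \<mu> * (real (mset_choose \<kappa> \<mu>) / real (mset_choose (grid k) \<mu>))) has_sum
    g (\<lambda>b. real (count \<kappa> b) / 2 ^ k)) (mfin F)"
proof (rule has_sum_finite_neutralI)
  show "finite {\<mu>. \<mu> \<subseteq># \<kappa>}" by (rule finite_submultisets)
  show "{\<mu>. \<mu> \<subseteq># \<kappa>} \<subseteq> mfin F" using \<kappa>_subset subset_grid_iff subset_mset.order_trans by blast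
  have "g (\<lambda>b. real (count \<kappa> b) / 2 ^ k) =
      (\<Sum>\<mu> | \<mu> \<subseteq># \<kappa>. real (mset_choose \<kappa> \<mu>) * iter_diff (image_mset (step k) \<mu>) g 0)"
    using newton_expansion[of g 0 "step k" \<kappa>] by (simp add: sum_step)
  also have "\<dots> =
      (\<Sum>\<mu> | \<mu> \<subseteq># \<kappa>. newton_coeff k \<mu> * (real (mset_choose \<kappa> \<mu>) / real (mset_choose (grid k) \<mu>)))"
    by (intro sum.cong)
      (auto simp: newton_coeff_def dest: mset_choose_pos[OF subset_mset.order_trans[OF _ \<kappa>_subset]])
  finally show "g (\<lambda>b. real (count \<kappa> b) / 2 ^ k) =
    (\<Sum>\<mu> | \<mu> \<subseteq># \<kappa>. newton_coeff k \<mu> * (real (mset_choose \<kappa> \<mu>) / real (mset_choose (grid k) \<mu>)))" .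
qed (simp add: mset_choose_eq_0)

lemma newton_coeff_le:
  assumes \<mu>_mfin: "\<mu> \<in> mfin F"
  shows "newton_coeff k \<mu> \<le> g (indicator F)"
proof -
  have "(\<lambda>b. real (count (grid k) b) / 2 ^ k) = indicator F" by (auto simp: count_grid)
  moreover have
      "(\<lambda>\<mu>. newton_coeff k \<mu> * (real (mset_choose (grid k) \<mu>) / real (mset_choose (grid k) \<mu>))) =
      newton_coeff k"
    by (auto simp: newton_coeff_def)
  ultimately have sum: "(newton_coeff k has_sum g (indicator F)) (mfin F)"
    using grid_point_has_sum[of "grid k" k] by (simp only: subset_mset.order_refl)
  have "(newton_coeff k has_sum newton_coeff k \<mu>) {\<mu>}" by (rule has_sum_finiteI) auto
  then show ?thesis using sum by (rule has_sum_mono2) (use \<mu>_mfin newton_coeff_nonneg in auto)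
qed

lemma grid_ratio_le:
  assumes "\<kappa> \<subseteq># grid k" and "\<mu> \<in> mfin F"
  shows "real (mset_choose \<kappa> \<mu>) / real (mset_choose (grid k) \<mu>) \<le>
      mpow (\<lambda>a. real (count \<kappa> a) / 2 ^ k) \<mu>"
proof (cases "mset_choose (grid k) \<mu> = 0")
  case True
  then show ?thesis by (simp add: mpow_nonneg le_fun_def)
next
  case False
  then show ?thesis
    using mset_choose_le_mpow_mult[OF finite _ assms(1)[unfolded grid_def] assms(2)]
    by (simp add: grid_def pos_divide_le_eq)
qed

lemma grid_ratio_LIMSEQ:
  assumes n_at_top: "filterlim n at_top sequentially" and \<mu>_mfin: "\<mu> \<in> mfin F"
    and lim: "\<And>a. (\<lambda>k. real (count (\<kappa> k) a) / 2 ^ n k) \<longlonglongrightarrow> t a"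
  shows "(\<lambda>k. real (mset_choose (\<kappa> k) \<mu>) / real (mset_choose (grid (n k)) \<mu>)) \<longlonglongrightarrow> mpow t \<mu>"
  unfolding grid_def
proof (rule mset_choose_ratio_LIMSEQ[OF finite _ \<mu>_mfin])
  show "filterlim (\<lambda>k. 2 ^ n k :: nat) at_top sequentially"
    using n_at_top by (rule filterlim_at_top_mono) (simp add: less_imp_le[OF less_exp])
qed (simp add: lim)

lemma dyadic_point_has_sum:
  assumes r_strict_mono: "strict_mono r"
    and c_lim: "\<And>\<mu>. \<mu> \<in> mfin F \<Longrightarrow> (\<lambda>k. newton_coeff (r k) \<mu>) \<longlonglongrightarrow> c \<mu>"
    and \<kappa>_mfin: "\<kappa> \<in> mfin F" and \<kappa>_less: "\<And>a. count \<kappa> a < 2 ^ j"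
  shows "((\<lambda>\<mu>. c \<mu> * mpow (\<lambda>a. real (count \<kappa> a) / 2 ^ j) \<mu>) has_sum
      g (\<lambda>a. real (count \<kappa> a) / 2 ^ j)) (mfin F)"
proof -
  define t where "t = (\<lambda>a. real (count \<kappa> a) / 2 ^ j)"
  define n where "n k = r (k + j)" for k
  define \<kappa>' where "\<kappa>' k = repeat_mset (2 ^ (n k - j)) \<kappa>" for k
  define q where "q k \<mu> = real (mset_choose (\<kappa>' k) \<mu>) / real (mset_choose (grid (n k)) \<mu>)" for k \<mu>
  let ?B = "g (indicator F)"
  have t_nonneg: "0 \<le> t a" and t_less: "t a < 1" for a using \<kappa>_less[of a] by (simp_all add: t_def)
  have "j \<le> n k" for k using seq_suble[OF r_strict_mono, of "k + j"] by (simp add: n_def)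
  then have pow: "(2 ^ n k :: nat) = 2 ^ (n k - j) * 2 ^ j" for k by (simp flip: power_add)
  have t_eq: "(\<lambda>a. real (count (\<kappa>' k) a) / 2 ^ n k) = t" for k
    using arg_cong[OF pow[of k], of real] by (simp add: \<kappa>'_def t_def)
  have grid_\<kappa>': "\<kappa>' k \<subseteq># grid (n k)" for k
    using \<kappa>_mfin \<kappa>_less
    unfolding subset_grid_iff
    by (auto simp: \<kappa>'_def pow mfin_def less_imp_le simp flip: count_greater_zero_iff)
  have "k \<le> n k" for k using seq_suble[OF r_strict_mono, of "k + j"] by (simp add: n_def)
  then have n_at_top: "filterlim n at_top sequentially"
    by (intro filterlim_at_top_mono[OF filterlim_ident]) simp
  have "((\<lambda>\<mu>. c \<mu> * mpow t \<mu>) has_sum g t) (mfin F)"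
  proof (rule has_sum_dominated_convergence)
    show "((\<lambda>\<mu>. newton_coeff (n k) \<mu> * q k \<mu>) has_sum g t) (mfin F)" for k
      using grid_point_has_sum[OF grid_\<kappa>'[of k]] by (simp add: t_eq q_def)
    show "(\<lambda>\<mu>. ?B * mpow t \<mu>) summable_on mfin F"
      using mpow_summable_on[OF finite] t_nonneg t_less by (intro summable_on_cmult_right) simp
    fix k \<mu> assume \<mu>_mfin: "\<mu> \<in> mfin F"
    show "0 \<le> newton_coeff (n k) \<mu> * q k \<mu>" by (simp add: newton_coeff_nonneg q_def)
    have "q k \<mu> \<le> mpow t \<mu>" using grid_ratio_le[OF grid_\<kappa>'[of k] \<mu>_mfin] by (simp add: t_eq q_def)
    then show "newton_coeff (n k) \<mu> * q k \<mu> \<le> ?B * mpow t \<mu>"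
      using newton_coeff_le[OF \<mu>_mfin, of "n k"]
        order_trans[OF newton_coeff_nonneg newton_coeff_le[OF \<mu>_mfin]]
      by (intro mult_mono) (auto simp: q_def)
    have "(\<lambda>k. newton_coeff (n k) \<mu>) \<longlonglongrightarrow> c \<mu>"
      unfolding n_def by (rule LIMSEQ_ignore_initial_segment[OF c_lim[OF \<mu>_mfin]])
    moreover have "(\<lambda>k. q k \<mu>) \<longlonglongrightarrow> mpow t \<mu>"
      unfolding q_def by (rule grid_ratio_LIMSEQ[OF n_at_top \<mu>_mfin]) (simp add: fun_cong[OF t_eq])
    ultimately show "(\<lambda>k. newton_coeff (n k) \<mu> * q k \<mu>) \<longlonglongrightarrow> c \<mu> * mpow t \<mu>"
      by (rule tendsto_mult)
  qed
  then show ?thesis by (simp add: t_def)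
qed

theorem ex_power_series: "\<exists>c. power_series_on F {0..indicator F} c g"
proof -
  have "norm (newton_coeff k \<mu>) \<le> g (indicator F)" if "\<mu> \<in> mfin F" for k \<mu>
    using newton_coeff_nonneg newton_coeff_le[OF that] by simp
  then obtain r where r_strict_mono: "strict_mono r"
      and "\<And>\<mu>. \<mu> \<in> mfin F \<Longrightarrow> \<exists>l. (\<lambda>k. newton_coeff (r k) \<mu>) \<longlonglongrightarrow> l"
    using function_convergent_subsequence[OF countable_mfin[OF countable_finite[OF finite]]]
    by metis
  then obtain l where l_lim: "\<And>\<mu>. \<mu> \<in> mfin F \<Longrightarrow> (\<lambda>k. newton_coeff (r k) \<mu>) \<longlonglongrightarrow> l \<mu>" by metis
  define c where "c \<mu> = (if \<mu> \<in> mfin F then l \<mu> else 0)" for \<mu>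
  have c_lim: "(\<lambda>k. newton_coeff (r k) \<mu>) \<longlonglongrightarrow> c \<mu>" if "\<mu> \<in> mfin F" for \<mu>
    using l_lim that by (simp add: c_def)
  have c_nonneg: "0 \<le> c"
    by (auto simp: le_fun_def c_def newton_coeff_nonneg intro!: LIMSEQ_le_const[OF l_lim])
  have "((\<lambda>\<mu>. c \<mu> * mpow z \<mu>) has_sum g z) (mfin F)" if z_box: "z \<in> {0..indicator F}" for z
  proof -
    have z_bounds: "0 \<le> z a" "z a \<le> 1" "a \<notin> F \<Longrightarrow> z a = 0" for a
      using z_box by (cases "a \<in> F"; auto simp: le_fun_def dest!: spec[of _ a])+
    define \<kappa> where "\<kappa> k = (\<Sum>a\<in>F. replicate_mset (dyadic_below k (z a)) a)" for k
    have count_\<kappa>: "count (\<kappa> k) a = dyadic_below k (z a)" for k a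
      using finite z_bounds(3)[of a] by (cases "a \<in> F") (auto simp: \<kappa>_def count_sum)
    then have \<kappa>_mfin: "\<kappa> k \<in> mfin F" for k
      using z_bounds(3) by (force simp: mfin_def simp flip: count_greater_zero_iff)
    define y where "y k = (\<lambda>a. real (count (\<kappa> k) a) / 2 ^ k)" for k
    have y_incseq: "incseq y" and y_lim: "y \<longlonglongrightarrow> z"
      using incseq_dyadic_below dyadic_below_LIMSEQ[OF z_bounds(1)]
      by (simp_all add: incseq_fun_iff tendsto_fun_iff y_def count_\<kappa>)
    have y_nonneg: "0 \<le> y k" for k by (simp add: y_def le_fun_def)
    have "y k \<in> {0..indicator F}" for k
      using incseq_LIMSEQ_fun_le[OF y_incseq y_lim, of k] y_nonneg z_box by auto
    then have "(\<lambda>k. g (y k)) \<longlonglongrightarrow> g z" using y_incseq y_lim by (intro left_continuous) auto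
    moreover have "((\<lambda>\<mu>. c \<mu> * mpow (y k) \<mu>) has_sum g (y k)) (mfin F)" for k
      unfolding y_def
      by (rule dyadic_point_has_sum[OF r_strict_mono c_lim \<kappa>_mfin])
        (simp_all add: count_\<kappa> dyadic_below_less z_bounds(2))
    ultimately show ?thesis
      by (intro power_series_has_sum_LIMSEQ[OF c_nonneg y_nonneg y_incseq y_lim])
  qed
  then show ?thesis using c_nonneg by (auto simp: power_series_on_def)
qed

end

section \<open>Stable maps are power series\<close>

lemma box_eq_scaled_cube:
  fixes w :: "'a \<Rightarrow> real"
  assumes w_pos: "\<And>a. a \<in> F \<Longrightarrow> 0 < w a" and w_eq_0: "\<And>a. a \<notin> F \<Longrightarrow> w a = 0"
  shows "{0..w} = (\<lambda>t. w * t) ` {0..indicator F}"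
proof (intro Set.equalityI subsetI)
  have w_nonneg: "0 \<le> w a" for a using w_pos[of a] w_eq_0[of a] by (cases "a \<in> F") auto
  fix x
  show "x \<in> (\<lambda>t. w * t) ` {0..indicator F}" if x_box: "x \<in> {0..w}"
  proof (rule image_eqI)
    have x_bounds: "0 \<le> x a" "x a \<le> w a" for a using x_box by (simp_all add: le_fun_def)
    show "x = w * (\<lambda>a. x a / w a)"
    proof
      show "x a = (w * (\<lambda>a. x a / w a)) a" for a
        using w_pos[of a] w_eq_0[of a] x_bounds[of a] by (cases "a \<in> F") auto
    qed
    show "(\<lambda>a. x a / w a) \<in> {0..indicator F}"
      using w_pos w_eq_0 x_bounds w_nonneg by (auto simp: le_fun_def indicator_def divide_le_eq_1)
  qed
  show "x \<in> {0..w}" if x_image: "x \<in> (\<lambda>t. w * t) ` {0..indicator F}"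
  proof -
    obtain t where x_eq: "x = w * t" and t_box: "t \<in> {0..indicator F}" using x_image by blast
    have "0 \<le> t a" "t a \<le> 1" for a
      using t_box by (cases "a \<in> F"; auto simp: le_fun_def dest!: spec[of _ a])+
    then show ?thesis using w_nonneg by (simp add: x_eq le_fun_def mult_left_le)
  qed
qed

lemma ex_power_series_on_box:
  fixes w :: "'a \<Rightarrow> real"
  assumes F_finite: "finite F" and w_pos: "\<And>a. a \<in> F \<Longrightarrow> 0 < w a" and w_eq_0: "\<And>a. a \<notin> F \<Longrightarrow> w a = 0"
    and mono: "absolutely_monotone_on {0..w} g"
    and cont: "\<And>y z. range y \<subseteq> {0..w} \<Longrightarrow> incseq y \<Longrightarrow> y \<longlonglongrightarrow> z \<Longrightarrow> (\<lambda>k. g (y k)) \<longlonglongrightarrow> g z"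
  shows "\<exists>c. power_series_on F {0..w} c g"
proof -
  have w_nonneg: "0 \<le> w a" for a using w_pos[of a] w_eq_0[of a] by (cases "a \<in> F") auto
  have box: "{0..w} = (\<lambda>t. w * t) ` {0..indicator F}"
    using w_pos w_eq_0 by (rule box_eq_scaled_cube)
  have scaled: "w * t \<in> {0..w}" if "t \<in> {0..indicator F}" for t
    unfolding box using that by (rule imageI)
  interpret unit_cube F "\<lambda>t. g (w * t)"
  proof
    show "absolutely_monotone_on {0..indicator F} (\<lambda>t. g (w * t))"
      using scaled w_nonneg
      by (intro absolutely_monotone_on_comp_additive[OF mono]) (auto simp: distrib_left le_fun_def)
    fix y :: "nat \<Rightarrow> 'a \<Rightarrow> real" and z assume y_range: "range y \<subseteq> {0..indicator F}"
        and y_incseq: "incseq y" and y_lim: "y \<longlonglongrightarrow> z"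
    show "(\<lambda>k. g (w * y k)) \<longlonglongrightarrow> g (w * z)"
    proof (rule cont)
      show "range (\<lambda>k. w * y k) \<subseteq> {0..w}" using y_range scaled by blast
      show "incseq (\<lambda>k. w * y k)"
        using y_incseq w_nonneg by (auto simp: incseq_def le_fun_def intro: mult_left_mono)
      show "(\<lambda>k. w * y k) \<longlonglongrightarrow> w * z"
        using y_lim by (auto simp: tendsto_fun_iff intro: tendsto_mult_left)
    qed
  qed (rule F_finite)
  obtain c where c_series: "power_series_on F {0..indicator F} c (\<lambda>t. g (w * t))"
    using ex_power_series ..
  have "((\<lambda>\<mu>. c \<mu> / mpow w \<mu> * mpow x \<mu>) has_sum g x) (mfin F)" if x_box: "x \<in> {0..w}" for x
  proof -
    obtain t where x_eq: "x = w * t" and t_box: "t \<in> {0..indicator F}"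
      using x_box unfolding box by blast
    have "c \<mu> * mpow t \<mu> = c \<mu> / mpow w \<mu> * mpow x \<mu>" if "\<mu> \<in> mfin F" for \<mu>
      using mpow_pos[of \<mu> w] w_pos that by (auto simp: x_eq mpow_mult mfin_def subset_iff)
    then show ?thesis
      using power_series_on_has_sum[OF c_series t_box] unfolding x_eq by (simp cong: has_sum_cong)
  qed
  moreover have "0 \<le> (\<lambda>\<mu>. c \<mu> / mpow w \<mu>)"
    using power_series_on_nonneg[OF c_series] mpow_nonneg[of w] w_nonneg by (simp add: le_fun_def)
  ultimately have "power_series_on F {0..w} (\<lambda>\<mu>. c \<mu> / mpow w \<mu>) g"
    by (simp add: power_series_on_def)
  then show ?thesis by blast
qed

lemma finite_support_exhaustion:
  fixes x :: "'a \<Rightarrow> real"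
  assumes "countable A" and "0 \<le> x" and "\<And>a. a \<notin> A \<Longrightarrow> x a = 0"
  obtains y where "incseq y" and "y \<longlonglongrightarrow> x" and "\<And>n. 0 \<le> y n" and "\<And>n. finite {a. y n a \<noteq> 0}"
proof -
  define y :: "nat \<Rightarrow> 'a \<Rightarrow> real" where "y n = indicator (from_nat_into A ` {..<n}) * x" for n
  have "incseq y"
    using assms(2) by (auto simp: y_def incseq_def le_fun_def indicator_def intro!: mult_right_mono)
  moreover have "(\<lambda>n. y n a) \<longlonglongrightarrow> x a" for a
  proof (cases "a \<in> A")
    case True
    have "y n a = x a" if "to_nat_on A a < n" for n
      using that from_nat_into_to_nat_on[OF assms(1) True] by (force simp: y_def indicator_def)
    then have "\<forall>\<^sub>F n in sequentially. y n a = x a" by (auto simp: eventually_at_top_dense)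
    then show ?thesis by (rule tendsto_eventually)
  qed (simp add: y_def assms(3))
  then have "y \<longlonglongrightarrow> x" by (simp add: tendsto_fun_iff)
  moreover have "0 \<le> y n" for n using assms(2) by (simp add: y_def le_fun_def)
  moreover have "finite {a. y n a \<noteq> 0}" for n
    by (rule finite_subset[of _ "from_nat_into A ` {..<n}"])
      (auto simp: y_def indicator_def split: if_splits)
  ultimately show ?thesis using that by blast
qed

context coherence_space
begin

context
  fixes g :: "('a \<Rightarrow> real) \<Rightarrow> real"
  assumes mono: "absolutely_monotone_on (cliques X) g"
    and cont: "\<And>y z. range y \<subseteq> cliques X \<Longrightarrow> incseq y \<Longrightarrow> y \<longlonglongrightarrow> z \<Longrightarrow> (\<lambda>k. g (y k)) \<longlonglongrightarrow> g z"
begin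

lemma ex_power_series_below_clique:
  assumes x_clique: "x \<in> cliques X" and fin: "finite {a. x a \<noteq> 0}"
  shows "\<exists>c. power_series_on {a. x a \<noteq> 0} {0..x} c g"
proof (rule ex_power_series_on_box[OF fin])
  have box: "{0..x} \<subseteq> cliques X" using clique_antimono[OF x_clique] by auto
  then show "absolutely_monotone_on {0..x} g" by (rule absolutely_monotone_on_subset[OF mono])
  show "0 < x a" if "a \<in> {a. x a \<noteq> 0}" for a
    using that nonneg_fun_apply[OF clique_nonneg[OF x_clique], of a] by simp
  show "(\<lambda>k. g (y k)) \<longlonglongrightarrow> g z" if "range y \<subseteq> {0..x}" "incseq y" "y \<longlonglongrightarrow> z" for y z
    using that box by (intro cont) auto
qed simp

text \<open>Both expansions restrict to the box below the infimum of the two cliques.\<close>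

lemma power_series_coefficients_agree:
  assumes x_clique: "x \<in> cliques X" and y_clique: "y \<in> cliques X"
    and x_neq_0: "\<And>a. a \<in># \<mu> \<Longrightarrow> x a \<noteq> 0" and y_neq_0: "\<And>a. a \<in># \<mu> \<Longrightarrow> y a \<noteq> 0"
    and c_series: "power_series_on {a. x a \<noteq> 0} {0..x} c g"
    and d_series: "power_series_on {a. y a \<noteq> 0} {0..y} d g"
  shows "c \<mu> = d \<mu>"
proof -
  let ?F = "set_mset \<mu>"
  define v where "v a = (if a \<in># \<mu> then min (x a) (y a) else 0)" for a
  have nonneg: "0 \<le> x a" "0 \<le> y a" for a
    using clique_nonneg[OF x_clique] clique_nonneg[OF y_clique] by (simp_all add: le_fun_def)
  have v_nonneg: "0 \<le> v" and v_le_x: "v \<le> x" and v_le_y: "v \<le> y"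
    using nonneg by (auto simp: v_def le_fun_def)
  have outside: "z a = 0" if "z \<in> {0..v}" "a \<notin> ?F" for z a
    using that by (auto simp: v_def le_fun_def intro!: antisym dest!: spec[of _ a])
  have "power_series_on ?F {0..v} c g"
    by (rule power_series_on_restrict[OF c_series]) (use x_neq_0 v_le_x outside in auto)
  moreover have "power_series_on ?F {0..v} d g"
    by (rule power_series_on_restrict[OF d_series]) (use y_neq_0 v_le_y outside in auto)
  ultimately show ?thesis
  proof (rule power_series_on_coefficient_unique[of ?F v, rotated 3])
    show "0 < v a" if "a \<in> ?F" for a
      using that x_neq_0[OF that] y_neq_0[OF that] nonneg[of a] by (simp add: v_def)
  qed (use v_nonneg in auto)
qed

lemma ex_power_series_positive_on:
  assumes "\<mu> \<in> mfin (web X)"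
  shows "\<exists>w d. w \<in> cliques X \<and> (\<forall>a\<in>#\<mu>. w a \<noteq> 0) \<and> power_series_on {a. w a \<noteq> 0} {0..w} d g"
proof -
  have "set_mset \<mu> \<subseteq> web X" using assms by (simp add: mfin_def)
  then obtain w where w_clique: "w \<in> cliques X" and w_pos: "\<And>a. a \<in># \<mu> \<Longrightarrow> 0 < w a"
      and "\<And>a. a \<notin># \<mu> \<Longrightarrow> w a = 0"
    using clique_with_support[OF finite_set_mset] by metis
  then have "finite {a. w a \<noteq> 0}" by (intro finite_subset[OF _ finite_set_mset[of \<mu>]]) auto
  then show ?thesis
    using ex_power_series_below_clique[OF w_clique] w_clique w_pos by (metis less_irrefl)
qed

lemma ex_power_series_finite_support:
  "\<exists>c\<ge>0. \<forall>x\<in>cliques X. finite {a. x a \<noteq> 0} \<longrightarrow> ((\<lambda>\<mu>. c \<mu> * mpow x \<mu>) has_sum g x) (mfin (web X))"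
proof -
  obtain w d where w_clique: "\<And>\<mu>. \<mu> \<in> mfin (web X) \<Longrightarrow> w \<mu> \<in> cliques X"
      and w_neq_0: "\<And>\<mu> a. \<mu> \<in> mfin (web X) \<Longrightarrow> a \<in># \<mu> \<Longrightarrow> w \<mu> a \<noteq> 0"
      and d_series: "\<And>\<mu>. \<mu> \<in> mfin (web X) \<Longrightarrow> power_series_on {a. w \<mu> a \<noteq> 0} {0..w \<mu>} (d \<mu>) g"
    using ex_power_series_positive_on by metis
  define c where "c \<mu> = (if \<mu> \<in> mfin (web X) then d \<mu> \<mu> else 0)" for \<mu>
  have "((\<lambda>\<mu>. c \<mu> * mpow x \<mu>) has_sum g x) (mfin (web X))"
      if x_clique: "x \<in> cliques X" and fin: "finite {a. x a \<noteq> 0}" for x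
  proof -
    let ?F = "{a. x a \<noteq> 0}"
    have F_subset: "?F \<subseteq> web X" using clique_outside[OF x_clique] by auto
    obtain e where e_series: "power_series_on ?F {0..x} e g"
      using ex_power_series_below_clique[OF x_clique fin] ..
    have "c \<mu> = e \<mu>" if "\<mu> \<in> mfin ?F" for \<mu>
    proof -
      have \<mu>_mfin: "\<mu> \<in> mfin (web X)" using mfin_mono[OF F_subset] that by blast
      have "d \<mu> \<mu> = e \<mu>"
        by (rule power_series_coefficients_agree[OF w_clique[OF \<mu>_mfin] x_clique w_neq_0[OF \<mu>_mfin]
          _ d_series[OF \<mu>_mfin] e_series])
          (use that in \<open>auto simp: mfin_def\<close>)
      then show ?thesis by (simp add: c_def \<mu>_mfin)
    qed
    moreover have "((\<lambda>\<mu>. e \<mu> * mpow x \<mu>) has_sum g x) (mfin ?F)"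
      using power_series_on_has_sum[OF e_series, of x] clique_nonneg[OF x_clique] by simp
    ultimately show ?thesis
      by (subst has_sum_mfin_support[OF F_subset]) (simp_all cong: has_sum_cong)
  qed
  moreover have "0 \<le> c" using power_series_on_nonneg[OF d_series] by (simp add: c_def le_fun_def)
  ultimately show ?thesis by blast
qed

theorem ex_power_series_on_cliques: "\<exists>c. power_series_on (web X) (cliques X) c g"
proof -
  obtain c where c_nonneg: "0 \<le> c" and sum: "\<And>x. x \<in> cliques X \<Longrightarrow> finite {a. x a \<noteq> 0} \<Longrightarrow>
      ((\<lambda>\<mu>. c \<mu> * mpow x \<mu>) has_sum g x) (mfin (web X))"
    using ex_power_series_finite_support by blast
  have "((\<lambda>\<mu>. c \<mu> * mpow x \<mu>) has_sum g x) (mfin (web X))" if x_clique: "x \<in> cliques X" for x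
  proof -
    obtain y where y_incseq: "incseq y" and y_lim: "y \<longlonglongrightarrow> x" and y_nonneg: "\<And>n. 0 \<le> y n"
        and y_finite: "\<And>n. finite {a. y n a \<noteq> 0}"
      using finite_support_exhaustion[OF countable_web clique_nonneg[OF x_clique] clique_outside[OF
        x_clique]] by blast
    have clique: "y n \<in> cliques X" for n
      by (rule clique_antimono[OF x_clique y_nonneg incseq_LIMSEQ_fun_le[OF y_incseq y_lim]])
    then have "(\<lambda>n. g (y n)) \<longlonglongrightarrow> g x" using y_incseq y_lim by (intro cont) auto
    then show ?thesis
      by (rule power_series_has_sum_LIMSEQ[OF c_nonneg y_nonneg y_incseq y_lim sum[OF clique
        y_finite]])
  qed
  then show ?thesis using c_nonneg by (auto simp: power_series_on_def)
qed

end

end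

context coherence_space_pair
begin

lemma stable_has_sum:
  assumes \<phi>_stable: "stable (Fm X) (Fm Y) \<phi>"
  obtains f where "f \<in> nnvecs (mfin (web X) \<times> web Y)"
    and "\<And>x b. x \<in> cliques X \<Longrightarrow> ((\<lambda>\<mu>. f (\<mu>, b) * mpow x \<mu>) has_sum \<phi> x b) (mfin (web X))"
proof -
  note stable = \<phi>_stable[unfolded stable_Fm_iff]
  have "\<exists>c. power_series_on (web X) (cliques X) c (\<lambda>x. \<phi> x b)" for b
    using stable by (intro X.ex_power_series_on_cliques) (auto simp: tendsto_fun_iff)
  then obtain c where c_series: "\<And>b. power_series_on (web X) (cliques X) (c b) (\<lambda>x. \<phi> x b)" by metis
  define f where "f = (\<lambda>(\<mu>, b). if \<mu> \<in> mfin (web X) \<and> b \<in> web Y then c b \<mu> else 0)"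
  show ?thesis
  proof
    show "f \<in> nnvecs (mfin (web X) \<times> web Y)"
      using power_series_on_nonneg[OF c_series] by (auto simp: nnvecs_def f_def)
    fix x b assume x_clique: "x \<in> cliques X"
    show "((\<lambda>\<mu>. f (\<mu>, b) * mpow x \<mu>) has_sum \<phi> x b) (mfin (web X))"
    proof (cases "b \<in> web Y")
      case True
      then show ?thesis
        using power_series_on_has_sum[OF c_series x_clique, of b]
        by (simp add: f_def cong: has_sum_cong)
    next
      case False
      moreover have "\<phi> x \<in> elems (Fm Y)" using stable x_clique by auto
      ultimately show ?thesis using Y.elem_outside[of "\<phi> x" b] by (simp add: f_def)
    qed
  qed
qed

lemma stable_eq_Fm_map:
  assumes \<phi>_stable: "stable (Fm X) (Fm Y) \<phi>" and "0 < c"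
    and bound: "\<And>x. x \<in> cliques X \<Longrightarrow> cnorm (Fm Y) (\<phi> x) \<le> c"
  obtains u where "u \<in> pcoh_hom X Y" and "Fm_map X (\<lambda>p. c * u p) = \<phi>"
proof -
  obtain f where f_nnvecs: "f \<in> nnvecs (mfin (web X) \<times> web Y)"
    and sum: "\<And>x b. x \<in> cliques X \<Longrightarrow> ((\<lambda>\<mu>. f (\<mu>, b) * mpow x \<mu>) has_sum \<phi> x b) (mfin (web X))"
    using stable_has_sum[OF \<phi>_stable] by blast
  define u where "u p = f p / c" for p
  have u_nnvecs: "u \<in> nnvecs (mfin (web X) \<times> web Y)"
    using f_nnvecs \<open>0 < c\<close> by (auto simp: nnvecs_def u_def)
  have elem: "\<phi> x \<in> elems (Fm Y)" if "x \<in> cliques X" for x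
    using \<phi>_stable that unfolding stable_Fm_iff by auto
  have clique: "(\<lambda>b. \<phi> x b / c) \<in> cliques Y" if x_clique: "x \<in> cliques X" for x
    using Y.norm_le_iff[OF elem[OF x_clique]] bound[OF x_clique] \<open>0 < c\<close> by auto
  have ehat: "ehat X u x b = ennreal (\<phi> x b / c)" if x_clique: "x \<in> cliques X" for x b
    using has_sum_cmult_left[OF sum[OF x_clique, of b], of "1 / c"] u_nnvecs
      X.clique_nonneg[OF x_clique]
      nonneg_fun_apply[OF Y.elem_nonneg[OF elem[OF x_clique]], of b] \<open>0 < c\<close>
    by (subst ehat_eq_iff_has_sum) (simp_all add: u_def nnvecs_iff)
  note hom = pcoh_homI[OF u_nnvecs clique ehat]
  have "Fm_map X (\<lambda>p. c * u p) = \<phi>"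
  proof
    fix x
    show "Fm_map X (\<lambda>p. c * u p) x = \<phi> x"
    proof (cases "x \<in> cliques X")
      case True
      then show ?thesis using \<open>0 < c\<close> by (simp add: Fm_map_apply hat_scale hom(2))
    next
      case False
      then show ?thesis
        using \<phi>_stable
        unfolding stable_Fm_iff by (auto simp: Fm_map_def X.unit_ball_Fm PiE_iff extensional_def)
    qed
  qed
  then show ?thesis using hom(1) that by blast
qed

lemma Fm_map_full:
  assumes \<phi>_cstab_hom: "\<phi> \<in> cstab_hom (Fm X) (Fm Y)"
  obtains f where "f \<in> pcoh_hom X Y" and "Fm_map X f = \<phi>"
proof -
  have "\<phi> x \<in> unit_ball (Fm Y)" if "x \<in> cliques X" for x
    using \<phi>_cstab_hom that by (simp add: cstab_hom_def X.unit_ball_Fm)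
  then have "cnorm (Fm Y) (\<phi> x) \<le> 1" if "x \<in> cliques X" for x
    using that by (simp add: unit_ball_def)
  moreover have "stable (Fm X) (Fm Y) \<phi>"
    using \<phi>_cstab_hom by (simp add: cstab_hom_def meas_stable_def)
  ultimately show ?thesis using stable_eq_Fm_map[of \<phi> 1] that by auto
qed

lemma inj_on_Fm_map: "inj_on (Fm_map X) (elems (Fm (pcs_exp X Y)))"
proof (rule inj_onI)
  fix f g assume elems: "f \<in> elems (Fm (pcs_exp X Y))" "g \<in> elems (Fm (pcs_exp X Y))"
      and "Fm_map X f = Fm_map X g"
  then have "hat X f x = hat X g x" if "x \<in> cliques X" for x using that by (metis Fm_map_apply)
  then show "f = g" by (rule hat_eqD[OF elems])
qed

lemma Fm_map_faithful: "inj_on (Fm_map X) (pcoh_hom X Y)"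
  using inj_on_Fm_map by (rule inj_on_subset) (auto intro: pcoh_hom_elem)

lemma Fm_map_image: "Fm_map X ` elems (Fm (pcs_exp X Y)) = meas_stable (Fm X) (Fm Y)"
proof
  show "Fm_map X ` elems (Fm (pcs_exp X Y)) \<subseteq> meas_stable (Fm X) (Fm Y)"
    using Fm_map_in_meas_stable by blast
  show "meas_stable (Fm X) (Fm Y) \<subseteq> Fm_map X ` elems (Fm (pcs_exp X Y))"
  proof
    fix \<phi> assume "\<phi> \<in> meas_stable (Fm X) (Fm Y)"
    then have \<phi>_stable: "stable (Fm X) (Fm Y) \<phi>" by (simp add: meas_stable_def)
    then obtain B where "\<And>x. x \<in> cliques X \<Longrightarrow> cnorm (Fm Y) (\<phi> x) \<le> B"
      unfolding stable_Fm_iff by blast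
    then have bound: "cnorm (Fm Y) (\<phi> x) \<le> max B 1" if "x \<in> cliques X" for x
      using that by (simp add: max.coboundedI1)
    obtain u where u_hom: "u \<in> pcoh_hom X Y" and u_map: "Fm_map X (\<lambda>p. max B 1 * u p) = \<phi>"
      by (rule stable_eq_Fm_map[OF \<phi>_stable _ bound]) auto
    have "(\<lambda>p. max B 1 * u p) \<in> elems (Fm (pcs_exp X Y))"
      by (rule XY.scale_elem(1)[OF pcoh_hom_elem[OF u_hom]]) simp
    then show "\<phi> \<in> Fm_map X ` elems (Fm (pcs_exp X Y))" using u_map by blast
  qed
qed

end

section \<open>Exponentials\<close>

lemma elems_cone_exp [simp]: "elems (cone_exp C D) = meas_stable C D"
  and czero_cone_exp [simp]: "czero (cone_exp C D) = (\<lambda>x\<in>unit_ball C. czero D)"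
  and cadd_cone_exp [simp]: "cadd (cone_exp C D) f g = (\<lambda>x\<in>unit_ball C. cadd D (f x) (g x))"
  and cscale_cone_exp [simp]: "cscale (cone_exp C D) \<alpha> f = (\<lambda>x\<in>unit_ball C. cscale D \<alpha> (f x))"
  and cnorm_cone_exp: "cnorm (cone_exp C D) f = (SUP x\<in>unit_ball C. cnorm D (f x))"
  and tests_cone_exp: "tests (cone_exp C D) n =
      {\<lambda>r f. m r (f (\<gamma> r)) | \<gamma> m. unitary_path C n \<gamma> \<and> m \<in> tests D n}"
  by (simp_all add: cone_exp_def)

context coherence_space_pair
begin

lemma norm_Fm_map:
  assumes f_elem: "f \<in> elems (Fm (pcs_exp X Y))"
  shows "cnorm (cone_exp (Fm X) (Fm Y)) (Fm_map X f) = cnorm (Fm (pcs_exp X Y)) f"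
proof (rule antisym)
  let ?N = "cnorm (cone_exp (Fm X) (Fm Y)) (Fm_map X f)"
  have norm_hat_le: "cnorm (Fm Y) (Fm_map X f x) \<le> cnorm (Fm (pcs_exp X Y)) f"
      if "x \<in> cliques X" for x
    using hat_elem(2)[OF f_elem that] by (simp add: Fm_map_apply that)
  then show "?N \<le> cnorm (Fm (pcs_exp X Y)) f"
    unfolding cnorm_cone_exp X.unit_ball_Fm using X.clique_zero by (intro cSUP_least) auto
  have norm_le: "cnorm (Fm Y) (Fm_map X f x) \<le> ?N" if "x \<in> cliques X" for x
    unfolding cnorm_cone_exp X.unit_ball_Fm
    using norm_hat_le that by (intro cSUP_upper) (auto intro!: bdd_aboveI2)
  have "0 \<le> cnorm (Fm Y) (Fm_map X f 0)"
    using hat_elem(1)[OF f_elem X.clique_zero]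
    by (simp add: Fm_map_apply X.clique_zero Y.norm_nonneg)
  then have "0 \<le> ?N" using norm_le[OF X.clique_zero] by (rule order_trans)
  show "cnorm (Fm (pcs_exp X Y)) f \<le> ?N"
  proof (rule dense_ge)
    fix c assume norm_less: "?N < c"
    then have "0 < c" using \<open>0 \<le> ?N\<close> by simp
    have bound: "cnorm (Fm Y) (Fm_map X f x) \<le> c" if "x \<in> cliques X" for x
      using norm_le[OF that] norm_less by simp
    obtain u where u_hom: "u \<in> pcoh_hom X Y" and u_map: "Fm_map X (\<lambda>p. c * u p) = Fm_map X f"
      by (rule stable_eq_Fm_map[OF stable_Fm_map[OF f_elem] \<open>0 < c\<close> bound]) auto
    have "(\<lambda>p. c * u p) \<in> elems (Fm (pcs_exp X Y))"
      using XY.scale_elem(1)[OF pcoh_hom_elem[OF u_hom]] \<open>0 < c\<close> by simp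
    then have "f = (\<lambda>p. c * u p)" using u_map f_elem inj_on_eq_iff[OF inj_on_Fm_map] by metis
    then show "cnorm (Fm (pcs_exp X Y)) f \<le> c"
      using XY.norm_le_iff[OF f_elem, of c] u_hom \<open>0 < c\<close> by auto
  qed
qed

sublocale exp: cone_isometry "Fm (pcs_exp X Y)" "cone_exp (Fm X) (Fm Y)" "Fm_map X"
proof
  show "seq_complete (Fm (pcs_exp X Y))" by (rule XY.seq_complete_Fm)
  show "bij_betw (Fm_map X) (elems (Fm (pcs_exp X Y))) (elems (cone_exp (Fm X) (Fm Y)))"
    by (simp add: bij_betw_def inj_on_Fm_map Fm_map_image)
  show "Fm_map X (czero (Fm (pcs_exp X Y))) = czero (cone_exp (Fm X) (Fm Y))"
    by (simp add: Fm_map_def hat_def zero_fun_def)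
  show "Fm_map X (cadd (Fm (pcs_exp X Y)) f g) =
      cadd (cone_exp (Fm X) (Fm Y)) (Fm_map X f) (Fm_map X g)"
    if "f \<in> elems (Fm (pcs_exp X Y))" "g \<in> elems (Fm (pcs_exp X Y))" for f g
    using hat_add[OF that] by (auto simp: Fm_map_def X.unit_ball_Fm intro: restrict_ext)
  show "Fm_map X (cscale (Fm (pcs_exp X Y)) \<alpha> f) = cscale (cone_exp (Fm X) (Fm Y)) \<alpha> (Fm_map X f)"
      for \<alpha> f
    by (auto simp: Fm_map_def hat_scale intro: restrict_ext)
qed (rule norm_Fm_map)

lemma linear_scott_hat:
  assumes x_clique: "x \<in> cliques X"
  shows "linear_scott (Fm (pcs_exp X Y)) (\<lambda>f. hat X f x b)"
proof (rule XY.linear_scott_FmI)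
  fix F f assume "incseq F" "\<And>n. F n \<in> elems (Fm (pcs_exp X Y))" "f \<in> elems (Fm (pcs_exp X Y))"
      "F \<longlonglongrightarrow> f"
  then have "(\<lambda>n. hat X (F n) x) \<longlonglongrightarrow> hat X f x" using x_clique by (intro hat_LIMSEQ) simp_all
  then show "(\<lambda>n. hat X (F n) x b) \<longlonglongrightarrow> hat X f x b" by (simp add: tendsto_fun_iff)
qed (use x_clique in \<open>simp_all add: hat_nonneg hat_add hat_scale\<close>)

lemma exp_test_cases:
  assumes "l \<in> tests (cone_exp (Fm X) (Fm Y)) n"
  obtains "l = (\<lambda>r f. 0)"
    | \<gamma> b where "unitary_path (Fm X) n \<gamma>" and "b \<in> web Y" and "l = (\<lambda>r f. f (\<gamma> r) b)"
  using assms by (auto simp: tests_cone_exp tests_Fm)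

lemma exp_testI:
  assumes "unitary_path (Fm X) n \<gamma>" and "b \<in> web Y"
  shows "(\<lambda>r f. f (\<gamma> r) b) \<in> tests (cone_exp (Fm X) (Fm Y)) n"
  unfolding tests_cone_exp tests_Fm
  using assms by (intro CollectI exI[of _ \<gamma>] exI[of _ "\<lambda>r y. y b"]) auto

lemma exp_test_zero: "(\<lambda>r f. 0) \<in> tests (cone_exp (Fm X) (Fm Y)) n"
proof -
  have "unitary_path (Fm X) n (\<lambda>s. 0)" by (simp add: X.unitary_path_Fm_iff X.clique_zero)
  then show ?thesis unfolding tests_cone_exp tests_Fm by fastforce
qed

lemma linear_scott_exp_test:
  assumes l_test: "l \<in> tests (cone_exp (Fm X) (Fm Y)) n" and r_space: "r \<in> space (Rn n)"
  shows "linear_scott (cone_exp (Fm X) (Fm Y)) (l r)"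
proof (rule exp.linear_scott_image)
  show "linear_scott (Fm (pcs_exp X Y)) (\<lambda>f. l r (Fm_map X f))"
    using l_test
  proof (cases rule: exp_test_cases)
    case 1
    then show ?thesis by (simp add: XY.linear_scott_zero)
  next
    case (2 \<gamma> b)
    then have "\<gamma> r \<in> cliques X" using r_space by (simp add: X.unitary_path_Fm_iff)
    then show ?thesis by (simp add: 2(3) Fm_map_apply linear_scott_hat)
  qed
qed

lemma exp_test_comp:
  assumes l_test: "l \<in> tests (cone_exp (Fm X) (Fm Y)) n" and h_measurable: "h \<in> Rn m \<rightarrow>\<^sub>M Rn n"
  shows "(\<lambda>r. l (h r)) \<in> tests (cone_exp (Fm X) (Fm Y)) m"
  using l_test
proof (cases rule: exp_test_cases)
  case 1
  then show ?thesis by (simp add: exp_test_zero)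
next
  case (2 \<gamma> b)
  then have "unitary_path (Fm X) m (\<lambda>r. \<gamma> (h r))"
    using measurable_space[OF h_measurable]
    by (auto simp: X.unitary_path_Fm_iff intro!: measurable_compose[OF h_measurable])
  then show ?thesis using exp_testI 2(2) by (simp add: 2(3))
qed

lemma exp_test_borel_measurable:
  assumes l_test: "l \<in> tests (cone_exp (Fm X) (Fm Y)) n"
    and f_meas_stable: "f \<in> meas_stable (Fm X) (Fm Y)"
  shows "(\<lambda>r. l r f) \<in> borel_measurable (Rn n)"
  using l_test
proof (cases rule: exp_test_cases)
  case (2 \<gamma> b)
  then have "meas_path (Fm Y) n (\<lambda>r. f (\<gamma> r))" using f_meas_stable by (simp add: meas_stable_def)
  then show ?thesis unfolding 2(3) by (rule Y.meas_path_Fm_coordinate)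
qed simp

lemma measurable_cone_exp: "measurable_cone (cone_exp (Fm X) (Fm Y))" (is "measurable_cone ?C")
  unfolding measurable_cone_def
proof (intro conjI exp.is_cone_image exp.seq_complete_image)
  show "\<forall>n. \<forall>l\<in>tests ?C n. \<forall>r\<in>space (Rn n). linear_scott ?C (l r)"
    using linear_scott_exp_test by blast
  show "\<forall>n. \<exists>l\<in>tests ?C n. \<forall>r\<in>space (Rn n). \<forall>f\<in>elems ?C. l r f = 0"
    using exp_test_zero by (intro allI) (rule bexI[rotated], auto)
  show "\<forall>m n. \<forall>l\<in>tests ?C n. \<forall>h\<in>Rn m \<rightarrow>\<^sub>M Rn n.
      \<exists>l'\<in>tests ?C m. \<forall>r\<in>space (Rn m). \<forall>f\<in>elems ?C. l' r f = l (h r) f"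
    using exp_test_comp by (intro allI ballI) (rule bexI[rotated], auto)
  show "\<forall>n. \<forall>l\<in>tests ?C n. \<forall>f\<in>elems ?C.
      (\<lambda>r. l r f) \<in> borel_measurable (Rn n)"
    using exp_test_borel_measurable by simp
qed

lemma meas_path_Fm_map:
  assumes F_unitary: "unitary_path (Fm (pcs_exp X Y)) n F"
  shows "meas_path (cone_exp (Fm X) (Fm Y)) n (\<lambda>s. Fm_map X (F s))"
  unfolding meas_path_def
proof (intro conjI allI ballI)
  have elem: "F s \<in> elems (Fm (pcs_exp X Y))" and norm: "cnorm (Fm (pcs_exp X Y)) (F s) \<le> 1"
    if "s \<in> space (Rn n)" for s
    using F_unitary that by (auto simp: unitary_path_def unit_ball_def)
  show "Fm_map X (F s) \<in> elems (cone_exp (Fm X) (Fm Y))" if "s \<in> space (Rn n)" for s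
    using elem[OF that] by (rule exp.map_closed)
  show "\<exists>B. \<forall>s\<in>space (Rn n). cnorm (cone_exp (Fm X) (Fm Y)) (Fm_map X (F s)) \<le> B"
    using elem norm by (intro exI[of _ 1]) (simp add: norm_Fm_map)
  fix k l assume "l \<in> tests (cone_exp (Fm X) (Fm Y)) k"
  then show "(\<lambda>(r, s). l r (Fm_map X (F s))) \<in> borel_measurable (Rn k \<Otimes>\<^sub>M Rn n)"
  proof (cases rule: exp_test_cases)
    case (2 \<gamma> b)
    have \<gamma>_clique: "\<gamma> r \<in> cliques X" if "r \<in> space (Rn k)" for r
      using 2(1) that by (simp add: X.unitary_path_Fm_iff)
    have "(\<lambda>p. hat X (F (snd p)) (\<gamma> (fst p)) b) \<in> borel_measurable (Rn k \<Otimes>\<^sub>M Rn n)"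
      using F_unitary 2(1) elem \<gamma>_clique
      by (intro borel_measurable_hat measurable_compose[OF measurable_snd] measurable_compose[OF
        measurable_fst])
        (auto simp: unitary_path_def space_pair_measure X.meas_path_Fm_coordinate
            XY.meas_path_Fm_coordinate)
    then show ?thesis
      by (rule measurable_cong[THEN iffD1, rotated])
        (auto simp: 2(3) space_pair_measure Fm_map_apply \<gamma>_clique)
  qed simp
qed

lemma meas_path_inverse_Fm_map:
  assumes F_unitary: "unitary_path (cone_exp (Fm X) (Fm Y)) n F"
  shows "meas_path (Fm (pcs_exp X Y)) n (\<lambda>s. exp.inverse (F s))"
  unfolding XY.meas_path_Fm_iff
proof (intro conjI ballI)
  have path: "meas_path (cone_exp (Fm X) (Fm Y)) n F"
      and elem: "F s \<in> elems (cone_exp (Fm X) (Fm Y))"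
    and norm: "cnorm (cone_exp (Fm X) (Fm Y)) (F s) \<le> 1" if "s \<in> space (Rn n)" for s
    using F_unitary that unfolding unitary_path_def unit_ball_def by auto
  show inverse: "exp.inverse (F s) \<in> elems (Fm (pcs_exp X Y))" if "s \<in> space (Rn n)" for s
    using elem[OF that] by (rule exp.inverse_closed)
  show "\<exists>B. \<forall>s\<in>space (Rn n). cnorm (Fm (pcs_exp X Y)) (exp.inverse (F s)) \<le> B"
    using norm elem norm_Fm_map[OF inverse] exp.map_inverse by (intro exI[of _ 1]) auto
  fix p assume "p \<in> web (pcs_exp X Y)"
  then obtain \<mu> b where p_eq: "p = (\<mu>, b)" and \<mu>_mfin: "\<mu> \<in> mfin (web X)" and b_web: "b \<in> web Y"
    by auto
  have "(\<lambda>s. hat X (exp.inverse (F s)) x b) \<in> borel_measurable (Rn n)"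
      if x_clique: "x \<in> cliques X" for x
  proof -
    have "unitary_path (Fm X) 0 (\<lambda>r. x)" using x_clique by (simp add: X.unitary_path_Fm_iff)
    then have "(\<lambda>s. F s x b) \<in> borel_measurable (Rn n)"
      using meas_path_test_measurable[OF _ exp_testI[of 0 "\<lambda>r. x" b], of n F "\<lambda>_. undefined"]
        F_unitary b_web
      by (simp add: unitary_path_def space_PiM)
    then show ?thesis
      by (rule measurable_cong[THEN iffD1, rotated])
        (metis Fm_map_apply elem exp.map_inverse x_clique)
  qed
  then show "(\<lambda>s. exp.inverse (F s) p) \<in> borel_measurable (Rn n)"
    unfolding p_eq by (rule matrix_entry_borel_measurable[rotated]) (use inverse \<mu>_mfin in auto)
qed

lemma cstab_iso_exp: "cstab_iso (Fm (pcs_exp X Y)) (cone_exp (Fm X) (Fm Y)) (exp_map X Y)"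
  unfolding exp_map_def
  by (intro exp.cstab_iso_restrict XY.measurable_cone_Fm measurable_cone_exp meas_path_Fm_map
    meas_path_inverse_Fm_map)

end

section \<open>Products\<close>

lemma web_prod [simp]: "web (pcs_prod I X) = (SIGMA i:I. web (X i))"
  and prod_clique_iff: "x \<in> cliques (pcs_prod I X) \<longleftrightarrow>
    x \<in> nnvecs (SIGMA i:I. web (X i)) \<and> (\<forall>i\<in>I. (\<lambda>a. x (i, a)) \<in> cliques (X i))"
  by (simp_all add: pcs_prod_def)

lemma nnvecs_component: "x \<in> nnvecs (Sigma I A) \<Longrightarrow>
    (\<lambda>a. x (i, a)) \<in> nnvecs (if i \<in> I then A i else {})"
  by (auto simp: nnvecs_iff le_fun_def)

definition inject :: "'i \<Rightarrow> ('a \<Rightarrow> real) \<Rightarrow> 'i \<times> 'a \<Rightarrow> real" where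
  "inject i v = (\<lambda>(j, a). if j = i then v a else 0)"

lemma inject_nnvecs: "i \<in> I \<Longrightarrow> v \<in> nnvecs (A i) \<Longrightarrow> inject i v \<in> nnvecs (Sigma I A)"
  by (auto simp: inject_def nnvecs_def)

lemma esum_inject:
  assumes "i \<in> I"
  shows "esum (Sigma I A) (\<lambda>p. ennreal (x p * inject i v p)) =
      esum (A i) (\<lambda>a. ennreal (x (i, a) * v a))"
proof -
  have "esum (Sigma I A) (\<lambda>p. ennreal (x p * inject i v p)) =
      esum (Pair i ` A i) (\<lambda>p. ennreal (x p * inject i v p))"
    by (rule nn_integral_count_space_eq) (use assms in \<open>auto simp: inject_def\<close>)
  also have "\<dots> = esum (A i) (\<lambda>a. ennreal (x (i, a) * inject i v (i, a)))"
    by (rule nn_integral_bij_count_space[symmetric]) (auto intro!: bij_betw_imageI inj_onI)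
  finally show ?thesis by (simp add: inject_def)
qed

lemma is_pcs_prod:
  assumes "countable I" and X_pcs: "\<And>i. i \<in> I \<Longrightarrow> is_pcs (X i)"
  shows "is_pcs (pcs_prod I X)"
proof -
  let ?A = "SIGMA i:I. web (X i)" and ?D = "\<lambda>i. pdual (web (X i)) (cliques (X i))"
  let ?S = "\<Union>i\<in>I. inject i ` ?D i"
  have coherence: "coherence_space (X i)" if "i \<in> I" for i
    using X_pcs[OF that] by (rule coherence_space.intro)
  have S_nnvecs: "?S \<subseteq> nnvecs ?A"
    using pdual_subset_nnvecs by (fastforce intro: inject_nnvecs)
  have "x \<in> cliques (pcs_prod I X) \<longleftrightarrow> x \<in> pdual ?A ?S" for x
  proof -
    have "(\<lambda>a. x (i, a)) \<in> cliques (X i) \<longleftrightarrow>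
        (\<forall>v\<in>?D i. esum ?A (\<lambda>p. ennreal (x p * inject i v p)) \<le> 1)"
      if "x \<in> nnvecs ?A" "i \<in> I" for i
      using nnvecs_component[OF that(1), of i] that(2)
      by (simp add: coherence_space.clique_iff_esum[OF coherence] esum_inject)
    then show ?thesis by (auto simp: prod_clique_iff pdual_iff_esum[OF S_nnvecs])
  qed
  then have "pcs_prod I X = \<lparr>web = ?A, cliques = pdual ?A ?S\<rparr>" by (auto intro: pcs.equality)
  moreover have "is_pcs \<lparr>web = ?A, cliques = pdual ?A ?S\<rparr>"
  proof (rule is_pcs_pdual[OF _ S_nnvecs])
    show "countable ?A"
      using assms(1) coherence_space.countable_web[OF coherence] by (intro countable_SIGMA)
    fix p assume "p \<in> ?A"
    then obtain i a where p_eq: "p = (i, a)" and i_in: "i \<in> I" and a_web: "a \<in> web (X i)" by blast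
    obtain v where "v \<in> ?D i" "0 < v a"
      using coherence_space.dual_clique_positive[OF coherence[OF i_in] a_web] .
    then have "inject i v \<in> ?S" "0 < inject i v p" using i_in by (auto simp: p_eq inject_def)
    then show "\<exists>s\<in>?S. 0 < s p" by blast
    obtain B where "\<And>v. v \<in> ?D i \<Longrightarrow> v a \<le> B"
      using coherence_space.dual_clique_bound[OF coherence[OF i_in] a_web] by blast
    then have "inject j v p \<le> max B 0" if "v \<in> ?D j" for j v
      using that by (auto simp: p_eq inject_def max.coboundedI1)
    then show "\<exists>B. \<forall>s\<in>?S. s p \<le> B" by blast
  qed
  ultimately show ?thesis by simp
qed

lemma elems_cone_prod [simp]: "elems (cone_prod I C) = (\<Pi>\<^sub>E i\<in>I. elems (C i))"
  and czero_cone_prod [simp]: "czero (cone_prod I C) = (\<lambda>i\<in>I. czero (C i))"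
  and cadd_cone_prod [simp]: "cadd (cone_prod I C) x y = (\<lambda>i\<in>I. cadd (C i) (x i) (y i))"
  and cscale_cone_prod [simp]: "cscale (cone_prod I C) \<alpha> x = (\<lambda>i\<in>I. cscale (C i) \<alpha> (x i))"
  and tests_cone_prod: "tests (cone_prod I C) n =
      {\<lambda>r x. \<Sum>i\<in>I. l i r (x i) | l. \<forall>i\<in>I. l i \<in> tests (C i) n}"
  by (simp_all add: cone_prod_def)

lemma cnorm_cone_prod_le_iff:
  "finite I \<Longrightarrow> cnorm (cone_prod I C) x \<le> c \<longleftrightarrow> 0 \<le> c \<and> (\<forall>i\<in>I. cnorm (C i) (x i) \<le> c)"
  by (simp add: cone_prod_def)

definition tuple :: "'i set \<Rightarrow> ('i \<times> 'a \<Rightarrow> real) \<Rightarrow> 'i \<Rightarrow> 'a \<Rightarrow> real" where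
  "tuple I x = (\<lambda>i\<in>I. \<lambda>a. x (i, a))"

locale coherence_space_product =
  fixes I :: "'i set" and X :: "'i \<Rightarrow> 'a pcs"
  assumes finite: "finite I" and component: "i \<in> I \<Longrightarrow> coherence_space (X i)"
begin

sublocale product: coherence_space "pcs_prod I X"
  using finite component
  by (intro coherence_space.intro is_pcs_prod countable_finite) (simp_all add: coherence_space_def)

lemma scaled_prod_clique_iff:
  assumes x_nnvecs: "x \<in> nnvecs (web (pcs_prod I X))"
  shows "(\<exists>u\<in>cliques (pcs_prod I X). x = (\<lambda>p. c * u p)) \<longleftrightarrow>
    (\<forall>i\<in>I. \<exists>u\<in>cliques (X i). (\<lambda>a. x (i, a)) = (\<lambda>a. c * u a))" (is "?L \<longleftrightarrow> ?R")
proof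
  show ?R if ?L using that by (auto simp: prod_clique_iff)
  assume ?R
  then obtain u where u_clique: "\<And>i. i \<in> I \<Longrightarrow> u i \<in> cliques (X i)"
      and x_eq: "\<And>i a. i \<in> I \<Longrightarrow> x (i, a) = c * u i a"
    by (metis fun_cong)
  define v where "v = (\<lambda>(i, a). if i \<in> I then u i a else 0)"
  have "v \<in> cliques (pcs_prod I X)"
    using u_clique coherence_space.clique_nnvecs[OF component u_clique]
    by (auto simp: prod_clique_iff v_def nnvecs_def)
  moreover have "x = (\<lambda>p. c * v p)" using x_nnvecs x_eq by (auto simp: v_def nnvecs_iff fun_eq_iff)
  ultimately show ?L by blast
qed

lemma prod_elem_iff:
  "x \<in> elems (Fm (pcs_prod I X)) \<longleftrightarrow>
     x \<in> nnvecs (web (pcs_prod I X)) \<and> (\<forall>i\<in>I. (\<lambda>a. x (i, a)) \<in> elems (Fm (X i)))" (is "?L \<longleftrightarrow> ?R")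
proof
  assume left: ?L
  then obtain c where "0 \<le> c" "\<exists>u\<in>cliques (pcs_prod I X). x = (\<lambda>p. c * u p)"
    unfolding Fm_elem_iff by blast
  then show ?R
    using scaled_prod_clique_iff product.elem_nnvecs[OF left] unfolding Fm_elem_iff by blast
next
  assume right: ?R
  let ?c = "Max (insert 0 ((\<lambda>i. cnorm (Fm (X i)) (\<lambda>a. x (i, a))) ` I))"
  have "0 \<le> ?c" and "cnorm (Fm (X i)) (\<lambda>a. x (i, a)) \<le> ?c" if "i \<in> I" for i
    using finite that by simp_all
  then have "\<exists>u\<in>cliques (X i). (\<lambda>a. x (i, a)) = (\<lambda>a. ?c * u a)" if "i \<in> I" for i
    using right that coherence_space.norm_le_iff[OF component[OF that]] by blast
  moreover have "0 \<le> ?c" using finite by simp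
  ultimately show ?L using right scaled_prod_clique_iff[of x ?c] unfolding Fm_elem_iff by blast
qed

lemma norm_tuple:
  assumes x_elem: "x \<in> elems (Fm (pcs_prod I X))"
  shows "cnorm (cone_prod I (\<lambda>i. Fm (X i))) (tuple I x) = cnorm (Fm (pcs_prod I X)) x"
proof -
  let ?m = "cnorm (cone_prod I (\<lambda>i. Fm (X i))) (tuple I x)" and ?n = "cnorm (Fm (pcs_prod I X)) x"
  have elems: "x \<in> nnvecs (web (pcs_prod I X))" "\<And>i. i \<in> I \<Longrightarrow> (\<lambda>a. x (i, a)) \<in> elems (Fm (X i))"
    using x_elem unfolding prod_elem_iff by blast+
  have "?m \<le> c \<longleftrightarrow> ?n \<le> c" if c_nonneg: "0 \<le> c" for c
    using elems(2) c_nonneg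
    by (simp add: cnorm_cone_prod_le_iff finite tuple_def product.norm_le_iff[OF x_elem c_nonneg]
      scaled_prod_clique_iff[OF elems(1)]
        coherence_space.norm_le_iff[OF component])
  moreover have "0 \<le> ?m"
    using cnorm_cone_prod_le_iff[OF finite, of "\<lambda>i. Fm (X i)" "tuple I x" ?m] by simp
  moreover have "0 \<le> ?n" by (rule product.norm_nonneg[OF x_elem])
  ultimately show ?thesis by (meson antisym order_refl)
qed

lemma bij_betw_tuple:
  "bij_betw (tuple I) (elems (Fm (pcs_prod I X))) (elems (cone_prod I (\<lambda>i. Fm (X i))))"
proof (rule bij_betw_byWitness[where f' = "\<lambda>y (i, a). if i \<in> I then y i a else 0"])
  show "\<forall>x\<in>elems (Fm (pcs_prod I X)). (\<lambda>(i, a). if i \<in> I then tuple I x i a else 0) = x"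
    by (auto simp: tuple_def fun_eq_iff product.elem_outside)
  show "\<forall>y\<in>elems (cone_prod I (\<lambda>i. Fm (X i))). tuple I (\<lambda>(i, a). if i \<in> I then y i a else 0) = y"
    by (auto simp: tuple_def fun_eq_iff PiE_iff extensional_def)
  show "tuple I ` elems (Fm (pcs_prod I X)) \<subseteq> elems (cone_prod I (\<lambda>i. Fm (X i)))"
    by (auto simp: tuple_def prod_elem_iff)
  show "(\<lambda>y (i, a). if i \<in> I then y i a else 0) ` elems (cone_prod I (\<lambda>i. Fm (X i))) \<subseteq>
      elems (Fm (pcs_prod I X))"
    using coherence_space.elem_nnvecs[OF component]
    by (fastforce simp: prod_elem_iff nnvecs_def PiE_iff)
qed

sublocale product: cone_isometry "Fm (pcs_prod I X)" "cone_prod I (\<lambda>i. Fm (X i))" "tuple I"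
proof
  show "seq_complete (Fm (pcs_prod I X))" by (rule product.seq_complete_Fm)
  show "bij_betw (tuple I) (elems (Fm (pcs_prod I X))) (elems (cone_prod I (\<lambda>i. Fm (X i))))"
    by (rule bij_betw_tuple)
qed (simp_all add: tuple_def norm_tuple[unfolded tuple_def] zero_fun_def plus_fun_def
    cong: restrict_cong)

lemma prod_test_iff:
  "l \<in> tests (cone_prod I (\<lambda>i. Fm (X i))) n \<longleftrightarrow>
     (\<exists>e. l = (\<lambda>r x. \<Sum>i\<in>I. e i (x i)) \<and> (\<forall>i\<in>I. e i = (\<lambda>x. 0) \<or> (\<exists>a\<in>web (X i). e i = (\<lambda>x. x a))))"
    (is "?L \<longleftrightarrow> ?R")
proof
  assume ?L
  then obtain m where l_eq: "l = (\<lambda>r x. \<Sum>i\<in>I. m i r (x i))"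
      and m_test: "\<And>i. i \<in> I \<Longrightarrow> m i \<in> tests (Fm (X i)) n"
    by (auto simp: tests_cone_prod)
  have "\<forall>i\<in>I. \<exists>e. m i = (\<lambda>r. e) \<and> (e = (\<lambda>x. 0) \<or> (\<exists>a\<in>web (X i). e = (\<lambda>x. x a)))"
    using m_test by (auto simp: tests_Fm)
  then obtain e where "\<forall>i\<in>I. m i = (\<lambda>r. e i) \<and> (e i = (\<lambda>x. 0) \<or> (\<exists>a\<in>web (X i). e i = (\<lambda>x. x a)))"
    by (rule bchoice[THEN exE])
  then show ?R by (intro exI[of _ e]) (simp add: l_eq)
next
  assume ?R
  then obtain e where l_eq: "l = (\<lambda>r x. \<Sum>i\<in>I. e i (x i))"
    and e_cases: "\<And>i. i \<in> I \<Longrightarrow> e i = (\<lambda>x. 0) \<or> (\<exists>a\<in>web (X i). e i = (\<lambda>x. x a))" by blast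
  have "(\<lambda>r. e i) \<in> tests (Fm (X i)) n" if "i \<in> I" for i
    using e_cases[OF that] by (auto simp: tests_Fm)
  then show ?L unfolding tests_cone_prod l_eq by (intro CollectI exI[of _ "\<lambda>i r. e i"]) simp
qed

lemma prod_coordinate_test:
  assumes "i \<in> I" and "a \<in> web (X i)"
  shows "(\<lambda>r x. \<Sum>j\<in>I. if j = i then x j a else 0) \<in> tests (cone_prod I (\<lambda>i. Fm (X i))) n"
  unfolding prod_test_iff using assms
  by (intro exI[of _ "\<lambda>j. if j = i then (\<lambda>x. x a) else (\<lambda>x. 0)"]) (auto intro!: ext sum.cong)

lemma linear_scott_prod_test:
  assumes "l \<in> tests (cone_prod I (\<lambda>i. Fm (X i))) n"
  shows "linear_scott (cone_prod I (\<lambda>i. Fm (X i))) (l r)"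
proof (rule product.linear_scott_image)
  obtain e where l_eq: "l = (\<lambda>r x. \<Sum>i\<in>I. e i (x i))"
    and e_cases: "\<And>i. i \<in> I \<Longrightarrow> e i = (\<lambda>x. 0) \<or> (\<exists>a\<in>web (X i). e i = (\<lambda>x. x a))"
    using assms unfolding prod_test_iff by blast
  have "linear_scott (Fm (pcs_prod I X)) (\<lambda>x. e i (tuple I x i))" if "i \<in> I" for i
    using e_cases[OF that] that
    by (auto simp: tuple_def product.linear_scott_zero product.linear_scott_coordinate)
  then show "linear_scott (Fm (pcs_prod I X)) (\<lambda>x. l r (tuple I x))"
    unfolding l_eq by (rule linear_scott_sum)
qed

lemma measurable_cone_prod: "measurable_cone (cone_prod I (\<lambda>i. Fm (X i)))" (is "measurable_cone ?C")
  unfolding measurable_cone_def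
proof (intro conjI product.is_cone_image product.seq_complete_image)
  show "\<forall>n. \<forall>l\<in>tests ?C n. \<forall>r\<in>space (Rn n). linear_scott ?C (l r)"
    using linear_scott_prod_test by blast
  have "(\<lambda>r x. \<Sum>i\<in>I. 0) \<in> tests ?C n" for n
    unfolding prod_test_iff by (intro exI[of _ "\<lambda>i x. 0"]) simp
  then show "\<forall>n. \<exists>l\<in>tests ?C n. \<forall>r\<in>space (Rn n). \<forall>x\<in>elems ?C. l r x = 0"
    by (intro allI) (rule bexI[rotated], auto)
  have "l \<in> tests ?C m \<and> (\<forall>r r'. l r = l r')" if "l \<in> tests ?C n" for m n l
    using that unfolding prod_test_iff by blast
  then show
      "\<forall>m n. \<forall>l\<in>tests ?C n. \<forall>h\<in>Rn m \<rightarrow>\<^sub>M Rn n. \<exists>l'\<in>tests ?C m. \<forall>r\<in>space (Rn m). \<forall>x\<in>elems ?C. l' r x =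
      l (h r) x"
    by metis
  have "(\<lambda>r. l r x) \<in> borel_measurable (Rn n)" if "l \<in> tests ?C n" for n l x
    using that unfolding prod_test_iff by auto
  then show "\<forall>n. \<forall>l\<in>tests ?C n. \<forall>x\<in>elems ?C. (\<lambda>r. l r x) \<in> borel_measurable (Rn n)" by blast
qed

lemma meas_path_tuple:
  assumes \<gamma>_unitary: "unitary_path (Fm (pcs_prod I X)) n \<gamma>"
  shows "meas_path (cone_prod I (\<lambda>i. Fm (X i))) n (\<lambda>s. tuple I (\<gamma> s))"
  unfolding meas_path_def
proof (intro conjI allI ballI)
  have \<gamma>_elem: "\<gamma> s \<in> elems (Fm (pcs_prod I X))" and norm: "cnorm (Fm (pcs_prod I X)) (\<gamma> s) \<le> 1"
    if "s \<in> space (Rn n)" for s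
    using \<gamma>_unitary that by (auto simp: unitary_path_def unit_ball_def)
  show "tuple I (\<gamma> s) \<in> elems (cone_prod I (\<lambda>i. Fm (X i)))" if "s \<in> space (Rn n)" for s
    using \<gamma>_elem[OF that] by (rule product.map_closed)
  show "\<exists>B. \<forall>s\<in>space (Rn n). cnorm (cone_prod I (\<lambda>i. Fm (X i))) (tuple I (\<gamma> s)) \<le> B"
    using \<gamma>_elem norm by (intro exI[of _ 1]) (simp add: norm_tuple)
  fix k l assume "l \<in> tests (cone_prod I (\<lambda>i. Fm (X i))) k"
  then obtain e where l_eq: "l = (\<lambda>r x. \<Sum>i\<in>I. e i (x i))"
    and e_cases: "\<And>i. i \<in> I \<Longrightarrow> e i = (\<lambda>x. 0) \<or> (\<exists>a\<in>web (X i). e i = (\<lambda>x. x a))"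
    unfolding prod_test_iff by blast
  have coordinate: "(\<lambda>s. \<gamma> s p) \<in> borel_measurable (Rn n)" for p
    using \<gamma>_unitary by (simp add: unitary_path_def product.meas_path_Fm_coordinate)
  have "(\<lambda>s. e i (tuple I (\<gamma> s) i)) \<in> borel_measurable (Rn n)" if "i \<in> I" for i
    using e_cases[OF that] that coordinate by (auto simp: tuple_def)
  then show "(\<lambda>(r, s). l r (tuple I (\<gamma> s))) \<in> borel_measurable (Rn k \<Otimes>\<^sub>M Rn n)"
    unfolding l_eq case_prod_beta
    by (intro borel_measurable_sum measurable_compose[OF measurable_snd])
qed

lemma meas_path_inverse_tuple:
  assumes \<gamma>_unitary: "unitary_path (cone_prod I (\<lambda>i. Fm (X i))) n \<gamma>"
  shows "meas_path (Fm (pcs_prod I X)) n (\<lambda>s. product.inverse (\<gamma> s))"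
  unfolding product.meas_path_Fm_iff
proof (intro conjI ballI)
  have \<gamma>_elem: "\<gamma> s \<in> elems (cone_prod I (\<lambda>i. Fm (X i)))"
    and norm: "cnorm (cone_prod I (\<lambda>i. Fm (X i))) (\<gamma> s) \<le> 1" if "s \<in> space (Rn n)" for s
    using \<gamma>_unitary that unfolding unitary_path_def unit_ball_def by auto
  show inverse: "product.inverse (\<gamma> s) \<in> elems (Fm (pcs_prod I X))" if "s \<in> space (Rn n)" for s
    using \<gamma>_elem[OF that] by (rule product.inverse_closed)
  show "\<exists>B. \<forall>s\<in>space (Rn n). cnorm (Fm (pcs_prod I X)) (product.inverse (\<gamma> s)) \<le> B"
  proof (intro exI[of _ 1] ballI)
    fix s assume s_space: "s \<in> space (Rn n)"
    then show "cnorm (Fm (pcs_prod I X)) (product.inverse (\<gamma> s)) \<le> 1"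
      using norm[OF s_space] norm_tuple[OF inverse[OF s_space]]
        product.map_inverse[OF \<gamma>_elem[OF s_space]] by simp
  qed
  fix p assume "p \<in> web (pcs_prod I X)"
  then obtain i a where p_eq: "p = (i, a)" and i_in: "i \<in> I" and a_web: "a \<in> web (X i)" by auto
  have "(\<lambda>s. \<Sum>j\<in>I. if j = i then \<gamma> s j a else 0) \<in> borel_measurable (Rn n)"
    using meas_path_test_measurable[OF _ prod_coordinate_test[OF i_in a_web, of 0], of n \<gamma>
      "\<lambda>_. undefined"] \<gamma>_unitary
    by (simp add: unitary_path_def space_PiM)
  then have "(\<lambda>s. \<gamma> s i a) \<in> borel_measurable (Rn n)" using finite i_in by simp
  moreover have "product.inverse (\<gamma> s) p = \<gamma> s i a" if s_space: "s \<in> space (Rn n)" for s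
    using product.map_inverse[OF \<gamma>_elem[OF s_space]] i_in
    by (auto simp: p_eq tuple_def dest!: fun_cong[of _ _ i] fun_cong[of _ _ a])
  ultimately show "(\<lambda>s. product.inverse (\<gamma> s) p) \<in> borel_measurable (Rn n)"
    by (subst measurable_cong) auto
qed

lemma cstab_iso_prod: "cstab_iso (Fm (pcs_prod I X)) (cone_prod I (\<lambda>i. Fm (X i))) (prod_map I X)"
proof -
  have "prod_map I X = restrict (tuple I) (unit_ball (Fm (pcs_prod I X)))"
    by (simp add: prod_map_def tuple_def[abs_def])
  then show ?thesis
    using product.cstab_iso_restrict[OF product.measurable_cone_Fm measurable_cone_prod
      meas_path_tuple meas_path_inverse_tuple]
    by simp
qed

end

theorem theorem5p15:
  fixes X :: "'a pcs" and Y :: "'b pcs" and Z :: "'c pcs"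
    and I :: "'i set" and Xs :: "'i \<Rightarrow> 'd pcs"
  assumes "is_pcs X" and "is_pcs Y" and "is_pcs Z"
    and "finite I" and "\<forall>i\<in>I. is_pcs (Xs i)"
  shows
    "\<comment> \<open>functor\<close>
     measurable_cone (Fm X) \<and>
     (\<forall>f\<in>pcoh_hom X Y. Fm_map X f \<in> cstab_hom (Fm X) (Fm Y)) \<and>
     pcoh_id X \<in> pcoh_hom X X \<and> Fm_map X (pcoh_id X) = cstab_id (Fm X) \<and>
     (\<forall>f\<in>pcoh_hom X Y. \<forall>g\<in>pcoh_hom Y Z.
        pcoh_comp Y g f \<in> pcoh_hom X Z \<and>
        Fm_map X (pcoh_comp Y g f) = cstab_comp (Fm X) (Fm_map Y g) (Fm_map X f)) \<and>
     \<comment> \<open>full\<close>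
     (\<forall>\<phi>\<in>cstab_hom (Fm X) (Fm Y). \<exists>f\<in>pcoh_hom X Y. Fm_map X f = \<phi>) \<and>
     \<comment> \<open>faithful\<close>
     inj_on (Fm_map X) (pcoh_hom X Y) \<and>
     \<comment> \<open>finite products\<close>
     is_pcs (pcs_prod I Xs) \<and>
     cstab_iso (Fm (pcs_prod I Xs)) (cone_prod I (\<lambda>i. Fm (Xs i))) (prod_map I Xs) \<and>
     \<comment> \<open>exponentials\<close>
     is_pcs (pcs_exp X Y) \<and>
     cstab_iso (Fm (pcs_exp X Y)) (cone_exp (Fm X) (Fm Y)) (exp_map X Y)"
proof -
  interpret coherence_space_triple X Y Z
    using assms(1-3) by unfold_locales
  interpret product: coherence_space_product I Xs
    using assms(4,5) by unfold_locales simp_all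
  have full: "\<exists>f\<in>pcoh_hom X Y. Fm_map X f = \<phi>" if "\<phi> \<in> cstab_hom (Fm X) (Fm Y)" for \<phi>
    using XY.Fm_map_full[OF that] by metis
  show ?thesis
    using XY.X.measurable_cone_Fm XY.Fm_map_in_cstab_hom
      XY.X.pcoh_id_in_pcoh_hom XY.X.Fm_map_pcoh_id
      pcoh_comp_in_pcoh_hom(1) Fm_map_pcoh_comp full XY.Fm_map_faithful
      product.product.is_pcs product.cstab_iso_prod XY.is_pcs_exp XY.cstab_iso_exp
    by (intro conjI ballI)
qed

end
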